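(* Assume that $G(o,o|z)=\sum_{n\ge0}\mathbb{P}[X_n=o]z^n$ has radius of convergence $\mathscr{R}>1$. Let $W_0:\mathcal{E}_1\cup\mathcal{E}_2\to[0,\infty)$ be a non-negative weight function such that, for all sequences $(e_n)_{n\in\mathbb{N}}$ of edges in $\mathcal{E}_1\cup\mathcal{E}_2$ with $d_{\mathcal{X}}(o,\mathrm{start}(e_n))=n$ for all $n\in\mathbb{N}$, $$\limsup_{n\to\infty}\frac{|W_0(e_n)|}{\exp(\lambda n)}=0\quad\text{for all }\lambda>0,$$ and let $W:\mathcal{E}\to[0,\infty)$ be its extension to all edges of $\mathcal{X}$. For $[u_0,\dots,u_m]\in\Pi$ let $\ell_W([u_0,\dots,u_m])=d_{\mathrm{weights}}(u_0,u_m)$. Then there exists a constant $\mathfrak{c}_{\mathrm{weight\text{-}dist}}$ such that $$\mathfrak{c}_{\mathrm{weight\text{-}dist}}=\lim_{n\to\infty}\frac{\ell_W\bigl([X_0,\ldots,X_n]\bigr)}{n}\quad\text{almost surely.}$$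
   Context: Notation: $\mathbb{N}=\{1,2,\dots\}$, $\mathbb{N}_0=\mathbb{N}\cup\{0\}$. Free product. Let $V_1,V_2$ be disjoint finite or countable sets with $|V_i|\ge 2$, not both of cardinality $2$, with distinguished elements (roots) $o_i\in V_i$; put $V_i^\times=V_i\setminus\{o_i\}$. For $i\in\{1,2\}$ let $P_i=(p_i(x,y))_{x,y\in V_i}$ be a transition matrix on $V_i$ with $p_i(x,x)=0$ for all $x\in V_i$ and such that for every $x\in V_i$ there is $n_x\in\mathbb{N}$ with $p_i^{(n_x)}(o_i,x)>0$ ($p_i^{(n)}$ denotes $n$-step transition probabilities). The free product $V=V_1*V_2$ is the set of all finite words $v_1\dots v_n$, $n\in\mathbb{N}$, with letters in $V_1^\times\cup V_2^\times$ such that no two consecutive letters lie in the same $V_i^\times$, together with the empty word $o$; both $o_1,o_2$ are identified with $o$, so $V_i\subset V$. Type: $\delta(v_1\dots v_n)=i$ if $v_n\in V_i^\times$ ($o$ has no type). Words are concatenated whenever the result lies in $V$, with $uo=ou=u$. Random walk. Fix $\alpha\in(0,1)$. Put $\bar p_i(uv,uw)=p_i(v,w)$ for $u\in V$ with $\delta(u)\ne i$ ($u=o$ allowed) and $v,w\in V_i$, and $\bar p_i(x,y)=0$ otherwise. Let $P=\alpha\bar P_1+(1-\alpha)\bar P_2=(p(x,y))_{x,y\in V}$, and let $(X_n)_{n\in\mathbb{N}_0}$ be the Markov chain on $V$ with transition matrix $P$ and $X_0=o$. Let $\mathcal{X}$ be the directed graph on $V$ with an edge from $x$ to $y$ iff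 $p(x,y)>0$. A path is a finite sequence $[v_0,\dots,v_n]$, $n\in\mathbb{N}_0$, with an edge from $v_{i-1}$ to $v_i$ for each $i$; its length is $n$. $\Pi$ is the set of all finite paths. $d_{\mathcal{X}}(u,v)$ is the minimal length of a path from $u$ to $v$. Weights. $\mathcal{E}_i=\{[u,v]: u,v\in V_i,\ p_i(u,v)>0\}$ for $i\in\{1,2\}$ and $\mathcal{E}=\{[u,v]: u,v\in V,\ p(u,v)>0\}$. For $e=[u,v]\in\mathcal{E}_1\cup\mathcal{E}_2$, $\mathrm{start}(e)=u$ (regarded as an element of $V$). Each edge in $\mathcal{E}$ has the form $[xu,xv]$ for exactly one edge $[u,v]\in\mathcal{E}_1\cup\mathcal{E}_2$, where $[u,v]\in\mathcal{E}_i$ and $x\in V$ with $\delta(x)\neq i$ (or $x=o$); the extension $W$ of $W_0$ is defined by $W([xu,xv])=W_0([u,v])$. For $\pi=[u_0,\dots,u_m]\in\Pi$, $f_W(\pi)=\sum_{i=1}^mW([u_{i-1},u_i])$, and $d_{\mathrm{weights}}(u,v)=\inf\{f_W(\pi): \pi\in\Pi\text{ is a path from }u\text{ to }v\}$.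
   Formalization: The constant is taken in [0,∞]; it is claimed finite only when W_0 is bounded on the edges starting at each fixed distance from o (automatic for locally finite graphs), since with infinitely many edges at one distance the limit can be infinite. *)

theory Defs
  imports "HOL-Probability.Probability"
begin

section \<open>Free products of two rooted sets\<close>

text \<open>
  The two factors are given as families indexed by \<open>i \<in> {1, 2}\<close>: the vertex set \<open>V i\<close>, its
  root \<open>rt i\<close> and the transition function \<open>p i\<close>. Values at other indices, and of \<open>p i\<close> outside
  \<open>V i\<close>, play no role. Words are lists of letters and the empty word is \<open>[]\<close>.
\<close>

primrec nstep :: "'a set \<Rightarrow> ('a \<Rightarrow> 'a \<Rightarrow> real) \<Rightarrow> nat \<Rightarrow> 'a \<Rightarrow> 'a \<Rightarrow> real" where
  "nstep S q 0 x y = (if x = y then 1 else 0)"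
| "nstep S q (Suc n) x y = (\<Sum>\<^sub>\<infinity>w\<in>S. q x w * nstep S q n w y)"

definition transition_matrix :: "'a set \<Rightarrow> ('a \<Rightarrow> 'a \<Rightarrow> real) \<Rightarrow> bool" where
  "transition_matrix S q \<longleftrightarrow>
     (\<forall>x\<in>S. (\<forall>y\<in>S. 0 \<le> q x y) \<and> ((\<lambda>y. q x y) has_sum 1) S)"

text \<open>\<open>card\<close> is \<open>0\<close> on infinite sets, which is why infinite factors are listed separately.\<close>

definition free_product_setting ::
  "(nat \<Rightarrow> 'a set) \<Rightarrow> (nat \<Rightarrow> 'a) \<Rightarrow> (nat \<Rightarrow> 'a \<Rightarrow> 'a \<Rightarrow> real) \<Rightarrow> real \<Rightarrow> bool" where
  "free_product_setting V rt p \<alpha> \<longleftrightarrow>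
     V 1 \<inter> V 2 = {} \<and>
     (\<forall>i\<in>{1,2}.
        countable (V i) \<and> rt i \<in> V i \<and>
        transition_matrix (V i) (p i) \<and>
        (\<forall>x\<in>V i. p i x x = 0) \<and>
        (\<forall>x\<in>V i. \<exists>n\<ge>1. nstep (V i) (p i) n (rt i) x > 0)) \<and>
     (\<forall>i\<in>{1,2}. infinite (V i) \<or> card (V i) \<ge> 2) \<and>
     \<not> (card (V 1) = 2 \<and> card (V 2) = 2) \<and>
     0 < \<alpha> \<and> \<alpha> < 1"

context
  fixes V :: "nat \<Rightarrow> 'a set" and rt :: "nat \<Rightarrow> 'a"
begin

definition nonroot :: "nat \<Rightarrow> 'a set" where
  "nonroot i = V i - {rt i}"

definition free_product :: "'a list set" where
  "free_product =
     {w. set w \<subseteq> nonroot 1 \<union> nonroot 2 \<and>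
         successively (\<lambda>a b. \<not> (\<exists>i\<in>{1,2}. a \<in> nonroot i \<and> b \<in> nonroot i)) w}"

definition wtype :: "'a list \<Rightarrow> nat option" where
  "wtype w = (if w = [] then None else if last w \<in> nonroot 1 then Some 1 else Some 2)"

text \<open>The inclusion of \<open>V i\<close> into the free product, which identifies \<open>rt i\<close> with the empty word.\<close>

definition emb :: "nat \<Rightarrow> 'a \<Rightarrow> 'a list" where
  "emb i v = (if v = rt i then [] else [v])"

text \<open>
  \<open>lifts i x y v w\<close>: the pair \<open>(x, y)\<close> of words is \<open>(uv, uw)\<close> for some word \<open>u\<close> with
  \<open>\<delta>(u) \<noteq> i\<close> and \<open>v, w \<in> V i\<close>.
\<close>

definition lifts :: "nat \<Rightarrow> 'a list \<Rightarrow> 'a list \<Rightarrow> 'a \<Rightarrow> 'a \<Rightarrow> bool" where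
  "lifts i x y v w \<longleftrightarrow>
     v \<in> V i \<and> w \<in> V i \<and>
     (\<exists>u\<in>free_product. wtype u \<noteq> Some i \<and> x = u @ emb i v \<and> y = u @ emb i w)"

end

section \<open>The random walk and its graph\<close>

context
  fixes V :: "nat \<Rightarrow> 'a set" and rt :: "nat \<Rightarrow> 'a"
    and p :: "nat \<Rightarrow> 'a \<Rightarrow> 'a \<Rightarrow> real"
begin

text \<open>By \<open>lifts_unique\<close> below, the definite descriptions here and in \<open>extend_weight\<close> are proper.\<close>

definition pbar :: "nat \<Rightarrow> 'a list \<Rightarrow> 'a list \<Rightarrow> real" where
  "pbar i x y =
     (if \<exists>v w. lifts V rt i x y v w
      then THE q. \<exists>v w. lifts V rt i x y v w \<and> q = p i v w
      else 0)"

definition factor_edges :: "nat \<Rightarrow> ('a \<times> 'a) set" where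
  "factor_edges i = {(u, v). u \<in> V i \<and> v \<in> V i \<and> p i u v > 0}"

definition extend_weight :: "('a \<times> 'a \<Rightarrow> real) \<Rightarrow> 'a list \<Rightarrow> 'a list \<Rightarrow> real" where
  "extend_weight W\<^sub>0 x y =
     (THE c. \<exists>i\<in>{1,2}. \<exists>(u, v)\<in>factor_edges i. lifts V rt i x y u v \<and> c = W\<^sub>0 (u, v))"

text \<open>As \<open>V 1\<close> and \<open>V 2\<close> are disjoint, a letter equal to some root is the root of its own factor.\<close>

definition start :: "'a \<times> 'a \<Rightarrow> 'a list" where
  "start e = (if fst e \<in> {rt 1, rt 2} then [] else [fst e])"

end

context
  fixes V :: "nat \<Rightarrow> 'a set" and rt :: "nat \<Rightarrow> 'a"
    and p :: "nat \<Rightarrow> 'a \<Rightarrow> 'a \<Rightarrow> real" and \<alpha> :: real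
begin

definition trans_prob :: "'a list \<Rightarrow> 'a list \<Rightarrow> real" where
  "trans_prob x y = \<alpha> * pbar V rt p 1 x y + (1 - \<alpha>) * pbar V rt p 2 x y"

definition paths :: "'a list list set" where
  "paths = {\<pi>. \<pi> \<noteq> [] \<and> set \<pi> \<subseteq> free_product V rt \<and> successively (\<lambda>x y. trans_prob x y > 0) \<pi>}"

definition paths_between :: "'a list \<Rightarrow> 'a list \<Rightarrow> 'a list list set" where
  "paths_between x y = {\<pi>\<in>paths. hd \<pi> = x \<and> last \<pi> = y}"

text \<open>A path is the list of its vertices, so its length is one less than that of the list.\<close>

definition graph_dist :: "'a list \<Rightarrow> 'a list \<Rightarrow> enat" where
  "graph_dist x y = (INF \<pi>\<in>paths_between x y. enat (length \<pi> - 1))"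

definition path_weight :: "('a list \<Rightarrow> 'a list \<Rightarrow> real) \<Rightarrow> 'a list list \<Rightarrow> real" where
  "path_weight W \<pi> = (\<Sum>i=1..length \<pi> - 1. W (\<pi> ! (i - 1)) (\<pi> ! i))"

text \<open>Extended real valued, so that the infimum is \<open>\<infinity>\<close> if there is no path.\<close>

definition weight_dist :: "('a list \<Rightarrow> 'a list \<Rightarrow> real) \<Rightarrow> 'a list \<Rightarrow> 'a list \<Rightarrow> ereal" where
  "weight_dist W x y = (INF \<pi>\<in>paths_between x y. ereal (path_weight W \<pi>))"

definition path_dist :: "('a list \<Rightarrow> 'a list \<Rightarrow> real) \<Rightarrow> 'a list list \<Rightarrow> ereal" where
  "path_dist W \<pi> = weight_dist W (hd \<pi>) (last \<pi>)"

end

definition markov_chain ::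
  "'w measure \<Rightarrow> 's set \<Rightarrow> ('s \<Rightarrow> 's \<Rightarrow> real) \<Rightarrow> 's \<Rightarrow> (nat \<Rightarrow> 'w \<Rightarrow> 's) \<Rightarrow> bool" where
  "markov_chain M S q x\<^sub>0 X \<longleftrightarrow>
     prob_space M \<and>
     (\<forall>n. X n \<in> measurable M (count_space S)) \<and>
     (AE \<omega> in M. X 0 \<omega> = x\<^sub>0) \<and>
     (\<forall>n s. (\<forall>k\<le>Suc n. s k \<in> S) \<longrightarrow>
        measure M {\<omega>\<in>space M. \<forall>k\<le>Suc n. X k \<omega> = s k} =
        measure M {\<omega>\<in>space M. \<forall>k\<le>n. X k \<omega> = s k} * q (s n) (s (Suc n)))"

section \<open>Well-definedness of the lifted objects\<close>

lemma lifts_unique: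
  assumes "V 1 \<inter> V 2 = {}" "i \<in> {1, 2}"
    and "lifts V rt i x y v w" "lifts V rt i x y v' w'"
  shows "v = v' \<and> w = w'"
proof -
  obtain u where u: "u \<in> free_product V rt" "wtype V rt u \<noteq> Some i"
      "x = u @ emb rt i v" "y = u @ emb rt i w" "v \<in> V i" "w \<in> V i"
    using assms(3) by (auto simp: lifts_def)
  obtain u' where u': "u' \<in> free_product V rt" "wtype V rt u' \<noteq> Some i"
      "x = u' @ emb rt i v'" "y = u' @ emb rt i w'" "v' \<in> V i" "w' \<in> V i"
    using assms(4) by (auto simp: lifts_def)
  have last_ne: "last t \<notin> nonroot V rt i"
    if "t \<in> free_product V rt" "wtype V rt t \<noteq> Some i" "t \<noteq> []" for t
    using that assms(1,2) by (auto simp: wtype_def nonroot_def split: if_splits)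
  have eq: "u = u' \<and> a = a'"
    if "u @ emb rt i a = u' @ emb rt i a'" "a \<in> V i" "a' \<in> V i" for a a'
    using that last_ne[OF u(1,2)] last_ne[OF u'(1,2)]
    by (auto simp: emb_def nonroot_def split: if_splits)
  show ?thesis
    using eq u u' by metis
qed

lemma pbar_lifts:
  assumes "V 1 \<inter> V 2 = {}" "i \<in> {1, 2}" "lifts V rt i x y v w"
  shows "pbar V rt p i x y = p i v w"
proof -
  have "(THE q. \<exists>v w. lifts V rt i x y v w \<and> q = p i v w) = p i v w"
    using assms lifts_unique[OF assms(1,2)] by (intro the_equality) blast+
  then show ?thesis
    using assms(3) by (auto simp: pbar_def)
qed

lemma lifts_index_unique:
  assumes "V 1 \<inter> V 2 = {}"
    and "lifts V rt 1 x y v w" "lifts V rt 2 x y v' w'"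
  shows "v = w \<and> v' = w'"
proof -
  obtain u where u: "wtype V rt u \<noteq> Some 1" "u \<in> free_product V rt"
      "x = u @ emb rt 1 v" "y = u @ emb rt 1 w" "v \<in> V 1" "w \<in> V 1"
    using assms(2) by (auto simp: lifts_def)
  obtain u' where u': "wtype V rt u' \<noteq> Some 2" "u' \<in> free_product V rt"
      "x = u' @ emb rt 2 v'" "y = u' @ emb rt 2 w'" "v' \<in> V 2" "w' \<in> V 2"
    using assms(3) by (auto simp: lifts_def)
  show ?thesis
    using u u' assms(1)
    by (auto simp: emb_def wtype_def nonroot_def append_eq_append_conv2 split: if_splits)
qed

lemma extend_weight_lifts:
  assumes "free_product_setting V rt p \<alpha>" "i \<in> {1, 2}"
    and "(u, v) \<in> factor_edges V p i" "lifts V rt i x y u v"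
  shows "extend_weight V rt p W\<^sub>0 x y = W\<^sub>0 (u, v)"
proof -
  have disj: "V 1 \<inter> V 2 = {}"
    using assms(1) by (simp add: free_product_setting_def)
  have ne: "a \<noteq> b" if "(a, b) \<in> factor_edges V p j" "j \<in> {1, 2}" for a b j
    using that assms(1) by (fastforce simp: factor_edges_def free_product_setting_def)
  have uniq: "a = u \<and> b = v"
    if "j \<in> {1, 2}" "(a, b) \<in> factor_edges V p j" "lifts V rt j x y a b" for j a b
  proof (cases "j = i")
    case True
    then show ?thesis
      using lifts_unique[OF disj assms(2)] that assms(4) by blast
  next
    case False
    then have "j = 1 \<and> i = 2 \<or> j = 2 \<and> i = 1"
      using that(1) assms(2) by auto
    then show ?thesis
      using lifts_index_unique[OF disj] that assms(3,4) ne[OF that(2,1)] by blast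
  qed
  show ?thesis
    unfolding extend_weight_def
  proof (rule the_equality)
    show "\<exists>i\<in>{1,2}. \<exists>(a, b)\<in>factor_edges V p i. lifts V rt i x y a b \<and> W\<^sub>0 (u, v) = W\<^sub>0 (a, b)"
      using assms by blast
  next
    fix c
    assume "\<exists>i\<in>{1,2}. \<exists>(a, b)\<in>factor_edges V p i. lifts V rt i x y a b \<and> c = W\<^sub>0 (a, b)"
    then show "c = W\<^sub>0 (u, v)"
      using uniq by fast
  qed
qed

end

theory Submission
  imports Defs
begin

text \<open>The walk is studied through the tree structure of the free product. Every word is a cut vertex:
a path that reaches \<open>u @ w\<close> from outside the branch at \<open>u\<close> passes through \<open>u\<close>. A potential
argument then shows that the weighted distance from the empty word to \<open>x\<close> is the sum, over
the letters \<open>v\<close> of \<open>x\<close>, of the weighted distance from the root to \<open>v\<close> inside the factor of \<open>v\<close>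
(\<open>weight_dist_word_sum\<close>). So the claim is a strong law for a sum over the letters of \<open>X n\<close>.

Cut the trajectory at the last times at which the word has at most \<open>0, 1, 2, \<dots>\<close> letters. After
such a time the walk stays in one branch at its current position, and this branch is a copy of
the branch at the empty word. Hence the pieces between consecutive cuts (``blocks'') have a joint
law of product form: the event that the first blocks are given ones depends on a finite piece of
the path, followed by an escape whose probability depends only on the type of the last
letter (\<open>decomposition_prob\<close>). The types of the blocks alternate. Two consecutive blocks,
ordered by type, form a pair, and the pairs are independent and identically distributed
(\<open>pair_law\<close>, \<open>pairs_indep\<close>).

The radius of convergence enters through generating functions. Returns to the empty word have
finite total mass, so the walk escapes with positive probability through at least one of the two
branches there. Inside either branch it can reach a vertex with a branch of the other type, so
both types admit an escape (\<open>ret_less_rate\<close>). The mass of the moves between consecutive visits to a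
given copy of a factor is therefore below \<open>1\<close>, and by convexity it stays below \<open>1\<close> at some \<open>z > 1\<close>
(\<open>level_growth_less_1_beyond_1\<close>). So the length of a block has an exponential moment. This yields
transience, the existence of the cuts, and a finite mean length of a pair.

Let \<open>L v\<close> be the weighted distance of the letter \<open>v\<close>. If the end letters of a pair have infinite
mean weight, the law of large numbers for the pairs forces the quotient to tend to infinity. If
the mean is finite, the quotient tends to the mean weight of a pair divided by its mean length,
provided that the detours inside a block are negligible. The detour inside a block is at most the
sum of the last letters along the block. Its mean is bounded by the mean of \<open>L\<close> times the
mean length of a block, because a new letter is drawn independently of the past and a path from a
child back to the first level has to pass through the parent (\<open>letter_sum_mass_finite\<close>).

The growth condition makes the limit finite. If the weights are bounded at each distance, then
the condition gives \<open>W e \<le> B * z ^ n\<close> for all edges \<open>e\<close> that start at distance \<open>n\<close>, hence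
\<open>L v \<le> K * z ^ n\<close> at distance \<open>n\<close>, and a block that ends in such a letter \<open>v\<close> has length at
least \<open>n\<close>. The exponential moment of the length bounds the mean of \<open>L\<close>.\<close>

section \<open>Averages of independent variables\<close>

text \<open>The maximum of \<open>0\<close> and the first \<open>n\<close> partial sums of \<open>y\<close>. The recursion peels off the first
term because the argument below compares a sequence with its shift.\<close>
primrec pmax :: "nat \<Rightarrow> (nat \<Rightarrow> real) \<Rightarrow> real" where
  "pmax 0 y = 0"
| "pmax (Suc n) y = max 0 (y 0 + pmax n (\<lambda>i. y (Suc i)))"

lemma pmax_nonneg: "0 \<le> pmax n y"
  by (cases n) auto

lemma partial_sum_le_pmax: "m \<le> n \<Longrightarrow> (\<Sum>i<m. y i) \<le> pmax n y"
proof (induction n arbitrary: m y)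
  case (Suc n)
  show ?case
  proof (cases m)
    case (Suc k)
    have "(\<Sum>i<m. y i) = y 0 + (\<Sum>i<k. y (Suc i))"
      unfolding Suc by (rule sum.lessThan_Suc_shift)
    also have "\<dots> \<le> y 0 + pmax n (\<lambda>i. y (Suc i))"
      using Suc.IH[of k "\<lambda>i. y (Suc i)"] Suc Suc.prems by simp
    finally show ?thesis by simp
  qed simp
qed simp

lemma pmax_mono: "m \<le> n \<Longrightarrow> pmax m y \<le> pmax n y"
proof (induction m arbitrary: n y)
  case (Suc m)
  then obtain k where k: "n = Suc k" "m \<le> k" by (cases n) auto
  show ?case using Suc.IH[OF k(2), of "\<lambda>i. y (Suc i)"] by (simp add: k max.coboundedI2)
qed (simp add: pmax_nonneg)

lemma pmax_abs_le: "\<bar>pmax n y\<bar> \<le> (\<Sum>i<n. \<bar>y i\<bar>)"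
proof (induction n arbitrary: y)
  case (Suc n)
  have "(\<Sum>i<Suc n. \<bar>y i\<bar>) = \<bar>y 0\<bar> + (\<Sum>i<n. \<bar>y (Suc i)\<bar>)"
    by (rule sum.lessThan_Suc_shift)
  with Suc[of "\<lambda>i. y (Suc i)"] show ?case by (auto simp: max_def)
qed simp

lemma measurable_pmax [measurable]:
  "pmax n \<in> borel_measurable (Pi\<^sub>M UNIV (\<lambda>_::nat. borel))"
proof (induction n)
  case 0
  then show ?case by (simp add: pmax.simps(1)[abs_def])
next
  case (Suc n)
  have [measurable]: "(\<lambda>y. pmax n (\<lambda>i. y (Suc i))) \<in> borel_measurable (Pi\<^sub>M UNIV (\<lambda>_::nat. borel))"
    by (rule measurable_compose[OF _ Suc]) (rule measurable_PiM_single'; simp)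
  show ?case unfolding pmax.simps(2)[abs_def] by measurable
qed

lemma bdd_above_range_nat_bound:
  fixes f :: "nat \<Rightarrow> real"
  shows "bdd_above (range f) \<longleftrightarrow> (\<exists>B::nat. \<forall>m. f m \<le> real B)"
proof
  assume "bdd_above (range f)"
  then obtain b where "\<And>m. f m \<le> b" by (auto simp: bdd_above_def)
  moreover obtain B :: nat where "b \<le> real B" using real_arch_simple by blast
  ultimately show "\<exists>B::nat. \<forall>m. f m \<le> real B" by (meson order_trans)
qed (auto simp: bdd_above_def)

context prob_space begin

lemma iid_distr_shift:
  fixes Y :: "nat \<Rightarrow> 'a \<Rightarrow> real"
  assumes indep: "indep_vars (\<lambda>_. borel) Y UNIV"
    and ident: "\<And>i. distr M borel (Y i) = distr M borel (Y 0)"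
  shows "distr M (Pi\<^sub>M UNIV (\<lambda>_. borel)) (\<lambda>\<omega> i. Y (Suc i) \<omega>) = distr M (Pi\<^sub>M UNIV (\<lambda>_. borel)) (\<lambda>\<omega> i. Y i \<omega>)"
proof -
  have rv: "\<And>i. random_variable borel (Y i)"
    using indep by (auto simp: indep_vars_def)
  define D where "D = distr M borel (Y 0)"
  interpret D: prob_space D
    unfolding D_def using rv by (rule prob_space_distr)
  have eqD: "distr M borel (Y i) = D" for i
    unfolding D_def by (rule ident)
  have *: "distr M (Pi\<^sub>M UNIV (\<lambda>_. borel)) (\<lambda>\<omega> i. Y i \<omega>) = Pi\<^sub>M UNIV (\<lambda>i. D)"
    using indep_vars_iff_distr_eq_PiM[where I=UNIV and X=Y and M'="\<lambda>_. borel"] rv indep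
    unfolding eqD by (simp add: restrict_UNIV)
  have mY: "(\<lambda>\<omega> i. Y i \<omega>) \<in> M \<rightarrow>\<^sub>M Pi\<^sub>M UNIV (\<lambda>_. borel)"
    by (rule measurable_PiM_single') (use rv in auto)
  have mS: "(\<lambda>y i. y (Suc i)) \<in> Pi\<^sub>M UNIV (\<lambda>_::nat. borel :: real measure) \<rightarrow>\<^sub>M Pi\<^sub>M UNIV (\<lambda>_. borel)"
    by (rule measurable_PiM_single') auto
  have "distr M (Pi\<^sub>M UNIV (\<lambda>_. borel)) (\<lambda>\<omega> i. Y (Suc i) \<omega>)
      = distr (distr M (Pi\<^sub>M UNIV (\<lambda>_. borel)) (\<lambda>\<omega> i. Y i \<omega>)) (Pi\<^sub>M UNIV (\<lambda>_. borel)) (\<lambda>y i. y (Suc i))"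
    by (subst distr_distr[OF mS mY]) (simp add: comp_def)
  also have "\<dots> = distr (Pi\<^sub>M UNIV (\<lambda>i. D)) (Pi\<^sub>M UNIV (\<lambda>_. D)) (\<lambda>y. \<lambda>i\<in>UNIV. y (Suc i))"
    unfolding * by (intro distr_cong) (auto simp: D_def intro!: sets_PiM_cong)
  also have "\<dots> = Pi\<^sub>M UNIV (\<lambda>_. D)"
    by (rule distr_PiM_reindex[where K=UNIV and M="\<lambda>_. D" and f=Suc and I=UNIV]) (auto intro: D.prob_space_axioms)
  finally show ?thesis using * by simp
qed

text \<open>Discarding finitely many terms changes the partial sums by a bounded amount, so boundedness is
a tail event and Kolmogorov's law applies.\<close>
lemma bdd_partial_sums_zero_one:
  fixes Y :: "nat \<Rightarrow> 'a \<Rightarrow> real"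
  assumes indep: "indep_vars (\<lambda>_. borel) Y UNIV"
  defines "E \<equiv> {\<omega>\<in>space M. bdd_above (range (\<lambda>n. \<Sum>i<n. Y i \<omega>))}"
  shows "prob E = 0 \<or> prob E = 1"
proof -
  define A where "A i = {Y i -` S \<inter> space M |S. S \<in> sets borel}" for i
  have rv: "\<And>i. random_variable borel (Y i)"
    using indep by (auto simp: indep_vars_def)
  have shift: "bdd_above (range (\<lambda>n. \<Sum>i<n. y i)) \<longleftrightarrow> bdd_above (range (\<lambda>m. \<Sum>i<m. y (k + i)))"
    for y :: "nat \<Rightarrow> real" and k
  proof -
    have split: "(\<Sum>i<k+m. y i) = (\<Sum>i<k. y i) + (\<Sum>i<m. y (k + i))" for m
      by (induction m) (auto simp: algebra_simps)
    show ?thesis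
    proof
      assume "bdd_above (range (\<lambda>n. \<Sum>i<n. y i))"
      then obtain B where B: "\<And>n. (\<Sum>i<n. y i) \<le> B" by (auto simp: bdd_above_def)
      show "bdd_above (range (\<lambda>m. \<Sum>i<m. y (k + i)))"
        unfolding bdd_above_def using B[of "k + _"] split
        by (intro exI[of _ "B - (\<Sum>i<k. y i)"]) (auto simp: algebra_simps)
    next
      assume "bdd_above (range (\<lambda>m. \<Sum>i<m. y (k + i)))"
      then obtain B where B: "\<And>m. (\<Sum>i<m. y (k + i)) \<le> B" by (auto simp: bdd_above_def)
      have "(\<Sum>i<n. y i) \<le> Max ((\<lambda>n. \<Sum>i<n. y i) ` {..k}) + \<bar>(\<Sum>i<k. y i) + B\<bar> + \<bar>Max ((\<lambda>n. \<Sum>i<n. y i) ` {..k})\<bar>" for n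
      proof (cases "n \<le> k")
        case True
        then have "(\<Sum>i<n. y i) \<le> Max ((\<lambda>n. \<Sum>i<n. y i) ` {..k})" by (intro Max_ge) auto
        then show ?thesis by linarith
      next
        case False
        then have "(\<Sum>i<n. y i) = (\<Sum>i<k. y i) + (\<Sum>i<n-k. y (k + i))" using split[of "n - k"] by simp
        with B[of "n - k"] show ?thesis by linarith
      qed
      then show "bdd_above (range (\<lambda>n. \<Sum>i<n. y i))" by (auto simp: bdd_above_def)
    qed
  qed
  have "E \<in> tail_events A"
    unfolding tail_events_def
  proof
    fix k :: nat
    define N where "N = sigma (space M) (\<Union> (A ` {k..}))"
    have sub: "\<Union> (A ` {k..}) \<subseteq> Pow (space M)" by (auto simp: A_def)
    have sp: "space N = space M" unfolding N_def by (simp add: sub)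
    have setsN: "sets N = sigma_sets (space M) (\<Union> (A ` {k..}))" unfolding N_def by (simp add: sub)
    have [measurable]: "Y (k + i) \<in> borel_measurable N" for i
    proof (rule measurableI)
      fix S :: "real set" assume "S \<in> sets borel"
      then have "Y (k + i) -` S \<inter> space M \<in> A (k + i)" by (auto simp: A_def)
      then show "Y (k + i) -` S \<inter> space N \<in> sets N"
        unfolding sp setsN by (intro sigma_sets.Basic) auto
    qed simp
    have "E = {\<omega>\<in>space N. \<exists>B::nat. \<forall>m. (\<Sum>i<m. Y (k + i) \<omega>) \<le> real B}"
    proof -
      have "bdd_above (range (\<lambda>n. \<Sum>i<n. Y i \<omega>)) \<longleftrightarrow> (\<exists>B::nat. \<forall>m. (\<Sum>i<m. Y (k + i) \<omega>) \<le> real B)" for \<omega>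
        unfolding shift[of "\<lambda>i. Y i \<omega>" k] by (rule bdd_above_range_nat_bound)
      then show ?thesis unfolding E_def sp by simp
    qed
    also have "\<dots> \<in> sets N" by measurable
    finally show "E \<in> sigma_sets (space M) (\<Union> (A ` {k..}))" unfolding setsN .
  qed
  moreover have "indep_sets A UNIV"
    using indep unfolding indep_vars_def2 A_def by simp
  moreover have "sigma_algebra (space M) (A i)" for i
  proof -
    have "A i = sets (vimage_algebra (space M) (Y i) borel)"
      unfolding A_def using rv[of i] by (subst sets_vimage_algebra2) (auto simp: measurable_def)
    then show ?thesis
      using sets.sigma_algebra_axioms[of "vimage_algebra (space M) (Y i) borel"] by simp
  qed
  ultimately show ?thesis
    using kolmogorov_0_1_law[of A E] by blast
qed

text \<open>Garsia's argument. Let \<open>G n\<close> be the maximum of the partial sums and \<open>G' n\<close> the same quantity for the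
shifted sequence. Then \<open>G (Suc n) - G' n = max (- G' n) (Y 0)\<close>, and since \<open>G\<close> is increasing and the
sequence is stationary, this difference has nonnegative mean. If the partial sums were unbounded,
it would converge to \<open>Y 0\<close>, dominated by \<open>\<bar>Y 0\<bar>\<close>, and \<open>Y 0\<close> would have nonnegative mean.\<close>
lemma iid_negative_drift_bounded:
  fixes Y :: "nat \<Rightarrow> 'a \<Rightarrow> real"
  assumes indep: "indep_vars (\<lambda>_. borel) Y UNIV"
    and ident: "\<And>i. distr M borel (Y i) = distr M borel (Y 0)"
    and int: "integrable M (Y 0)" and neg: "expectation (Y 0) < 0"
  shows "AE \<omega> in M. bdd_above (range (\<lambda>n. \<Sum>i<n. Y i \<omega>))"
proof (rule ccontr)
  assume not: "\<not> ?thesis"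
  define E where "E = {\<omega>\<in>space M. bdd_above (range (\<lambda>n. \<Sum>i<n. Y i \<omega>))}"
  have rv [measurable]: "\<And>i. random_variable borel (Y i)"
    using indep by (auto simp: indep_vars_def)
  have Eev [measurable]: "E \<in> events" unfolding E_def bdd_above_range_nat_bound by measurable
  have "prob E \<noteq> 1"
    using not prob_eq_1[OF Eev] by (auto simp: E_def)
  then have "prob E = 0"
    using bdd_partial_sums_zero_one[OF indep] by (auto simp: E_def)
  then have "AE \<omega> in M. \<omega> \<notin> E"
    using Eev by (simp add: prob_eq_0)
  then have unb: "AE \<omega> in M. \<not> bdd_above (range (\<lambda>n. \<Sum>i<n. Y i \<omega>))"
    by (rule AE_mp) (auto simp: E_def)
  have int': "integrable M (Y i)" for i
  proof -
    have "integrable (distr M borel (Y i)) (\<lambda>x. x)"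
      using int unfolding ident[of i] by (subst integrable_distr_eq) auto
    then show ?thesis by (subst (asm) integrable_distr_eq) auto
  qed
  define G where "G n \<omega> = pmax n (\<lambda>i. Y i \<omega>)" for n \<omega>
  define G' where "G' n \<omega> = pmax n (\<lambda>i. Y (Suc i) \<omega>)" for n \<omega>
  have mY [measurable]: "(\<lambda>\<omega> i. Y i \<omega>) \<in> M \<rightarrow>\<^sub>M Pi\<^sub>M UNIV (\<lambda>_. borel)"
      "(\<lambda>\<omega> i. Y (Suc i) \<omega>) \<in> M \<rightarrow>\<^sub>M Pi\<^sub>M UNIV (\<lambda>_. borel)"
    by (rule measurable_PiM_single'; auto)+
  have mG [measurable]: "G n \<in> borel_measurable M" "G' n \<in> borel_measurable M" for n
    unfolding G_def G'_def by measurable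
  have intG: "integrable M (G n)" for n
    by (rule Bochner_Integration.integrable_bound[where f="\<lambda>\<omega>. \<Sum>i<n. \<bar>Y i \<omega>\<bar>"])
       (use pmax_abs_le in \<open>auto simp: G_def intro!: integrable_sum integrable_abs int' order_trans[OF _ abs_ge_self]\<close>)
  have intG': "integrable M (G' n)" for n
    by (rule Bochner_Integration.integrable_bound[where f="\<lambda>\<omega>. \<Sum>i<n. \<bar>Y (Suc i) \<omega>\<bar>"])
       (use pmax_abs_le[of _ "\<lambda>i. Y (Suc i) _"] in \<open>auto simp: G'_def intro!: integrable_sum integrable_abs int' order_trans[OF _ abs_ge_self]\<close>)
  have eqE: "expectation (G' n) = expectation (G n)" for n
  proof -
    have "expectation (G' n) = integral\<^sup>L (distr M (Pi\<^sub>M UNIV (\<lambda>_. borel)) (\<lambda>\<omega> i. Y (Suc i) \<omega>)) (pmax n)"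
      unfolding G'_def by (subst integral_distr) auto
    also have "\<dots> = integral\<^sup>L (distr M (Pi\<^sub>M UNIV (\<lambda>_. borel)) (\<lambda>\<omega> i. Y i \<omega>)) (pmax n)"
      unfolding iid_distr_shift[OF indep ident] ..
    also have "\<dots> = expectation (G n)"
      unfolding G_def by (subst integral_distr) auto
    finally show ?thesis .
  qed
  define D where "D n \<omega> = G (Suc n) \<omega> - G' n \<omega>" for n \<omega>
  have D_eq: "D n \<omega> = max (- G' n \<omega>) (Y 0 \<omega>)" for n \<omega>
    by (simp add: D_def G_def G'_def max_def)
  have G'_nonneg: "0 \<le> G' n \<omega>" for n \<omega> unfolding G'_def by (rule pmax_nonneg)
  have ED: "0 \<le> expectation (D n)" for n
  proof -
    have "expectation (G n) \<le> expectation (G (Suc n))"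
      by (intro integral_mono intG) (auto simp: G_def intro!: pmax_mono simp del: pmax.simps)
    then show ?thesis
      unfolding D_def using intG intG' eqE by simp
  qed
  have lim: "AE \<omega> in M. (\<lambda>n. D n \<omega>) \<longlonglongrightarrow> Y 0 \<omega>"
    using unb
  proof eventually_elim
    fix \<omega> assume nb: "\<not> bdd_above (range (\<lambda>n. \<Sum>i<n. Y i \<omega>))"
    have "\<exists>n. - Y 0 \<omega> \<le> G' n \<omega>"
    proof (rule ccontr)
      assume "\<nexists>n. - Y 0 \<omega> \<le> G' n \<omega>"
      then have b: "G' n \<omega> \<le> - Y 0 \<omega>" for n using linorder_not_le by (metis less_imp_le)
      have "(\<Sum>i<n. Y i \<omega>) \<le> 0" for n
      proof -
        have "(\<Sum>i<n. Y i \<omega>) \<le> G (Suc n) \<omega>"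
          unfolding G_def by (intro partial_sum_le_pmax) auto
        also have "\<dots> = max 0 (Y 0 \<omega> + G' n \<omega>)" by (simp add: G_def G'_def)
        also have "\<dots> \<le> 0" using b[of n] by simp
        finally show ?thesis .
      qed
      with nb show False by (auto simp: bdd_above_def)
    qed
    then obtain n0 where n0: "- Y 0 \<omega> \<le> G' n0 \<omega>" by blast
    have "D n \<omega> = Y 0 \<omega>" if "n \<ge> n0" for n
      using n0 pmax_mono[OF that, of "\<lambda>i. Y (Suc i) \<omega>"] unfolding D_eq G'_def by linarith
    then show "(\<lambda>n. D n \<omega>) \<longlonglongrightarrow> Y 0 \<omega>"
      by (intro tendsto_eventually) (auto simp: eventually_sequentially)
  qed
  have "(\<lambda>n. expectation (D n)) \<longlonglongrightarrow> expectation (Y 0)"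
  proof (rule integral_dominated_convergence[where w="\<lambda>\<omega>. \<bar>Y 0 \<omega>\<bar>"])
    show "AE \<omega> in M. norm (D n \<omega>) \<le> \<bar>Y 0 \<omega>\<bar>" for n
      using G'_nonneg[of n] by (intro AE_I2) (auto simp: D_eq max_def)
    show "D n \<in> borel_measurable M" for n
      unfolding D_def[abs_def] by (intro borel_measurable_diff mG)
    show "Y 0 \<in> borel_measurable M" by simp
    show "integrable M (\<lambda>\<omega>. \<bar>Y 0 \<omega>\<bar>)" using int by simp
    show "AE \<omega> in M. (\<lambda>n. D n \<omega>) \<longlonglongrightarrow> Y 0 \<omega>" by (rule lim)
  qed
  then have "0 \<le> expectation (Y 0)"
    by (rule LIMSEQ_le_const) (use ED in auto)
  with neg show False by simp
qed

lemma iid_average_upper: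
  fixes Y :: "nat \<Rightarrow> 'a \<Rightarrow> real"
  assumes indep: "indep_vars (\<lambda>_. borel) Y UNIV"
    and ident: "\<And>i. distr M borel (Y i) = distr M borel (Y 0)"
    and int: "integrable M (Y 0)" and e: "expectation (Y 0) < e"
  shows "AE \<omega> in M. eventually (\<lambda>n. (\<Sum>i<n. Y i \<omega>) / real n < e) sequentially"
proof -
  \<comment> \<open>room between the mean and \<open>e\<close>, so that the drift of \<open>Y i - a\<close> is negative\<close>
  define a where "a = (expectation (Y 0) + e) / 2"
  have a: "expectation (Y 0) < a" "a < e" using e by (auto simp: a_def)
  have rv [measurable]: "\<And>i. random_variable borel (Y i)"
    using indep by (auto simp: indep_vars_def)
  have indep': "indep_vars (\<lambda>_. borel) (\<lambda>i \<omega>. Y i \<omega> - a) UNIV"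
    by (rule indep_vars_compose2[OF indep]) simp
  have d: "distr M borel (\<lambda>\<omega>. Y i \<omega> - a) = distr (distr M borel (Y i)) borel (\<lambda>x. x - a)" for i
    by (subst distr_distr) (auto simp: comp_def)
  have ident': "distr M borel (\<lambda>\<omega>. Y i \<omega> - a) = distr M borel (\<lambda>\<omega>. Y 0 \<omega> - a)" for i
    unfolding d using ident[of i] by simp
  have "AE \<omega> in M. bdd_above (range (\<lambda>n. \<Sum>i<n. Y i \<omega> - a))"
    by (rule iid_negative_drift_bounded[OF indep' ident'])
       (use int a in \<open>auto simp: prob_space\<close>)
  then show ?thesis
  proof eventually_elim
    fix \<omega> assume "bdd_above (range (\<lambda>n. \<Sum>i<n. Y i \<omega> - a))"
    then obtain B where B: "\<And>n. (\<Sum>i<n. Y i \<omega> - a) \<le> B" by (auto simp: bdd_above_def)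
    have "(\<lambda>n. a + B / real n) \<longlonglongrightarrow> a + 0"
      by (intro tendsto_intros lim_const_over_n)
    then have "eventually (\<lambda>n. a + B / real n < e) sequentially"
      using a by (auto dest: order_tendstoD)
    with eventually_gt_at_top[of 0]
    show "eventually (\<lambda>n. (\<Sum>i<n. Y i \<omega>) / real n < e) sequentially"
    proof eventually_elim
      case (elim n)
      have "(\<Sum>i<n. Y i \<omega>) \<le> a * real n + B"
        using B[of n] by (simp add: sum_subtractf mult.commute)
      then have "(\<Sum>i<n. Y i \<omega>) / real n \<le> a + B / real n"
        using elim by (simp add: field_simps)
      with elim show ?case by linarith
    qed
  qed
qed

theorem iid_average_tendsto_expectation:
  fixes Y :: "nat \<Rightarrow> 'a \<Rightarrow> real"
  assumes indep: "indep_vars (\<lambda>_. borel) Y UNIV"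
    and ident: "\<And>i. distr M borel (Y i) = distr M borel (Y 0)"
    and int: "integrable M (Y 0)"
  shows "AE \<omega> in M. (\<lambda>n. (\<Sum>i<n. Y i \<omega>) / real n) \<longlonglongrightarrow> expectation (Y 0)"
proof -
  let ?E = "expectation (Y 0)"
  have rv [measurable]: "\<And>i. random_variable borel (Y i)"
    using indep by (auto simp: indep_vars_def)
  have indep': "indep_vars (\<lambda>_. borel) (\<lambda>i \<omega>. - Y i \<omega>) UNIV"
    by (rule indep_vars_compose2[OF indep]) simp
  have d: "distr M borel (\<lambda>\<omega>. - Y i \<omega>) = distr (distr M borel (Y i)) borel (\<lambda>x. - x)" for i
    by (subst distr_distr) (auto simp: comp_def)
  have ident': "distr M borel (\<lambda>\<omega>. - Y i \<omega>) = distr M borel (\<lambda>\<omega>. - Y 0 \<omega>)" for i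
    unfolding d using ident[of i] by simp
  have "AE \<omega> in M. \<forall>k::nat. eventually (\<lambda>n. (\<Sum>i<n. Y i \<omega>) / real n < ?E + 1 / real (Suc k)) sequentially"
    by (subst AE_all_countable, intro allI iid_average_upper[OF indep ident int]) simp
  moreover have "AE \<omega> in M. \<forall>k::nat. eventually (\<lambda>n. (\<Sum>i<n. - Y i \<omega>) / real n < - ?E + 1 / real (Suc k)) sequentially"
    by (subst AE_all_countable, intro allI iid_average_upper[OF indep' ident']) (use int in auto)
  ultimately show ?thesis
  proof eventually_elim
    case (elim \<omega>)
    show ?case
    proof (rule LIMSEQ_I)
      fix r :: real assume "0 < r"
      then obtain k where k: "1 / real (Suc k) < r"
        using reals_Archimedean by (auto simp: inverse_eq_divide)
      have "eventually (\<lambda>n. norm ((\<Sum>i<n. Y i \<omega>) / real n - ?E) < r) sequentially"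
        using elim(1)[rule_format, of k] elim(2)[rule_format, of k]
        by eventually_elim (use k in \<open>auto simp: sum_negf abs_if\<close>)
      then show "\<exists>no. \<forall>n\<ge>no. norm ((\<Sum>i<n. Y i \<omega>) / real n - ?E) < r"
        by (auto simp: eventually_sequentially)
    qed
  qed
qed

text \<open>Truncation reduces the claim to the integrable case, and the truncated means increase to infinity.\<close>
theorem iid_average_tendsto_infinity:
  fixes Y :: "nat \<Rightarrow> 'a \<Rightarrow> real"
  assumes indep: "indep_vars (\<lambda>_. borel) Y UNIV"
    and ident: "\<And>i. distr M borel (Y i) = distr M borel (Y 0)"
    and nonneg: "\<And>i \<omega>. 0 \<le> Y i \<omega>"
    and inf: "(\<integral>\<^sup>+\<omega>. ennreal (Y 0 \<omega>) \<partial>M) = \<infinity>"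
  shows "AE \<omega> in M. filterlim (\<lambda>n. (\<Sum>i<n. Y i \<omega>) / real n) at_top sequentially"
proof -
  have rv [measurable]: "\<And>i. random_variable borel (Y i)"
    using indep by (auto simp: indep_vars_def)
  define T where "T k i \<omega> = min (Y i \<omega>) (real k)" for k i \<omega>
  have T0: "0 \<le> T k i \<omega>" for k i \<omega> using nonneg by (auto simp: T_def)
  have indep': "indep_vars (\<lambda>_. borel) (T k) UNIV" for k
    unfolding T_def by (rule indep_vars_compose2[OF indep]) simp
  have d: "distr M borel (T k i) = distr (distr M borel (Y i)) borel (\<lambda>x. min x (real k))" for i k
    unfolding T_def[abs_def] by (subst distr_distr) (auto simp: comp_def)
  have ident': "distr M borel (T k i) = distr M borel (T k 0)" for i k
    unfolding d using ident[of i] by simp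
  have int: "integrable M (T k 0)" for k
    by (rule integrable_const_bound[where B="real k"]) (use T0[of k 0] in \<open>auto simp: T_def[abs_def]\<close>)
  have sup: "(SUP k. ennreal (expectation (T k 0))) = \<infinity>"
  proof -
    have "ennreal (Y 0 \<omega>) = (SUP k. ennreal (T k 0 \<omega>))" for \<omega>
    proof (rule antisym)
      obtain k where "Y 0 \<omega> \<le> real k" using real_arch_simple by blast
      then show "ennreal (Y 0 \<omega>) \<le> (SUP k. ennreal (T k 0 \<omega>))"
        by (intro SUP_upper2[of k]) (auto simp: T_def)
    qed (auto intro!: SUP_least ennreal_leI simp: T_def)
    then have "\<infinity> = (\<integral>\<^sup>+\<omega>. (SUP k. ennreal (T k 0 \<omega>)) \<partial>M)" using inf by simp
    also have "\<dots> = (SUP k. \<integral>\<^sup>+\<omega>. ennreal (T k 0 \<omega>) \<partial>M)"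
      by (rule nn_integral_monotone_convergence_SUP)
         (auto simp: incseq_def le_fun_def T_def intro!: ennreal_leI)
    also have "\<dots> = (SUP k. ennreal (expectation (T k 0)))"
      using T0 by (subst nn_integral_eq_integral[OF int]) auto
    finally show ?thesis by simp
  qed
  have "AE \<omega> in M. \<forall>k. (\<lambda>n. (\<Sum>i<n. T k i \<omega>) / real n) \<longlonglongrightarrow> expectation (T k 0)"
    by (subst AE_all_countable, intro allI iid_average_tendsto_expectation indep' ident' int)
  then show ?thesis
  proof eventually_elim
    case (elim \<omega>)
    show ?case
      unfolding filterlim_at_top
    proof
      fix Z :: real
      have "ennreal (\<bar>Z\<bar> + 1) < (SUP k. ennreal (expectation (T k 0)))"
        unfolding sup by simp
      then obtain k where "ennreal (\<bar>Z\<bar> + 1) < ennreal (expectation (T k 0))"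
        by (auto simp: less_SUP_iff)
      then have "Z < expectation (T k 0)"
        by (subst (asm) ennreal_less_iff) auto
      then have "eventually (\<lambda>n. Z < (\<Sum>i<n. T k i \<omega>) / real n) sequentially"
        using elim[rule_format, of k] by (auto dest: order_tendstoD)
      then show "eventually (\<lambda>n. Z \<le> (\<Sum>i<n. Y i \<omega>) / real n) sequentially"
      proof eventually_elim
        case (elim n)
        have "(\<Sum>i<n. T k i \<omega>) / real n \<le> (\<Sum>i<n. Y i \<omega>) / real n"
          by (intro divide_right_mono sum_mono) (auto simp: T_def)
        with elim show ?case by linarith
      qed
    qed
  qed
qed

end

section \<open>Masses of families of paths\<close>

text \<open>Sums with values in \<open>[0, \<infinity>]\<close>, which may be rearranged freely.\<close>
abbreviation msum :: "('a \<Rightarrow> ennreal) \<Rightarrow> 'a set \<Rightarrow> ennreal" where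
  "msum f A \<equiv> (\<integral>\<^sup>+x. f x \<partial>count_space A)"

lemma msum_indicator: "msum f A = (\<integral>\<^sup>+x. f x * indicator A x \<partial>count_space UNIV)"
  by (cases "A = UNIV") (simp_all add: nn_integral_count_space_indicator)

lemma msum_subset: "A \<subseteq> B \<Longrightarrow> msum f A \<le> msum f B"
  unfolding msum_indicator[of A f] msum_indicator[of B f]
  by (intro nn_integral_mono) (auto split: split_indicator)

lemma msum_mono: "(\<And>x. x \<in> A \<Longrightarrow> f x \<le> g x) \<Longrightarrow> msum f A \<le> msum g A"
  by (intro nn_integral_mono) simp

lemma msum_cong: "(\<And>x. x \<in> A \<Longrightarrow> f x = g x) \<Longrightarrow> msum f A = msum g A"
  by (intro nn_integral_cong) simp

lemma msum_reindex: "inj_on g S \<Longrightarrow> msum f (g ` S) = msum (\<lambda>x. f (g x)) S"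
  by (rule nn_integral_bij_count_space[symmetric]) (simp add: inj_on_imp_bij_betw)

lemma msum_image_le:
  assumes "F \<subseteq> g ` S"
  shows "msum f F \<le> msum (\<lambda>x. f (g x)) S"
proof -
  obtain S' where S': "S' \<subseteq> S" "inj_on g S'" "F = g ` S'"
    using assms by (auto simp: subset_image_inj)
  show ?thesis unfolding S'(3) msum_reindex[OF S'(2)] by (rule msum_subset[OF S'(1)])
qed

lemma msum_Sigma: "msum h (Sigma A B) = msum (\<lambda>s. msum (\<lambda>t. h (s, t)) (B s)) A"
proof -
  have "msum h (Sigma A B) = (\<integral>\<^sup>+x. \<integral>\<^sup>+y. h (x, y) * indicator (Sigma A B) (x, y) \<partial>count_space UNIV \<partial>count_space UNIV)"
    unfolding msum_indicator[of _ h]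
    using nn_integral_fst_count_space[of "\<lambda>xy. h xy * indicator (Sigma A B) xy"] by simp
  also have "\<dots> = msum (\<lambda>s. msum (\<lambda>t. h (s, t)) (B s)) A"
    unfolding msum_indicator[of A _] msum_indicator[of "B _" _]
    by (intro nn_integral_cong) (auto split: split_indicator intro!: nn_integral_cong simp: nn_integral_0_iff_AE)
  finally show ?thesis .
qed

lemma msum_cmult: "msum (\<lambda>x. c * f x) A = c * msum f A"
  by (rule nn_integral_cmult) simp

lemma msum_multc: "msum (\<lambda>x. f x * c) A = msum f A * c"
  by (rule nn_integral_multc) simp

lemma msum_add: "msum (\<lambda>x. f x + g x) A = msum f A + msum g A"
  by (rule nn_integral_add) simp_all

lemma msum_Times: "msum (\<lambda>(s, t). f s * g t) (A \<times> B) = msum f A * msum g B"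
  by (simp add: msum_Sigma msum_cmult msum_multc)

text \<open>The main tool for upper bounds: the mass of a family of paths that is covered by
concatenations of two pieces. The covering may be redundant.\<close>
lemma msum_decomp:
  assumes "F \<subseteq> (\<lambda>(s, t). c s t) ` Sigma A B"
    and "\<And>s t. s \<in> A \<Longrightarrow> t \<in> B s \<Longrightarrow> f (c s t) \<le> g s * h s t"
    and "\<And>s. s \<in> A \<Longrightarrow> msum (h s) (B s) \<le> K s"
  shows "msum f F \<le> msum (\<lambda>s. g s * K s) A"
proof -
  have "msum f F \<le> msum (\<lambda>(s, t). f (c s t)) (Sigma A B)"
    using msum_image_le[OF assms(1), of f] by (simp add: case_prod_unfold)
  also have "\<dots> \<le> msum (\<lambda>(s, t). g s * h s t) (Sigma A B)"
    using assms(2) by (intro msum_mono) auto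
  also have "\<dots> = msum (\<lambda>s. g s * msum (h s) (B s)) A"
    by (simp add: msum_Sigma msum_cmult)
  also have "\<dots> \<le> msum (\<lambda>s. g s * K s) A"
    by (intro msum_mono mult_left_mono assms(3)) auto
  finally show ?thesis .
qed

lemma msum_Un_le: "msum f (A \<union> B) \<le> msum f A + msum f B"
  unfolding msum_indicator[of "A \<union> B" f] msum_indicator[of A f] msum_indicator[of B f]
  by (subst nn_integral_add[symmetric]) (auto intro!: nn_integral_mono split: split_indicator)

lemma msum_Un_disjoint: "A \<inter> B = {} \<Longrightarrow> msum f (A \<union> B) = msum f A + msum f B"
  unfolding msum_indicator[of "A \<union> B" f] msum_indicator[of A f] msum_indicator[of B f]
  by (subst nn_integral_add[symmetric]) (auto intro!: nn_integral_cong split: split_indicator)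

lemma msum_singleton [simp]: "msum f {x} = f x"
  by (simp add: nn_integral_count_space_finite)

lemma msum_empty [simp]: "msum f {} = 0"
  by (simp add: nn_integral_count_space_finite)

lemma msum_support: "msum f A = msum f {x\<in>A. f x \<noteq> 0}"
  by (rule nn_integral_count_space_eq) auto

lemma msum_support_subset: "{x\<in>A. f x \<noteq> 0} \<subseteq> B \<Longrightarrow> msum f A \<le> msum f B"
  by (subst msum_support) (rule msum_subset)

lemma msum_le_by_size:
  fixes g :: "'a \<Rightarrow> nat"
  assumes "\<And>n. msum f {x\<in>F. g x \<le> n} \<le> K"
  shows "msum f F \<le> K"
proof -
  have "f x * indicator F x = (SUP n. f x * indicator {x\<in>F. g x \<le> n} x)" for x
    by (rule antisym) (auto intro!: SUP_upper2[of "g x"] SUP_least split: split_indicator)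
  then have "msum f F = (\<integral>\<^sup>+x. (SUP n. f x * indicator {x\<in>F. g x \<le> n} x) \<partial>count_space UNIV)"
    unfolding msum_indicator[of F f] by simp
  also have "\<dots> = (SUP n. \<integral>\<^sup>+x. f x * indicator {x\<in>F. g x \<le> n} x \<partial>count_space UNIV)"
    by (rule nn_integral_monotone_convergence_SUP)
       (auto simp: incseq_def le_fun_def split: split_indicator)
  also have "\<dots> \<le> K"
    using assms unfolding msum_indicator[of "{x\<in>F. g x \<le> _}" f] by (intro SUP_least) auto
  finally show ?thesis .
qed

lemma msum_by_size:
  fixes g :: "'a \<Rightarrow> nat"
  shows "msum f F = (\<Sum>n. msum f {x\<in>F. g x = n})"
proof -
  have "msum f F = msum (\<lambda>(n, x). f x) (SIGMA n:UNIV. {x\<in>F. g x = n})"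
  proof -
    have "F = snd ` (SIGMA n:UNIV. {x\<in>F. g x = n})" by force
    then have "msum f F = msum f (snd ` (SIGMA n:UNIV. {x\<in>F. g x = n}))" by simp
    also have "\<dots> = msum (\<lambda>x. f (snd x)) (SIGMA n:UNIV. {x\<in>F. g x = n})"
      by (rule msum_reindex) (auto simp: inj_on_def)
    finally show ?thesis by (simp add: case_prod_unfold)
  qed
  also have "\<dots> = msum (\<lambda>n. msum f {x\<in>F. g x = n}) UNIV" by (simp add: msum_Sigma)
  also have "\<dots> = (\<Sum>n. msum f {x\<in>F. g x = n})" by (rule nn_integral_count_space_nat)
  finally show ?thesis .
qed

lemma msum_has_sum:
  fixes f :: "'a \<Rightarrow> real"
  assumes "(f has_sum s) A" "\<And>x. x \<in> A \<Longrightarrow> 0 \<le> f x"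
  shows "msum (\<lambda>x. ennreal (f x)) A = ennreal s"
proof -
  have "f summable_on A" using assms(1) by (rule has_sum_imp_summable)
  then have "Infinite_Set_Sum.abs_summable_on f A"
    using abs_summable_equivalent summable_on_iff_abs_summable_on_real by blast
  then show ?thesis
    using nn_integral_conv_infsetsum[of f A] infsetsum_infsum[of f A] infsumI[OF assms(1)] assms(2) by simp
qed

text \<open>A path is given by its starting point and the list of its later vertices, so that joining paths
is appending lists.\<close>
primrec pweight :: "('s \<Rightarrow> 's \<Rightarrow> ennreal) \<Rightarrow> 's \<Rightarrow> 's list \<Rightarrow> ennreal" where
  "pweight q x [] = 1"
| "pweight q x (y # ys) = q x y * pweight q y ys"

lemma pweight_append: "pweight q x (s @ t) = pweight q x s * pweight q (last (x # s)) t"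
  by (induction s arbitrary: x) (auto simp: mult.assoc)

definition prefix_free :: "'s list set \<Rightarrow> bool" where
  "prefix_free F \<longleftrightarrow> (\<forall>s r. s \<in> F \<longrightarrow> s @ r \<in> F \<longrightarrow> r = [])"

lemma prefix_free_Cons: "prefix_free F \<Longrightarrow> prefix_free {s. y # s \<in> F}"
proof -
  assume pf: "prefix_free F"
  have "r = []" if "y # s \<in> F" "y # (s @ r) \<in> F" for s r
    using pf[unfolded prefix_free_def, rule_format, of "y # s" r] that by simp
  then show ?thesis unfolding prefix_free_def by simp
qed

lemma prefix_free_subset: "prefix_free F \<Longrightarrow> G \<subseteq> F \<Longrightarrow> prefix_free G"
  unfolding prefix_free_def by (meson subsetD)

text \<open>Kraft's inequality: no trajectory begins with two members of a prefix-free family, so the members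
describe disjoint events.\<close>
lemma pweight_prefix_free_le_1:
  assumes rows: "\<And>x. x \<in> S \<Longrightarrow> msum (q x) UNIV \<le> 1"
    and closed: "\<And>x y. q x y \<noteq> 0 \<Longrightarrow> y \<in> S"
    and x: "x \<in> S" and pf: "prefix_free F"
  shows "msum (pweight q x) F \<le> 1"
proof (rule msum_le_by_size[where g=length])
  fix n
  have "x \<in> S \<Longrightarrow> prefix_free F \<Longrightarrow> (\<forall>s\<in>F. length s \<le> n) \<Longrightarrow> msum (pweight q x) F \<le> 1" for F
  proof (induction n arbitrary: x F)
    case 0
    then have "F \<subseteq> {[]}" by auto
    then have "msum (pweight q x) F \<le> msum (pweight q x) {[]}" by (rule msum_subset)
    then show ?case by simp
  next
    case (Suc n)
    show ?case
    proof (cases "[] \<in> F")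
      case True
      have "s = []" if "s \<in> F" for s
        by (rule Suc.prems(2)[unfolded prefix_free_def, rule_format, OF True]) (simp add: that)
      then have "F \<subseteq> {[]}" by blast
      then have "msum (pweight q x) F \<le> msum (pweight q x) {[]}" by (rule msum_subset)
      then show ?thesis by simp
    next
      case False
      have "msum (pweight q x) F \<le> msum (\<lambda>y. q x y * 1) UNIV"
      proof (rule msum_decomp[where c="\<lambda>y s. y # s" and B="\<lambda>y. {s. y # s \<in> F}"
            and h="\<lambda>y s. if q x y = 0 then 0 else pweight q y s"])
        show "F \<subseteq> (\<lambda>(y, s). y # s) ` (SIGMA y:UNIV. {s. y # s \<in> F})"
        proof
          fix s assume "s \<in> F"
          with False obtain y t where "s = y # t" by (cases s) auto
          with \<open>s \<in> F\<close> show "s \<in> (\<lambda>(y, s). y # s) ` (SIGMA y:UNIV. {s. y # s \<in> F})"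
            by (intro image_eqI[of _ _ "(y, t)"]) auto
        qed
      next
        fix y
        show "msum (\<lambda>s. if q x y = 0 then 0 else pweight q y s) {s. y # s \<in> F} \<le> 1"
        proof (cases "q x y = 0")
          case False
          have "\<forall>s\<in>{s. y # s \<in> F}. length s \<le> n" using Suc.prems(3) by auto
          then have "msum (pweight q y) {s. y # s \<in> F} \<le> 1"
            by (rule Suc.IH[OF closed[OF False] prefix_free_Cons[OF Suc.prems(2)]])
          then show ?thesis using False by simp
        qed simp
      next
        fix y s
        show "pweight q x (y # s) \<le> q x y * (if q x y = 0 then 0 else pweight q y s)" by simp
      qed
      also have "\<dots> \<le> 1" using rows[OF Suc.prems(1)] by simp
      finally show ?thesis .
    qed
  qed
  note bounded = this
  show "msum (pweight q x) {x\<in>F. length x \<le> n} \<le> 1"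
    by (rule bounded[OF x prefix_free_subset[OF pf]]) auto
qed

section \<open>Words and transitions of the free product\<close>

locale free_walk =
  fixes V :: "nat \<Rightarrow> 'a set" and rt :: "nat \<Rightarrow> 'a"
    and p :: "nat \<Rightarrow> 'a \<Rightarrow> 'a \<Rightarrow> real" and \<alpha> :: real
  assumes setting: "free_product_setting V rt p \<alpha>"
begin

abbreviation "N \<equiv> nonroot V rt"
abbreviation "FP \<equiv> free_product V rt"
abbreviation "wt \<equiv> wtype V rt"
abbreviation "tp \<equiv> trans_prob V rt p \<alpha>"

definition rate :: "nat \<Rightarrow> real" where
  "rate i = (if i = 1 then \<alpha> else 1 - \<alpha>)"

text \<open>The part of the free product that hangs at the empty word on the side of factor \<open>i\<close>. Its translate
by \<open>u\<close> hangs at \<open>u\<close> if \<open>u\<close> does not end in a letter of factor \<open>i\<close>.\<close>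
definition branch :: "nat \<Rightarrow> 'a list set" where
  "branch i = {w\<in>FP. w \<noteq> [] \<and> hd w \<in> N i}"

lemma disj: "V 1 \<inter> V 2 = {}"
  using setting by (simp add: free_product_setting_def)

lemma rate_pos: "0 < rate i"
  using setting by (auto simp: free_product_setting_def rate_def)

lemma rate_sum: "rate 1 + rate 2 = 1"
  by (simp add: rate_def)

lemma rt_in: "i \<in> {1,2} \<Longrightarrow> rt i \<in> V i"
  using setting by (auto simp: free_product_setting_def)

lemma p_nonneg: "i \<in> {1,2} \<Longrightarrow> x \<in> V i \<Longrightarrow> y \<in> V i \<Longrightarrow> 0 \<le> p i x y"
  using setting unfolding free_product_setting_def transition_matrix_def by blast

lemma p_has_sum: "i \<in> {1,2} \<Longrightarrow> x \<in> V i \<Longrightarrow> ((\<lambda>y. p i x y) has_sum 1) (V i)"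
  using setting unfolding free_product_setting_def transition_matrix_def by blast

lemma p_diag: "i \<in> {1,2} \<Longrightarrow> x \<in> V i \<Longrightarrow> p i x x = 0"
  using setting unfolding free_product_setting_def by blast

lemma countable_V: "i \<in> {1,2} \<Longrightarrow> countable (V i)"
  using setting unfolding free_product_setting_def by blast

lemma N_disjoint: "v \<in> N i \<Longrightarrow> v \<in> N j \<Longrightarrow> i \<in> {1,2} \<Longrightarrow> j \<in> {1,2} \<Longrightarrow> i = j"
  using disj by (auto simp: nonroot_def)

lemma rt_notin_N: "i \<in> {1,2} \<Longrightarrow> j \<in> {1,2} \<Longrightarrow> rt i \<notin> N j"
  using disj rt_in[of 1] rt_in[of 2] by (auto simp: nonroot_def)

lemma V_cases: "v \<in> V i \<longleftrightarrow> v = rt i \<or> v \<in> N i" if "i \<in> {1,2}"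
  using rt_in[OF that] by (auto simp: nonroot_def)

lemma Nil_FP [simp]: "[] \<in> FP"
  by (simp add: free_product_def)

lemma wt_Nil [simp]: "wt [] = None"
  by (simp add: wtype_def)

lemma FP_append:
  "u \<noteq> [] \<Longrightarrow> w \<noteq> [] \<Longrightarrow> u @ w \<in> FP \<longleftrightarrow>
     u \<in> FP \<and> w \<in> FP \<and> \<not> (\<exists>i\<in>{1,2}. last u \<in> N i \<and> hd w \<in> N i)"
  by (auto simp: free_product_def successively_append_iff)

lemma FP_appendD: "u @ w \<in> FP \<Longrightarrow> u \<in> FP" "u @ w \<in> FP \<Longrightarrow> w \<in> FP"
  by (cases "u = []"; cases "w = []"; simp add: FP_append)+

lemma FP_last: "u \<in> FP \<Longrightarrow> u \<noteq> [] \<Longrightarrow> last u \<in> N 1 \<or> last u \<in> N 2"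
proof -
  assume "u \<in> FP" "u \<noteq> []"
  then have "last u \<in> set u" "set u \<subseteq> N 1 \<union> N 2" by (simp_all add: free_product_def)
  then show ?thesis by blast
qed

lemma FP_hd: "u \<in> FP \<Longrightarrow> u \<noteq> [] \<Longrightarrow> hd u \<in> N 1 \<or> hd u \<in> N 2"
proof -
  assume "u \<in> FP" "u \<noteq> []"
  then have "hd u \<in> set u" "set u \<subseteq> N 1 \<union> N 2" by (simp_all add: free_product_def)
  then show ?thesis by blast
qed

lemma wt_iff: "u \<in> FP \<Longrightarrow> u \<noteq> [] \<Longrightarrow> i \<in> {1,2} \<Longrightarrow> wt u = Some i \<longleftrightarrow> last u \<in> N i"
  using FP_last[of u] N_disjoint[of "last u" 1 2] by (auto simp: wtype_def)

lemma wt_last: "w \<noteq> [] \<Longrightarrow> wt (u @ w) = wt w"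
  by (simp add: wtype_def)

lemma FP_append_branch:
  assumes "u \<in> FP" "wt u \<noteq> Some j" "w \<in> branch j" "j \<in> {1,2}"
  shows "u @ w \<in> FP"
proof (cases "u = []")
  case False
  have l: "last u \<notin> N j" using wt_iff[OF assms(1) False assms(4)] assms(2) by simp
  have h: "hd w \<in> N j" using assms(3) by (simp add: branch_def)
  have "\<not> (\<exists>i\<in>{1,2}. last u \<in> N i \<and> hd w \<in> N i)"
  proof
    assume "\<exists>i\<in>{1,2}. last u \<in> N i \<and> hd w \<in> N i"
    then obtain i where i: "i \<in> {1,2}" "last u \<in> N i" "hd w \<in> N i" by blast
    then have "i = j" using N_disjoint[OF _ h i(1) assms(4)] by simp
    then show False using i l by simp
  qed
  moreover have "w \<in> FP" "w \<noteq> []" using assms(3) by (simp_all add: branch_def)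
  ultimately show ?thesis using assms(1) False by (simp add: FP_append)
qed (use assms in \<open>auto simp: branch_def\<close>)

lemma singleton_branch: "[v] \<in> branch i \<longleftrightarrow> v \<in> N i" if "i \<in> {1,2}"
  using that by (auto simp: branch_def free_product_def)

lemma FP_snoc: "u \<in> FP \<Longrightarrow> wt u \<noteq> Some i \<Longrightarrow> v \<in> N i \<Longrightarrow> i \<in> {1,2} \<Longrightarrow> u @ [v] \<in> FP"
  by (rule FP_append_branch[where j=i]) (auto simp: singleton_branch)

lemma FP_emb: "u \<in> FP \<Longrightarrow> wt u \<noteq> Some i \<Longrightarrow> v \<in> V i \<Longrightarrow> i \<in> {1,2} \<Longrightarrow> u @ emb rt i v \<in> FP"
  by (auto simp: emb_def V_cases intro: FP_snoc)

lemma FP_decomp: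
  assumes "x \<in> FP" "i \<in> {1,2}"
  obtains u v where "u \<in> FP" "wt u \<noteq> Some i" "v \<in> V i" "x = u @ emb rt i v"
proof (cases "wt x = Some i")
  case False
  then show ?thesis using that[of x "rt i"] assms rt_in[of i] by (simp add: emb_def)
next
  case True
  then have ne: "x \<noteq> []" by auto
  then have x: "x = butlast x @ [last x]" by simp
  have "last x \<in> N i" using True ne assms wt_iff by blast
  moreover have b: "butlast x \<in> FP" using x assms(1) FP_appendD(1)[of "butlast x" "[last x]"] by simp
  moreover have "wt (butlast x) \<noteq> Some i"
  proof
    assume w: "wt (butlast x) = Some i"
    then have ne': "butlast x \<noteq> []" by auto
    then have "last (butlast x) \<in> N i" using w b assms(2) wt_iff by blast
    with \<open>last x \<in> N i\<close> ne' show False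
      using assms x FP_append[of "butlast x" "[last x]"] by auto
  qed
  ultimately show ?thesis
    using that[of "butlast x" "last x"] x rt_notin_N[of i i] assms(2)
    by (auto simp: emb_def nonroot_def)
qed

lemma pbar_nonneg: "i \<in> {1,2} \<Longrightarrow> 0 \<le> pbar V rt p i x y"
proof (cases "\<exists>v w. lifts V rt i x y v w")
  case True
  assume i: "i \<in> {1,2}"
  from True obtain v w where l: "lifts V rt i x y v w" by blast
  then have "v \<in> V i" "w \<in> V i" by (auto simp: lifts_def)
  then show ?thesis using p_nonneg[OF i] pbar_lifts[OF disj i l, of p] by simp
qed (simp add: pbar_def)

lemma tp_eq: "tp x y = rate 1 * pbar V rt p 1 x y + rate 2 * pbar V rt p 2 x y"
  by (simp add: trans_prob_def rate_def)

lemma tp_nonneg: "0 \<le> tp x y"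
  unfolding tp_eq using pbar_nonneg[of 1 x y] pbar_nonneg[of 2 x y] rate_pos[of 1] rate_pos[of 2]
  by (intro add_nonneg_nonneg mult_nonneg_nonneg) (auto intro: less_imp_le)

lemma tp_copy:
  assumes "i \<in> {1,2}" "u \<in> FP" "wt u \<noteq> Some i" "v \<in> V i" "w \<in> V i" "v \<noteq> w"
  shows "tp (u @ emb rt i v) (u @ emb rt i w) = rate i * p i v w"
proof -
  have l: "lifts V rt i (u @ emb rt i v) (u @ emb rt i w) v w"
    using assms by (auto simp: lifts_def)
  have "\<not> lifts V rt (3 - i) (u @ emb rt i v) (u @ emb rt i w) a b" for a b
    using assms(1,6) lifts_index_unique[OF disj] l by auto
  then have "pbar V rt p (3 - i) (u @ emb rt i v) (u @ emb rt i w) = 0"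
    by (simp add: pbar_def)
  with pbar_lifts[OF disj assms(1) l] assms(1) show ?thesis by (auto simp: tp_eq)
qed

lemma tp_nonzeroE:
  assumes "tp x y \<noteq> 0"
  obtains i u v w where "i \<in> {1,2}" "u \<in> FP" "wt u \<noteq> Some i" "v \<in> V i" "w \<in> V i" "v \<noteq> w"
    "x = u @ emb rt i v" "y = u @ emb rt i w" "0 < p i v w" "tp x y = rate i * p i v w"
proof -
  have "pbar V rt p 1 x y \<noteq> 0 \<or> pbar V rt p 2 x y \<noteq> 0"
    using assms by (auto simp: tp_eq)
  then obtain i where i: "i \<in> {1,2}" "pbar V rt p i x y \<noteq> 0" by auto
  then obtain v w where l: "lifts V rt i x y v w"
    by (auto simp: pbar_def split: if_splits)
  then have pv: "p i v w \<noteq> 0" using pbar_lifts[OF disj i(1) l, of p] i by auto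
  from l obtain u where u: "v \<in> V i" "w \<in> V i" "u \<in> FP" "wt u \<noteq> Some i" "x = u @ emb rt i v" "y = u @ emb rt i w"
    by (auto simp: lifts_def)
  then have "v \<noteq> w" "0 < p i v w" using pv p_diag i p_nonneg[of i v w] by (auto simp: less_le)
  then show ?thesis using that[of i u v w] i u tp_copy[of i u v w] by auto
qed

lemma tp_FP: "tp x y \<noteq> 0 \<Longrightarrow> x \<in> FP" "tp x y \<noteq> 0 \<Longrightarrow> y \<in> FP"
  by (erule tp_nonzeroE; simp add: FP_emb)+

lemma tp_self: "tp x x = 0"
proof (rule ccontr)
  assume "tp x x \<noteq> 0"
  then show False by (rule tp_nonzeroE) (auto simp: emb_def split: if_splits)
qed

lemma tp_common:
  assumes "tp x y \<noteq> 0"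
  obtains u a b where "x = u @ a" "y = u @ b" "length a \<le> 1" "length b \<le> 1" "a \<noteq> [] \<or> b \<noteq> []"
  using assms
proof (rule tp_nonzeroE)
  fix i u v w assume "i \<in> {1,2}" "v \<noteq> w" "x = u @ emb rt i v" "y = u @ emb rt i w"
  then show ?thesis using that[of u "emb rt i v" "emb rt i w"] by (simp add: emb_def split: if_splits)
qed

text \<open>A step moves inside one copy of a factor, so it touches at most the last letter of the longer word.\<close>
lemma tp_take:
  assumes "tp x y \<noteq> 0" "k < length x \<or> k < length y"
  shows "take k x = take k y"
  using assms(1) by (rule tp_common) (use assms(2) in auto)

lemma tp_length: "tp x y \<noteq> 0 \<Longrightarrow> length y \<le> Suc (length x) \<and> length x \<le> Suc (length y)"
  by (erule tp_common) auto

lemma tp_branch: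
  assumes "tp x y \<noteq> 0" "x \<in> branch j" "y \<noteq> []" "j \<in> {1,2}"
  shows "y \<in> branch j"
  using assms(1)
proof (rule tp_nonzeroE)
  fix i u v w assume h: "i \<in> {1,2}" "u \<in> FP" "wt u \<noteq> Some i" "v \<in> V i" "w \<in> V i" "v \<noteq> w"
    "x = u @ emb rt i v" "y = u @ emb rt i w"
  show ?thesis
  proof (cases "u = []")
    case True
    with h assms have "v \<in> N i" "w \<in> N i" "v \<in> N j"
      by (auto simp: emb_def branch_def nonroot_def split: if_splits)
    then have "i = j" using N_disjoint h assms by blast
    then show ?thesis using h True \<open>w \<in> N i\<close> assms by (auto simp: emb_def singleton_branch split: if_splits)
  next
    case False
    then show ?thesis using h assms tp_FP(2)[OF assms(1)] by (auto simp: branch_def)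
  qed
qed

lemma tp_first:
  assumes "tp u y \<noteq> 0" "length u < length y"
  obtains j v where "j \<in> {1,2}" "v \<in> N j" "y = u @ [v]" "wt u \<noteq> Some j"
  using assms(1)
proof (rule tp_nonzeroE)
  fix i t v w assume h: "i \<in> {1,2}" "t \<in> FP" "wt t \<noteq> Some i" "v \<in> V i" "w \<in> V i" "v \<noteq> w"
    "u = t @ emb rt i v" "y = t @ emb rt i w"
  then have "v = rt i" "w \<in> N i" using assms(2) by (auto simp: emb_def nonroot_def split: if_splits)
  then show ?thesis using that[of i w] h rt_notin_N[of i i] by (auto simp: emb_def)
qed

lemma lifts_translate:
  assumes "u \<in> FP" "wt u \<noteq> Some j" "j \<in> {1,2}" "i \<in> {1,2}"
    and "x \<in> branch j \<or> x = []" "y \<in> branch j \<or> y = []" "x \<noteq> [] \<or> y \<noteq> []"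
  shows "lifts V rt i (u @ x) (u @ y) v w \<longleftrightarrow> lifts V rt i x y v w"
proof
  assume "lifts V rt i x y v w"
  then obtain t where t: "v \<in> V i" "w \<in> V i" "t \<in> FP" "wt t \<noteq> Some i" "x = t @ emb rt i v" "y = t @ emb rt i w"
    by (auto simp: lifts_def)
  have "u @ t \<in> FP \<and> wt (u @ t) \<noteq> Some i"
  proof (cases "t = []")
    case False
    then have "t \<in> branch j" using t assms(5,6) by (auto simp: branch_def)
    then show ?thesis using FP_append_branch assms(1,2,3) t(4) False by (simp add: wt_last)
  next
    case True
    then have "(v \<in> N i \<and> [v] \<in> branch j) \<or> (w \<in> N i \<and> [w] \<in> branch j)"
      using assms t by (auto simp: emb_def nonroot_def split: if_splits)
    then have "i = j" using N_disjoint assms singleton_branch by blast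
    then show ?thesis using True assms by simp
  qed
  then show "lifts V rt i (u @ x) (u @ y) v w"
    using t by (auto simp: lifts_def)
next
  assume "lifts V rt i (u @ x) (u @ y) v w"
  then obtain t where t: "v \<in> V i" "w \<in> V i" "t \<in> FP" "wt t \<noteq> Some i" "u @ x = t @ emb rt i v" "u @ y = t @ emb rt i w"
    by (auto simp: lifts_def)
  have "length u \<le> length t"
  proof (rule ccontr)
    assume "\<not> length u \<le> length t"
    moreover have "length u + length x = length t + length (emb rt i v)"
      "length u + length y = length t + length (emb rt i w)"
      using t(5,6) by (metis length_append)+
    moreover have "length (emb rt i v) \<le> 1" "length (emb rt i w) \<le> 1" by (simp_all add: emb_def)
    moreover have "1 \<le> length x \<or> 1 \<le> length y" using assms(7) by (simp add: Suc_le_eq)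
    ultimately show False by linarith
  qed
  then obtain t' where t': "t = u @ t'"
    using t(5) by (metis append_eq_append_conv_if append_take_drop_id)
  then have "t' \<in> FP" "wt t' \<noteq> Some i"
    using t FP_appendD(2) by (auto simp: wtype_def split: if_splits)
  then show "lifts V rt i x y v w" using t t' by (auto simp: lifts_def)
qed

text \<open>Each branch at \<open>u\<close> is an isomorphic copy of the branch at the empty word. Only the end of a
word decides which copies of the factors contain it, and the end survives the translation.\<close>
lemma tp_translate:
  assumes "u \<in> FP" "wt u \<noteq> Some j" "j \<in> {1,2}"
    and "x \<in> branch j \<or> x = []" "y \<in> branch j \<or> y = []"
  shows "tp (u @ x) (u @ y) = tp x y"
proof (cases "x = [] \<and> y = []")
  case False
  then have ne: "x \<noteq> [] \<or> y \<noteq> []" by simp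
  have "pbar V rt p i (u @ x) (u @ y) = pbar V rt p i x y" if i: "i \<in> {1,2}" for i
  proof -
    have "lifts V rt i (u @ x) (u @ y) = lifts V rt i x y"
      by (intro ext lifts_translate[OF assms(1-3) i assms(4,5) ne])
    then show ?thesis by (simp only: pbar_def)
  qed
  then show ?thesis by (simp add: tp_eq)
qed (simp add: tp_self)

end

section \<open>Loops, blocks and their masses\<close>

context free_walk begin

definition Q :: "'a list \<Rightarrow> 'a list \<Rightarrow> ennreal" where
  "Q x y = ennreal (tp x y)"

lemma Q_nonzero: "Q x y \<noteq> 0 \<longleftrightarrow> tp x y \<noteq> 0"
  using tp_nonneg[of x y] by (simp add: Q_def order_less_le)

definition opp :: "nat \<Rightarrow> nat" where "opp j = 3 - j"

lemma opp_in [simp]: "j \<in> {1,2} \<Longrightarrow> opp j \<in> {1,2}" by (auto simp: opp_def)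
lemma opp_opp [simp]: "j \<in> {1,2} \<Longrightarrow> opp (opp j) = j" by (auto simp: opp_def)
lemma opp_neq: "j \<in> {1,2} \<Longrightarrow> i \<in> {1,2} \<Longrightarrow> i \<noteq> j \<Longrightarrow> i = opp j" by (auto simp: opp_def)
lemma rate_opp: "j \<in> {1,2} \<Longrightarrow> rate j + rate (opp j) = 1" by (auto simp: opp_def rate_def)

lemma copy_row_sum:
  assumes i: "i \<in> {1,2}" and u: "u \<in> FP" "wt u \<noteq> Some i" and v: "v \<in> V i"
  shows "msum (\<lambda>w. Q (u @ emb rt i v) (u @ emb rt i w)) (V i) = ennreal (rate i)"
proof -
  have "Q (u @ emb rt i v) (u @ emb rt i w) = ennreal (rate i * p i v w)" if "w \<in> V i" for w
    using tp_copy[OF i u v that] tp_self p_diag[OF i v] by (cases "v = w") (auto simp: Q_def)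
  then have "msum (\<lambda>w. Q (u @ emb rt i v) (u @ emb rt i w)) (V i) = msum (\<lambda>w. ennreal (rate i) * ennreal (p i v w)) (V i)"
    using rate_pos[of i] p_nonneg[OF i v] by (intro msum_cong) (simp add: ennreal_mult)
  also have "\<dots> = ennreal (rate i)"
    using msum_has_sum[OF p_has_sum[OF i v] p_nonneg[OF i v]] by (simp add: msum_cmult)
  finally show ?thesis .
qed

lemma row_sum_le_1:
  assumes "x \<in> FP"
  shows "msum (Q x) UNIV \<le> 1"
proof -
  have "\<exists>u v. u \<in> FP \<and> wt u \<noteq> Some i \<and> v \<in> V i \<and> x = u @ emb rt i v" if "i \<in> {1,2}" for i
    by (rule FP_decomp[OF assms that]) blast
  then obtain u v where uv: "\<And>i. i \<in> {1,2} \<Longrightarrow> u i \<in> FP \<and> wt (u i) \<noteq> Some i \<and> v i \<in> V i \<and> x = u i @ emb rt i (v i)"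
    by metis
  define C where "C i = (\<lambda>w. u i @ emb rt i w) ` V i" for i
  have inj: "inj_on (\<lambda>w. u i @ emb rt i w) (V i)" for i
    by (auto simp: inj_on_def emb_def split: if_splits)
  have C: "msum (Q x) (C i) = ennreal (rate i)" if i: "i \<in> {1,2}" for i
    unfolding C_def msum_reindex[OF inj] using copy_row_sum[OF i, of "u i" "v i"] uv[OF i] by simp
  have "{y\<in>UNIV. Q x y \<noteq> 0} \<subseteq> C 1 \<union> C 2"
  proof
    fix y assume "y \<in> {y\<in>UNIV. Q x y \<noteq> 0}"
    then have "tp x y \<noteq> 0" by (simp add: Q_nonzero)
    then show "y \<in> C 1 \<union> C 2"
    proof (rule tp_nonzeroE)
      fix i t a b assume h: "i \<in> {1,2}" "t \<in> FP" "wt t \<noteq> Some i" "a \<in> V i" "b \<in> V i"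
        "x = t @ emb rt i a" "y = t @ emb rt i b"
      have "lifts V rt i x x a a" using h unfolding lifts_def by blast
      moreover have "x = u i @ emb rt i (v i)" "u i \<in> FP" "wt (u i) \<noteq> Some i" "v i \<in> V i"
        using uv[OF h(1)] by auto
      then have "lifts V rt i x x (v i) (v i)" unfolding lifts_def by blast
      ultimately have "a = v i" using lifts_unique[OF disj h(1)] by blast
      then have "t = u i" using h(6) uv[OF h(1)] by simp
      then have "y \<in> C i" using h by (auto simp: C_def)
      then show ?thesis using h(1) by auto
    qed
  qed
  then have "msum (Q x) UNIV \<le> msum (Q x) (C 1 \<union> C 2)"
    by (rule msum_support_subset)
  also have "\<dots> \<le> msum (Q x) (C 1) + msum (Q x) (C 2)" by (rule msum_Un_le)
  also have "\<dots> = ennreal (rate 1 + rate 2)"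
    using C[of 1] C[of 2] rate_pos[of 1] rate_pos[of 2] by (simp add: ennreal_plus)
  also have "\<dots> = 1" unfolding rate_sum by simp
  finally show ?thesis .
qed

text \<open>With the parameter \<open>z\<close>, masses become generating functions in the length of the path; \<open>z = 1\<close> gives
probabilities.\<close>
definition wp :: "ennreal \<Rightarrow> 'a list \<Rightarrow> 'a list list \<Rightarrow> ennreal" where
  "wp z x s = z ^ length s * pweight Q x s"

lemma wp_Nil [simp]: "wp z x [] = 1"
  and wp_Cons: "wp z x (y # s) = z * Q x y * wp z y s"
  by (simp_all add: wp_def ac_simps)

lemma wp_append: "wp z x (s @ t) = wp z x s * wp z (last (x # s)) t"
  by (simp add: wp_def pweight_append power_add ac_simps)

lemma wp_1: "wp 1 x = pweight Q x"
  by (simp add: wp_def fun_eq_iff)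

lemma kraft:
  assumes "x \<in> FP" "prefix_free F"
  shows "msum (wp 1 x) F \<le> 1"
  unfolding wp_1
  by (rule pweight_prefix_free_le_1[where S=FP])
     (use assms row_sum_le_1 tp_FP(2) in \<open>auto simp: Q_nonzero\<close>)

lemma wp_nonzeroD:
  assumes "wp z x s \<noteq> 0"
  shows "pweight Q x s \<noteq> 0"
  using assms by (auto simp: wp_def)

lemma pweight_FP: "pweight Q x s \<noteq> 0 \<Longrightarrow> x \<in> FP \<Longrightarrow> set s \<subseteq> FP"
  by (induction s arbitrary: x) (auto simp: Q_nonzero dest: tp_FP)

lemma FP_suffix_branch:
  assumes "u \<noteq> []" "u @ y \<in> FP" "y \<noteq> []" "wt u \<noteq> Some j" "j \<in> {1,2}"
  shows "y \<in> branch j"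
proof -
  have uy: "u \<in> FP" "y \<in> FP" "\<not> (\<exists>i\<in>{1,2}. last u \<in> N i \<and> hd y \<in> N i)"
    using assms FP_append by blast+
  have "last u \<notin> N j" using assms uy(1) wt_iff[of u j] by simp
  then have "last u \<in> N (opp j)" using FP_last[OF uy(1) assms(1)] assms(5) by (auto simp: opp_def)
  then have "hd y \<notin> N (opp j)" using uy(3) opp_in[OF assms(5)] by blast
  then have "hd y \<in> N j" using FP_hd[OF uy(2) assms(3)] assms(5) by (auto simp: opp_def)
  then show ?thesis using uy assms(3) by (simp add: branch_def)
qed

text \<open>The word \<open>u\<close> separates the branches at \<open>u\<close> from each other and from the rest of the free product.\<close>
lemma path_in_branch:
  assumes "pweight Q (u @ x) s \<noteq> 0" "u \<in> FP" "wt u \<noteq> Some j" "j \<in> {1,2}" "x \<in> branch j"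
    and "\<And>y. y \<in> set s \<Longrightarrow> length u < length y"
  shows "\<exists>t. set t \<subseteq> branch j \<and> s = map ((@) u) t"
  using assms
proof (induction s arbitrary: x)
  case (Cons y s)
  have tp: "tp (u @ x) y \<noteq> 0" and rest: "pweight Q y s \<noteq> 0"
    using Cons.prems(1) by (auto simp: Q_nonzero)
  have "take (length u) (u @ x) = take (length u) y"
    using tp_take[OF tp, of "length u"] Cons.prems(6)[of y] by simp
  then obtain y' where y: "y = u @ y'" by (metis append_eq_conv_conj append_take_drop_id)
  have y'ne: "y' \<noteq> []" using Cons.prems(6)[of y] y by auto
  have y': "y' \<in> branch j"
  proof (cases "u = []")
    case True
    then show ?thesis using tp_branch[of x y' j] tp y Cons.prems(4,5) y'ne by simp
  next
    case False
    then show ?thesis using FP_suffix_branch[of u y' j] tp_FP(2)[OF tp] y y'ne Cons.prems(3,4) by simp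
  qed
  obtain t where "set t \<subseteq> branch j" "s = map ((@) u) t"
    using Cons.IH[of y'] rest Cons.prems y y' by auto
  then show ?case using y y' by (intro exI[of _ "y' # t"]) auto
qed (auto intro!: exI[of _ "[]"])

lemma path_above_cut:
  assumes "pweight Q u s \<noteq> 0" "u \<in> FP" "s \<noteq> []"
    and "\<And>y. y \<in> set s \<Longrightarrow> length u < length y"
  obtains j t where "j \<in> {1,2}" "wt u \<noteq> Some j" "set t \<subseteq> branch j" "s = map ((@) u) t"
proof -
  obtain y s' where s: "s = y # s'" using assms(3) by (cases s) auto
  have tp: "tp u y \<noteq> 0" and rest: "pweight Q y s' \<noteq> 0" using assms(1) s by (auto simp: Q_nonzero)
  obtain j v where j: "j \<in> {1,2}" "v \<in> N j" "y = u @ [v]" "wt u \<noteq> Some j"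
    using tp_first[OF tp] assms(4)[of y] s by auto
  obtain t where "set t \<subseteq> branch j" "s' = map ((@) u) t"
    using path_in_branch[of u "[v]" s' j] rest j assms s singleton_branch[OF j(1)] by auto
  then show ?thesis using that[of j "[v] # t"] j s singleton_branch[OF j(1)] by auto
qed

lemma Q_translate:
  assumes "u \<in> FP" "wt u \<noteq> Some j" "j \<in> {1,2}"
    and "x \<in> insert [] (branch j)" "y \<in> insert [] (branch j)"
  shows "Q (u @ x) (u @ y) = Q x y"
proof -
  have "tp (u @ x) (u @ y) = tp x y"
    by (rule tp_translate[OF assms(1-3)]) (use assms(4,5) in auto)
  then show ?thesis by (simp add: Q_def)
qed

lemma pweight_translate:
  assumes "u \<in> FP" "wt u \<noteq> Some j" "j \<in> {1,2}"
    and "x \<in> insert [] (branch j)" "set s \<subseteq> insert [] (branch j)"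
  shows "pweight Q (u @ x) (map ((@) u) s) = pweight Q x s"
  using assms(4,5)
proof (induction s arbitrary: x)
  case (Cons y s)
  then show ?case using Q_translate[OF assms(1-3), of x y] by simp
qed simp

lemma wp_translate:
  assumes "u \<in> FP" "wt u \<noteq> Some j" "j \<in> {1,2}"
    and "set s \<subseteq> insert [] (branch j)"
  shows "wp z u (map ((@) u) s) = wp z [] s"
  using pweight_translate[OF assms(1-3) _ assms(4), of "[]"] by (simp add: wp_def)

text \<open>First returns to the empty word through branch \<open>j\<close>.\<close>
definition loops :: "nat \<Rightarrow> 'a list list set" where
  "loops j = (\<lambda>s. s @ [[]]) ` {s. s \<noteq> [] \<and> set s \<subseteq> branch j}"

definition ret :: "nat \<Rightarrow> ennreal \<Rightarrow> ennreal" where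
  "ret j z = msum (wp z []) (loops j)"

text \<open>A block is what the walk does between its last visits to two consecutive prefixes of the
infinite word to which it converges.\<close>
definition blocks :: "nat \<Rightarrow> 'a list list set" where
  "blocks j = {s. s \<noteq> [] \<and> set s \<subseteq> branch j \<and> length (last s) = 1}"

definition level_paths :: "nat \<Rightarrow> 'a list \<Rightarrow> 'a list list set" where
  "level_paths j x = {s. set s \<subseteq> branch j \<and> length (last (x # s)) = 1}"

text \<open>A bound for the generating function of one move between consecutive visits to the first level of
branch \<open>j\<close>: a step inside the copy of factor \<open>j\<close> (where \<open>rate j\<close> also counts the step to the root),
or a loop through the other branch at the current vertex.\<close>
definition level_growth :: "nat \<Rightarrow> ennreal \<Rightarrow> ennreal" where
  "level_growth j z = z * ennreal (rate j) + ret (opp j) z"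

lemma branch_ne: "x \<in> branch j \<Longrightarrow> x \<noteq> []"
  by (simp add: branch_def)

lemma branch_FP: "x \<in> branch j \<Longrightarrow> x \<in> FP"
  by (simp add: branch_def)

lemma length1_branch:
  assumes "x \<in> branch j" "length x = 1"
  obtains v where "x = [v]" "v \<in> N j"
  using assms by (cases x) (auto simp: branch_def)

lemma wt_singleton: "v \<in> N j \<Longrightarrow> j \<in> {1,2} \<Longrightarrow> wt [v] = Some j"
  using wt_iff[of "[v]" j] singleton_branch[of j v] branch_FP by auto

definition level_moves :: "nat \<Rightarrow> 'a list \<Rightarrow> 'a list list set" where
  "level_moves j x = (\<lambda>w. [[w]]) ` N j \<union> map ((@) x) ` loops (opp j)"

lemma single_step_mass:
  assumes "j \<in> {1,2}" "v \<in> V j"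
  shows "msum (\<lambda>w. Q (emb rt j v) [w]) (N j) \<le> ennreal (rate j)"
proof -
  have "msum (\<lambda>w. Q (emb rt j v) [w]) (N j) = msum (\<lambda>w. Q ([] @ emb rt j v) ([] @ emb rt j w)) (N j)"
    by (intro msum_cong) (auto simp: emb_def nonroot_def)
  also have "\<dots> \<le> msum (\<lambda>w. Q ([] @ emb rt j v) ([] @ emb rt j w)) (V j)"
    by (rule msum_subset) (auto simp: nonroot_def)
  also have "\<dots> = ennreal (rate j)"
    by (rule copy_row_sum) (use assms in auto)
  finally show ?thesis .
qed

lemma level_moves_mass:
  assumes j: "j \<in> {1,2}" and v: "v \<in> N j"
  shows "msum (wp z [v]) (level_moves j [v]) \<le> level_growth j z"
proof -
  have emb: "emb rt j v = [v]" "v \<in> V j" using v by (auto simp: emb_def nonroot_def)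
  have "msum (wp z [v]) ((\<lambda>w. [[w]]) ` N j) = msum (\<lambda>w. z * Q (emb rt j v) [w]) (N j)"
    by (subst msum_reindex) (auto simp: inj_on_def wp_Cons emb)
  also have "\<dots> \<le> z * ennreal (rate j)"
    unfolding msum_cmult by (intro mult_left_mono single_step_mass j emb) simp
  finally have 1: "msum (wp z [v]) ((\<lambda>w. [[w]]) ` N j) \<le> z * ennreal (rate j)" .
  have sub: "set l \<subseteq> insert [] (branch (opp j))" if "l \<in> loops (opp j)" for l
    using that by (auto simp: loops_def)
  have wtv: "wt [v] \<noteq> Some (opp j)" "[v] \<in> FP"
    using wt_singleton[OF v j] j singleton_branch[OF j] v branch_FP by (auto simp: opp_def)
  have "msum (wp z [v]) (map ((@) [v]) ` loops (opp j)) = msum (\<lambda>l. wp z [v] (map ((@) [v]) l)) (loops (opp j))"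
    by (rule msum_reindex) (auto simp: inj_on_def intro: map_injective)
  also have "\<dots> = ret (opp j) z"
    unfolding ret_def by (intro msum_cong wp_translate[OF wtv(2,1) opp_in[OF j]] sub)
  finally have 2: "msum (wp z [v]) (map ((@) [v]) ` loops (opp j)) = ret (opp j) z" .
  show ?thesis
    unfolding level_moves_def level_growth_def
    by (rule order_trans[OF msum_Un_le]) (use 1 2 in \<open>auto intro: add_mono\<close>)
qed

text \<open>Cut at the last visit to the first level before the end. What follows either is a single step or
stays above one vertex of the first level until it returns to that vertex.\<close>
lemma level_paths_split:
  assumes j: "j \<in> {1,2}" and v: "v \<in> N j" and c: "c \<in> level_paths j [v]" "c \<noteq> []" "pweight Q [v] c \<noteq> 0"
  obtains s t where "c = s @ t" "s \<in> level_paths j [v]" "t \<noteq> []" "t \<in> level_moves j (last ([v] # s))"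
proof -
  obtain c' e where c': "c = c' @ [e]" using c(2) by (metis append_butlast_last_id)
  have vb: "[v] \<in> branch j" using v singleton_branch[OF j] by simp
  have sub: "set ([v] # c) \<subseteq> branch j" using c(1) vb by (simp add: level_paths_def)
  have "\<exists>x\<in>set ([v] # c'). length x = 1" by simp
  then obtain ys x zs where sp: "[v] # c' = ys @ x # zs" "length x = 1" "\<forall>z\<in>set zs. length z \<noteq> 1"
    using split_list_last_prop[of "[v] # c'" "\<lambda>x. length x = 1"] by blast
  obtain s where s: "ys @ [x] = [v] # s" "c' = s @ zs"
    using sp(1) by (cases ys) auto
  have x: "x = last ([v] # s)" using s(1) by (metis last_snoc)
  have xb: "x \<in> branch j" using sub sp(1) c' by (metis Un_iff in_set_conv_decomp set_append set_ConsD subset_iff list.set_intros(2))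
  obtain w where w: "x = [w]" "w \<in> N j" using length1_branch[OF xb sp(2)] .
  have eb: "e \<in> branch j" "length e = 1" using c(1) c' by (auto simp: level_paths_def)
  obtain w' where w': "e = [w']" "w' \<in> N j" using length1_branch[OF eb] .
  have s_lp: "s \<in> level_paths j [v]"
    using sub c' s(2) x sp(2) by (auto simp: level_paths_def)
  have pw: "pweight Q x (zs @ [e]) \<noteq> 0"
    using c(3) c' s(2) x by (auto simp: pweight_append)
  have "zs @ [e] \<in> level_moves j x"
  proof (cases "zs = []")
    case True
    then show ?thesis using w' by (auto simp: level_moves_def)
  next
    case False
    have zl: "length x < length z" if "z \<in> set zs" for z
    proof -
      have "z \<in> branch j" using that sub c' s(2) by auto
      then have "length z \<noteq> 0" using branch_ne[of z j] by simp
      moreover have "length z \<noteq> 1" using sp(3) that by blast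
      ultimately show ?thesis using sp(2) by linarith
    qed
    have pz: "pweight Q x zs \<noteq> 0" using pw by (auto simp: pweight_append)
    obtain i t where t: "i \<in> {1,2}" "wt x \<noteq> Some i" "set t \<subseteq> branch i" "zs = map ((@) x) t"
      using path_above_cut[OF pz branch_FP[OF xb] False zl] by blast
    have "wt x = Some j" using w wt_singleton[OF w(2) j] by simp
    then have i: "i = opp j" using opp_neq[OF j t(1)] t(2) by blast
    have "tp (last zs) e \<noteq> 0" using pw False by (auto simp: pweight_append Q_nonzero)
    then have "take 1 (last zs) = take 1 e"
      by (rule tp_take) (use zl[OF last_in_set[OF False]] sp(2) in auto)
    moreover have "take 1 (last zs) = x"
      using t(4) False w by (simp add: last_map)
    ultimately have "e = x" using w' w by simp
    then have "zs @ [e] = map ((@) x) (t @ [[]])" using t(4) by simp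
    moreover have "t @ [[]] \<in> loops (opp j)" using t i False by (auto simp: loops_def)
    ultimately show ?thesis unfolding level_moves_def by blast
  qed
  then show ?thesis using that[of s "zs @ [e]"] c' s(2) s_lp x by simp
qed

text \<open>Restricted to length at most \<open>n\<close>, the masses satisfy \<open>S (Suc n) \<le> 1 + S n * level_growth j z\<close>. So
any \<open>C\<close> that is mapped below itself is a bound; the restriction to bounded length supplies the
induction without knowing in advance that the masses are finite.\<close>
lemma level_paths_mass:
  assumes j: "j \<in> {1,2}" and v: "v \<in> N j" and C: "1 + C * level_growth j z \<le> C"
  shows "msum (wp z [v]) (level_paths j [v]) \<le> C"
proof (rule msum_le_by_size[where g=length])
  fix n
  show "msum (wp z [v]) {c\<in>level_paths j [v]. length c \<le> n} \<le> C"
  proof (induction n)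
    case 0
    have "msum (wp z [v]) {c\<in>level_paths j [v]. length c \<le> 0} \<le> msum (wp z [v]) {[]}"
      by (rule msum_subset) auto
    also have "\<dots> \<le> 1 + C * level_growth j z" by simp
    finally show ?case using C by (rule order_trans)
  next
    case (Suc n)
    let ?L = "{c\<in>level_paths j [v]. length c \<le> n}"
    let ?F = "(\<lambda>(s, t). s @ t) ` (SIGMA s:?L. level_moves j (last ([v] # s)))"
    have "msum (wp z [v]) {c\<in>level_paths j [v]. length c \<le> Suc n} \<le> msum (wp z [v]) ({[]} \<union> ?F)"
    proof (rule msum_support_subset, rule subsetI)
      fix c assume "c \<in> {c \<in> {c \<in> level_paths j [v]. length c \<le> Suc n}. wp z [v] c \<noteq> 0}"
      then have h: "c \<in> level_paths j [v]" "length c \<le> Suc n" "wp z [v] c \<noteq> 0" by auto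
      show "c \<in> {[]} \<union> ?F"
      proof (cases "c = []")
        case False
        obtain s t where st: "c = s @ t" "s \<in> level_paths j [v]" "t \<noteq> []" "t \<in> level_moves j (last ([v] # s))"
          using level_paths_split[OF j v h(1) False wp_nonzeroD[OF h(3)]] .
        then have "length s \<le> n" using h(2) by (cases t) auto
        then have "c \<in> ?F" using st by (intro image_eqI[of _ _ "(s, t)"]) auto
        then show ?thesis by simp
      qed simp
    qed
    also have "\<dots> \<le> msum (wp z [v]) {[]} + msum (wp z [v]) ?F" by (rule msum_Un_le)
    also have "msum (wp z [v]) ?F \<le> msum (\<lambda>s. wp z [v] s * level_growth j z) ?L"
    proof (rule msum_decomp[where c="\<lambda>s t. s @ t" and B="\<lambda>s. level_moves j (last ([v] # s))" and h="\<lambda>s t. wp z (last ([v] # s)) t"])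
      fix s assume s: "s \<in> ?L"
      have "last ([v] # s) \<in> branch j"
        using s v singleton_branch[OF j] last_in_set[of s] by (auto simp: level_paths_def)
      then obtain w where "last ([v] # s) = [w]" "w \<in> N j"
        using s by (elim length1_branch) (auto simp: level_paths_def)
      then show "msum (wp z (last ([v] # s))) (level_moves j (last ([v] # s))) \<le> level_growth j z"
        using level_moves_mass[OF j] by simp
    next
      fix s t show "wp z [v] (s @ t) \<le> wp z [v] s * wp z (last ([v] # s)) t"
        by (simp only: wp_append order_refl)
    qed simp
    also have "\<dots> = msum (wp z [v]) ?L * level_growth j z" by (rule msum_multc)
    also have "\<dots> \<le> C * level_growth j z" by (intro mult_right_mono Suc.IH) simp
    also have "msum (wp z [v]) {[]} + C * level_growth j z \<le> C" using C by simp
    finally show ?case by simp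
  qed
qed

lemma blocks_mass:
  assumes j: "j \<in> {1,2}" and C: "1 + C * level_growth j z \<le> C"
  shows "msum (wp z []) (blocks j) \<le> z * ennreal (rate j) * C"
proof -
  have "msum (wp z []) (blocks j) \<le> msum (\<lambda>v. z * Q [] [v] * C) (N j)"
  proof -
    have "msum (wp z []) (blocks j) \<le> msum (wp z []) ((\<lambda>(v, s). [v] # s) ` (SIGMA v:N j. level_paths j [v]))"
    proof (rule msum_support_subset, rule subsetI)
      fix s assume "s \<in> {s\<in>blocks j. wp z [] s \<noteq> 0}"
      then have s: "s \<noteq> []" "set s \<subseteq> branch j" "length (last s) = 1" "wp z [] s \<noteq> 0"
        by (auto simp: blocks_def)
      then obtain y t where y: "s = y # t" by (cases s) auto
      then have "tp [] y \<noteq> 0" using s(4) by (auto simp: wp_Cons Q_nonzero)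
      then have "length y \<le> 1" by (auto dest: tp_length)
      moreover have "y \<in> branch j" using s y by simp
      ultimately obtain v where "y = [v]" "v \<in> N j"
        using branch_ne[of y j] by (cases y) (auto simp: branch_def)
      moreover have "t \<in> level_paths j y" using s y by (auto simp: level_paths_def)
      ultimately show "s \<in> (\<lambda>(v, s). [v] # s) ` (SIGMA v:N j. level_paths j [v])"
        using y by (intro image_eqI[of _ _ "(v, t)"]) auto
    qed
    also have "\<dots> \<le> msum (\<lambda>v. (z * Q [] [v]) * C) (N j)"
      by (rule msum_decomp[where c="\<lambda>v s. [v] # s" and B="\<lambda>v. level_paths j [v]" and h="\<lambda>v s. wp z [v] s"])
         (use level_paths_mass[OF j _ C] in \<open>auto simp: wp_Cons\<close>)
    finally show ?thesis .
  qed
  also have "\<dots> = z * msum (\<lambda>v. Q (emb rt j (rt j)) [v]) (N j) * C"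
    by (simp add: msum_multc msum_cmult emb_def)
  also have "\<dots> \<le> z * ennreal (rate j) * C"
    by (intro mult_right_mono mult_left_mono single_step_mass j rt_in) auto
  finally show ?thesis .
qed

end

section \<open>Transience and exponential moments\<close>

context free_walk begin

definition returns :: "'a list list set" where
  "returns = {s. last ([] # s) = []}"

lemma loops_last: "l \<in> loops j \<Longrightarrow> l \<noteq> [] \<and> last l = []"
  by (auto simp: loops_def)

lemma branch_disjoint: "branch 1 \<inter> branch 2 = {}"
  using N_disjoint[of _ 1 2] by (auto simp: branch_def)

lemma loops_disjoint: "loops 1 \<inter> loops 2 = {}"
proof -
  have False if "l \<in> loops 1" "l \<in> loops 2" for l
  proof -
    obtain s where s: "l = s @ [[]]" "s \<noteq> []" "set s \<subseteq> branch 1" using \<open>l \<in> loops 1\<close> by (auto simp: loops_def)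
    then have "set s \<subseteq> branch 2" using \<open>l \<in> loops 2\<close> by (auto simp: loops_def)
    then show False using s branch_disjoint hd_in_set[OF s(2)] by blast
  qed
  then show ?thesis by blast
qed

lemma returns_loops_inj: "inj_on (\<lambda>(s, l). s @ l) (returns \<times> (loops 1 \<union> loops 2))"
proof -
  have aux: "us = []" if "us @ a = a'" "[] \<notin> set a'" "s' @ us \<in> returns" for us a a' s' :: "'a list list"
  proof (rule ccontr)
    assume "us \<noteq> []"
    then have "last us = []" using that(3) by (simp add: returns_def)
    then show False using that(1,2) \<open>us \<noteq> []\<close> last_in_set[of us] by auto
  qed
  have "s = s' \<and> l = l'" if h: "s \<in> returns" "s' \<in> returns" "l \<in> loops 1 \<union> loops 2" "l' \<in> loops 1 \<union> loops 2" "s @ l = s' @ l'"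
    for s s' l l'
  proof -
    have L: "\<exists>a. l = a @ [[]] \<and> [] \<notin> set a" if "l \<in> loops 1 \<union> loops 2" for l
      using that by (auto simp: loops_def branch_def)
    obtain a a' where a: "l = a @ [[]]" "[] \<notin> set a" "l' = a' @ [[]]" "[] \<notin> set a'"
      using L[OF h(3)] L[OF h(4)] by blast
    then have "s @ a = s' @ a'" using h(5) by simp
    then obtain us where "s = s' @ us \<and> us @ a = a' \<or> s @ us = s' \<and> a = us @ a'"
      unfolding append_eq_append_conv2 by blast
    then have "s = s' \<and> a = a'" using aux[of us a a' s'] aux[of us a' a s] a h(1,2) by auto
    then show ?thesis using a by simp
  qed
  then show ?thesis unfolding inj_on_def by auto
qed

text \<open>Appending a loop to a path of returns is injective and never gives the empty path. Hence the total
mass \<open>G\<close> of the returns satisfies \<open>1 + G * U \<le> G\<close>, where \<open>U\<close> is the mass of the loops.\<close>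
lemma ret_sum_less_1:
  assumes fin: "msum (wp 1 []) returns < \<infinity>"
  shows "ret 1 1 + ret 2 1 < 1"
proof (rule ccontr)
  assume "\<not> ret 1 1 + ret 2 1 < 1"
  then have U: "1 \<le> ret 1 1 + ret 2 1" by simp
  let ?G = "msum (wp 1 []) returns"
  let ?L = "loops 1 \<union> loops 2"
  have UL: "msum (wp 1 []) ?L = ret 1 1 + ret 2 1"
    unfolding ret_def by (rule msum_Un_disjoint[OF loops_disjoint])
  have "?G * msum (wp 1 []) ?L = msum (\<lambda>(s, l). wp 1 [] s * wp 1 [] l) (returns \<times> ?L)"
    by (rule msum_Times[symmetric])
  also have "\<dots> = msum (\<lambda>x. wp 1 [] (case x of (s, l) \<Rightarrow> s @ l)) (returns \<times> ?L)"
    by (intro msum_cong) (auto simp: wp_append returns_def simp del: last.simps)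
  also have "\<dots> = msum (wp 1 []) ((\<lambda>(s, l). s @ l) ` (returns \<times> ?L))"
    by (rule msum_reindex[OF returns_loops_inj, symmetric])
  finally have "1 + ?G * msum (wp 1 []) ?L = msum (wp 1 []) ({[]} \<union> (\<lambda>(s, l). s @ l) ` (returns \<times> ?L))"
    by (subst msum_Un_disjoint) (auto simp: loops_def)
  also have "\<dots> \<le> ?G"
    by (rule msum_subset) (auto simp: returns_def loops_def)
  finally have le: "1 + ?G * msum (wp 1 []) ?L \<le> ?G" .
  have "1 + ?G * 1 \<le> 1 + ?G * msum (wp 1 []) ?L"
    unfolding UL by (intro add_left_mono mult_left_mono U) simp
  from order_trans[OF this le] show False using fin
    by (cases ?G) (auto simp: ennreal_plus[symmetric] simp del: ennreal_plus)
qed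

text \<open>Continuations inside branch \<open>j\<close> that leave it at their last step, to the empty word.\<close>
definition hitting :: "nat \<Rightarrow> 'a list list set" where
  "hitting j = {s @ [[]] | s. set s \<subseteq> branch j}"

lemma prefix_free_snoc:
  assumes "\<And>s. s \<in> F \<Longrightarrow> \<exists>c. s = c @ [x] \<and> x \<notin> set c"
  shows "prefix_free F"
  unfolding prefix_free_def
proof (intro allI impI)
  fix s r assume "s \<in> F" "s @ r \<in> F"
  obtain c where c: "s = c @ [x]" using assms[OF \<open>s \<in> F\<close>] by blast
  obtain c' where c': "s @ r = c' @ [x]" "x \<notin> set c'" using assms[OF \<open>s @ r \<in> F\<close>] by blast
  show "r = []"
  proof (rule ccontr)
    assume "r \<noteq> []"
    then have "c' = s @ butlast r" using c'(1) by (metis butlast_append butlast_snoc)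
    then show False using c c'(2) by auto
  qed
qed

lemma prefix_free_hitting: "prefix_free (hitting j)"
  by (rule prefix_free_snoc[where x="[]"]) (auto simp: hitting_def branch_def)

lemma hitting_le_1: "x \<in> FP \<Longrightarrow> msum (wp 1 x) (hitting j) \<le> 1"
  by (rule kraft[OF _ prefix_free_hitting])

text \<open>The first step either stays in the copy of factor \<open>j\<close>, which has mass at most \<open>rate j\<close>, or begins a
loop through the other branch, after which the path starts afresh.\<close>
lemma hitting_bound:
  assumes j: "j \<in> {1,2}" and v: "v \<in> N j"
  shows "msum (wp 1 [v]) (hitting j) \<le> ennreal (rate j) + ret (opp j) 1 * msum (wp 1 [v]) (hitting j)"
proof -
  let ?short = "{s\<in>hitting j. length (hd s) \<le> 1}"
  let ?long = "(\<lambda>(l, s). map ((@) [v]) l @ s) ` (loops (opp j) \<times> hitting j)"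
  have vj: "[v] \<in> branch j" "[v] \<in> FP" "wt [v] = Some j"
    using v j singleton_branch[OF j] branch_FP wt_singleton by auto
  have "msum (wp 1 [v]) (hitting j) \<le> msum (wp 1 [v]) (?short \<union> ?long)"
  proof (rule msum_support_subset, rule subsetI)
    fix s assume "s \<in> {s \<in> hitting j. wp 1 [v] s \<noteq> 0}"
    then have h: "s \<in> hitting j" "pweight Q [v] s \<noteq> 0" by (auto simp: wp_1)
    then obtain c where c: "s = c @ [[]]" "set c \<subseteq> branch j" by (auto simp: hitting_def)
    show "s \<in> ?short \<union> ?long"
    proof (cases "length (hd s) \<le> 1")
      case False
      have "\<exists>x\<in>set s. length x \<le> 1" using c by auto
      then obtain zs x r where sp: "s = zs @ x # r" "length x \<le> 1" "\<forall>z\<in>set zs. \<not> length z \<le> 1"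
        using split_list_first_prop[of s "\<lambda>x. length x \<le> 1"] by blast
      have zne: "zs \<noteq> []" using False sp(1,2) by (cases zs) auto
      have zl: "length [v] < length z" if "z \<in> set zs" for z using sp(3) that by auto
      have pz: "pweight Q [v] zs \<noteq> 0" and pxr: "pweight Q (last zs) (x # r) \<noteq> 0"
        using h(2) sp(1) zne by (auto simp: pweight_append)
      obtain i t where t: "i \<in> {1,2}" "wt [v] \<noteq> Some i" "set t \<subseteq> branch i" "zs = map ((@) [v]) t"
        using path_above_cut[OF pz vj(2) zne zl] by blast
      then have i: "i = opp j" using vj(3) opp_neq[OF j t(1)] by auto
      have ll: "1 < length (last zs)" using zl[OF last_in_set[OF zne]] by simp
      have tpx: "tp (last zs) x \<noteq> 0" using pxr by (auto simp: Q_nonzero)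
      have "take 1 (last zs) = take 1 x" using tp_take[OF tpx, of 1] ll by simp
      moreover have "take 1 (last zs) = [v]" using t(4) zne by (simp add: last_map)
      ultimately have x: "x = [v]" using sp(2) by simp
      then have rne: "r \<noteq> []" using sp(1) c(1) by auto
      then have "r = butlast r @ [[]]" "set (butlast r) \<subseteq> set c"
        using sp(1) c(1) by (auto simp: append_eq_append_conv2 append_eq_Cons_conv Cons_eq_append_conv butlast_append)
      then have "r \<in> hitting j" using c(2) unfolding hitting_def by blast
      moreover have "map ((@) [v]) (t @ [[]]) @ r = s" using sp(1) t(4) x by simp
      moreover have "t @ [[]] \<in> loops (opp j)" using t i zne by (auto simp: loops_def)
      ultimately have "s \<in> ?long" by (intro image_eqI[of _ _ "(t @ [[]], r)"]) auto
      then show ?thesis by simp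
    qed (use h in auto)
  qed
  also have "\<dots> \<le> msum (wp 1 [v]) ?short + msum (wp 1 [v]) ?long" by (rule msum_Un_le)
  also have "msum (wp 1 [v]) ?short \<le> ennreal (rate j)"
  proof -
    have "msum (wp 1 [v]) ?short \<le> msum (\<lambda>w. Q [v] (emb rt j w) * 1) (V j)"
    proof (rule msum_decomp[where c="\<lambda>w s. emb rt j w # s" and B="\<lambda>w. {s. emb rt j w # s \<in> hitting j}" and h="\<lambda>w s. wp 1 (emb rt j w) s"])
      show "?short \<subseteq> (\<lambda>(w, s). emb rt j w # s) ` (SIGMA w:V j. {s. emb rt j w # s \<in> hitting j})"
      proof
        fix s assume s: "s \<in> ?short"
        then obtain y t where y: "s = y # t" by (cases s) (auto simp: hitting_def)
        then have yb: "y \<in> insert [] (branch j)" using s by (auto simp: hitting_def Cons_eq_append_conv)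
        have "\<exists>w\<in>V j. y = emb rt j w"
        proof (cases "y = []")
          case True
          then show ?thesis using rt_in[OF j] by (intro bexI[of _ "rt j"]) (auto simp: emb_def)
        next
          case False
          then have "y \<in> branch j" "length y = 1" using yb s y by (auto simp: le_Suc_eq)
          then obtain w where "y = [w]" "w \<in> N j" by (rule length1_branch)
          then show ?thesis by (intro bexI[of _ w]) (auto simp: emb_def nonroot_def)
        qed
        then obtain w where "w \<in> V j" "y = emb rt j w" by blast
        then show "s \<in> (\<lambda>(w, s). emb rt j w # s) ` (SIGMA w:V j. {s. emb rt j w # s \<in> hitting j})"
          using s y by (intro image_eqI[of _ _ "(w, t)"]) auto
      qed
    next
      fix w assume "w \<in> V j"
      then have "emb rt j w \<in> FP" using FP_emb[of "[]" j w] j by simp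
      then show "msum (wp 1 (emb rt j w)) {s. emb rt j w # s \<in> hitting j} \<le> 1"
        by (intro kraft prefix_free_Cons prefix_free_hitting)
    qed (auto simp: wp_Cons)
    also have "\<dots> = msum (\<lambda>w. Q ([] @ emb rt j v) ([] @ emb rt j w)) (V j)"
      using v by (auto simp: emb_def nonroot_def intro!: msum_cong)
    also have "\<dots> = ennreal (rate j)"
      by (rule copy_row_sum) (use j v in \<open>auto simp: nonroot_def\<close>)
    finally show ?thesis .
  qed
  also have "msum (wp 1 [v]) ?long \<le> msum (\<lambda>l. wp 1 [] l * msum (wp 1 [v]) (hitting j)) (loops (opp j))"
  proof (rule msum_decomp[where c="\<lambda>l s. map ((@) [v]) l @ s" and B="\<lambda>_. hitting j" and h="\<lambda>_. wp 1 [v]"])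
    fix l s assume l: "l \<in> loops (opp j)"
    then have "last ([v] # map ((@) [v]) l) = [v]" using loops_last[OF l] by (simp add: last_map)
    moreover have "wp 1 [v] (map ((@) [v]) l) = wp 1 [] l"
      by (rule wp_translate[OF vj(2) _ opp_in[OF j]]) (use l vj(3) j in \<open>auto simp: loops_def opp_def\<close>)
    ultimately show "wp 1 [v] (map ((@) [v]) l @ s) \<le> wp 1 [] l * wp 1 [v] s"
      by (simp only: wp_append order_refl)
  qed auto
  also have "\<dots> = ret (opp j) 1 * msum (wp 1 [v]) (hitting j)"
    by (simp add: msum_multc ret_def)
  finally show ?thesis by (simp add: add_mono)
qed

lemma hitting_less_1:
  assumes j: "j \<in> {1,2}" and v: "v \<in> N j" and r: "ret (opp j) 1 < ennreal (rate (opp j))"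
  shows "msum (wp 1 [v]) (hitting j) < 1"
proof -
  have "[v] \<in> FP" using v j singleton_branch[OF j] branch_FP by auto
  then have f1: "msum (wp 1 [v]) (hitting j) \<le> 1" by (rule hitting_le_1)
  have "msum (wp 1 [v]) (hitting j) \<le> ennreal (rate j) + ret (opp j) 1 * 1"
    by (rule order_trans[OF hitting_bound[OF j v]]) (intro add_left_mono mult_left_mono f1, simp)
  also have "\<dots> < ennreal (rate j) + ennreal (rate (opp j))"
    using r by (simp add: ennreal_add_left_cancel_less)
  also have "\<dots> = 1" using rate_opp[OF j] rate_pos[of j] rate_pos[of "opp j"]
    by (simp flip: ennreal_plus)
  finally show ?thesis .
qed

text \<open>Suppose that the walk can escape through branches of the other type. To escape through branch
\<open>j\<close>, it may move to a neighbour \<open>v0\<close> of the empty word in factor \<open>j\<close> and escape from there through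
the branch of the other type.\<close>
lemma ret_less_rate_swap:
  assumes j: "j \<in> {1,2}" and r: "ret (opp j) 1 < ennreal (rate (opp j))"
  shows "ret j 1 < ennreal (rate j)"
proof -
  have rt: "rt j \<in> V j" by (rule rt_in[OF j])
  have "\<exists>v\<in>V j. p j (rt j) v \<noteq> 0"
  proof (rule ccontr)
    assume "\<not> ?thesis"
    then have "((\<lambda>y. p j (rt j) y) has_sum 0) (V j)" by (intro has_sum_0) auto
    then show False using p_has_sum[OF j rt] has_sum_unique by fastforce
  qed
  then obtain v0 where v0: "v0 \<in> V j" "p j (rt j) v0 \<noteq> 0" by blast
  then have v0N: "v0 \<in> N j" using p_diag[OF j rt] by (auto simp: nonroot_def)
  let ?q = "\<lambda>v. Q [] [v]"
  let ?f = "\<lambda>v. msum (wp 1 [v]) (hitting j)"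
  have q0: "?q v0 \<noteq> 0"
  proof -
    have "tp ([] @ emb rt j (rt j)) ([] @ emb rt j v0) = rate j * p j (rt j) v0"
      by (rule tp_copy) (use j rt v0 v0N in \<open>auto simp: nonroot_def\<close>)
    then show ?thesis using v0 v0N rate_pos[of j] by (auto simp: Q_nonzero emb_def nonroot_def)
  qed
  have tot: "msum ?q (N j) \<le> ennreal (rate j)"
    using single_step_mass[OF j rt] by (simp add: emb_def)
  have split: "msum g (N j) = g v0 + msum g (N j - {v0})" for g
    using msum_Un_disjoint[of "{v0}" "N j - {v0}" g] v0N by (simp add: insert_absorb)
  have "ret j 1 \<le> msum (\<lambda>v. ?q v * ?f v) (N j)"
    unfolding ret_def
  proof (rule order_trans[OF msum_support_subset], rule subsetI)
    fix l assume "l \<in> {l \<in> loops j. wp 1 [] l \<noteq> 0}"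
    then obtain s where s: "l = s @ [[]]" "s \<noteq> []" "set s \<subseteq> branch j" "wp 1 [] l \<noteq> 0"
      by (auto simp: loops_def)
    obtain y t where y: "s = y # t" using s(2) by (cases s) auto
    have "tp [] y \<noteq> 0" using s(1,4) y by (auto simp: wp_Cons Q_nonzero)
    then have "length y \<le> 1" by (auto dest: tp_length)
    moreover have "y \<in> branch j" using s y by simp
    ultimately obtain v where v: "y = [v]" "v \<in> N j"
      using branch_ne[of y j] by (cases y) (auto simp: branch_def)
    have "t @ [[]] \<in> hitting j" using s(3) y by (auto simp: hitting_def)
    then show "l \<in> (\<lambda>(v, s). [v] # s) ` (N j \<times> hitting j)"
      using s(1) y v by (intro image_eqI[of _ _ "(v, t @ [[]])"]) auto
  next
    show "msum (wp 1 []) ((\<lambda>(v, s). [v] # s) ` (N j \<times> hitting j)) \<le> msum (\<lambda>v. ?q v * ?f v) (N j)"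
      by (rule msum_decomp[where c="\<lambda>v s. [v] # s" and B="\<lambda>_. hitting j" and h="\<lambda>v s. wp 1 [v] s"])
         (auto simp: wp_Cons)
  qed
  also have "\<dots> = ?q v0 * ?f v0 + msum (\<lambda>v. ?q v * ?f v) (N j - {v0})" by (rule split)
  also have "\<dots> \<le> ?q v0 * ?f v0 + msum (\<lambda>v. ?q v * 1) (N j - {v0})"
    by (intro add_left_mono msum_mono mult_left_mono hitting_le_1 branch_FP[of _ j])
       (simp_all add: singleton_branch[OF j])
  also have "\<dots> < ?q v0 * 1 + msum (\<lambda>v. ?q v * 1) (N j - {v0})"
  proof -
    have "msum (\<lambda>v. ?q v * 1) (N j - {v0}) \<le> msum ?q (N j)"
      unfolding mult_1_right by (rule msum_subset) simp
    also note tot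
    also have "ennreal (rate j) < \<infinity>" by simp
    finally have fin: "msum (\<lambda>v. ?q v * 1) (N j - {v0}) \<noteq> \<infinity>" by simp
    have "?q v0 * ?f v0 < ?q v0 * 1"
    proof (rule ennreal_mult_strict_left_mono)
      show "?f v0 < 1" by (rule hitting_less_1[OF j v0N r])
      show "0 < ?q v0" using q0 by (simp add: zero_less_iff_neq_zero)
      show "?q v0 < \<top>" by (simp add: Q_def)
    qed
    then show ?thesis
      using fin by (subst (1 2) add.commute) (simp only: ennreal_add_left_cancel_less simp_thms)
  qed
  also have "\<dots> = msum ?q (N j)" using split[of ?q] by simp
  also have "\<dots> \<le> ennreal (rate j)" by (rule tot)
  finally show ?thesis .
qed

lemma ret_less_rate:
  assumes fin: "msum (wp 1 []) returns < \<infinity>" and j: "j \<in> {1,2}"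
  shows "ret j 1 < ennreal (rate j)"
proof (cases "ret (opp j) 1 < ennreal (rate (opp j))")
  case True
  then show ?thesis by (rule ret_less_rate_swap[OF j])
next
  case False
  then have o: "ennreal (rate (opp j)) \<le> ret (opp j) 1" by simp
  have lt: "ret j 1 + ret (opp j) 1 < 1"
    using ret_sum_less_1[OF fin] j by (auto simp: opp_def add.commute)
  have "ret j 1 + ennreal (rate (opp j)) \<le> ret j 1 + ret (opp j) 1"
    by (intro add_left_mono o)
  also note lt
  also have "1 = ennreal (rate j) + ennreal (rate (opp j))"
    using rate_opp[OF j] rate_pos[of j] rate_pos[of "opp j"] by (simp flip: ennreal_plus)
  finally have "ennreal (rate (opp j)) + ret j 1 < ennreal (rate (opp j)) + ennreal (rate j)"
    by (simp only: add.commute)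
  then show ?thesis by (simp only: ennreal_add_left_cancel_less)
qed

lemma convex_power_bound:
  fixes \<theta> z :: real
  assumes "0 \<le> \<theta>" "\<theta> \<le> 1" "1 \<le> z"
  shows "((1 - \<theta>) + \<theta> * z) ^ n \<le> (1 - \<theta>) + \<theta> * z ^ n"
proof (induction n)
  case (Suc n)
  have "((1 - \<theta>) + \<theta> * z) ^ Suc n \<le> ((1 - \<theta>) + \<theta> * z) * ((1 - \<theta>) + \<theta> * z ^ n)"
    using Suc assms by (simp add: mult_left_mono)
  also have "\<dots> = (1 - \<theta>) + \<theta> * z ^ Suc n - \<theta> * (1 - \<theta>) * ((z - 1) * (z ^ n - 1))"
    by (simp add: algebra_simps)
  also have "\<dots> \<le> (1 - \<theta>) + \<theta> * z ^ Suc n"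
    using assms one_le_power[OF assms(3), of n] by simp
  finally show ?case .
qed simp

text \<open>Convexity of the powers takes the place of continuity of the power series at \<open>1\<close>.\<close>
lemma ret_convex:
  assumes "0 \<le> \<theta>" "\<theta> \<le> 1" "1 \<le> z"
  shows "ret j (ennreal ((1 - \<theta>) + \<theta> * z)) \<le> ennreal (1 - \<theta>) * ret j 1 + ennreal \<theta> * ret j (ennreal z)"
proof -
  have "wp (ennreal ((1 - \<theta>) + \<theta> * z)) [] s \<le> ennreal (1 - \<theta>) * wp 1 [] s + ennreal \<theta> * wp (ennreal z) [] s" for s
  proof -
    have "ennreal ((1 - \<theta>) + \<theta> * z) ^ length s = ennreal (((1 - \<theta>) + \<theta> * z) ^ length s)"
      using assms by (intro ennreal_power) auto
    also have "\<dots> \<le> ennreal ((1 - \<theta>) + \<theta> * z ^ length s)"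
      by (intro ennreal_leI convex_power_bound assms)
    also have "\<dots> = ennreal (1 - \<theta>) + ennreal \<theta> * ennreal z ^ length s"
      using assms by (simp add: ennreal_plus ennreal_mult ennreal_power)
    finally have "ennreal ((1 - \<theta>) + \<theta> * z) ^ length s * pweight Q [] s
        \<le> (ennreal (1 - \<theta>) + ennreal \<theta> * ennreal z ^ length s) * pweight Q [] s"
      by (intro mult_right_mono) auto
    then show ?thesis by (simp add: wp_def distrib_right mult.assoc)
  qed
  then have "ret j (ennreal ((1 - \<theta>) + \<theta> * z)) \<le> msum (\<lambda>s. ennreal (1 - \<theta>) * wp 1 [] s + ennreal \<theta> * wp (ennreal z) [] s) (loops j)"
    unfolding ret_def by (intro msum_mono)
  also have "\<dots> = ennreal (1 - \<theta>) * ret j 1 + ennreal \<theta> * ret j (ennreal z)"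
    unfolding ret_def by (simp add: msum_add msum_cmult)
  finally show ?thesis .
qed

text \<open>At \<open>1\<close> the growth is smaller than \<open>rate j + rate (opp j) = 1\<close>, because the loops through
the other branch have mass less than its rate. Convexity carries the strict inequality beyond \<open>1\<close>.\<close>
lemma level_growth_less_1_beyond_1:
  assumes z1: "1 < z1" and fin: "msum (wp (ennreal z1) []) returns < \<infinity>"
  shows "\<exists>z>1. \<forall>j\<in>{1,2}. level_growth j (ennreal z) < 1 \<and> level_growth j 1 < 1"
proof -
  have mono: "wp 1 [] s \<le> wp (ennreal z1) [] s" for s
    unfolding wp_def using z1 by (intro mult_right_mono power_mono) (auto simp: ennreal_1[symmetric] simp del: ennreal_1 intro!: ennreal_leI)
  have fin1: "msum (wp 1 []) returns < \<infinity>"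
    by (rule le_less_trans[OF msum_mono fin]) (rule mono)
  have retfin: "ret j (ennreal z1) < \<infinity>" for j
    unfolding ret_def by (rule le_less_trans[OF msum_subset fin]) (auto simp: returns_def loops_def)
  have ret1: "ret j 1 < ennreal (rate j)" if "j \<in> {1,2}" for j
    by (rule ret_less_rate[OF fin1 that])
  define r where "r j = enn2real (ret j 1)" for j
  define s where "s j = enn2real (ret j (ennreal z1))" for j
  have r: "ret j 1 = ennreal (r j)" "r j < rate j" "0 \<le> r j" if "j \<in> {1,2}" for j
  proof -
    have "ret j 1 < \<infinity>" using ret1[OF that] by (rule less_trans) simp
    then show e: "ret j 1 = ennreal (r j)" by (simp add: r_def)
    show "0 \<le> r j" by (simp add: r_def)
    show "r j < rate j" using ret1[OF that] \<open>0 \<le> r j\<close> rate_pos[of j] unfolding e by (simp add: ennreal_less_iff)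
  qed
  have s: "ret j (ennreal z1) = ennreal (s j)" "0 \<le> s j" for j
    using retfin[of j] by (simp_all add: s_def)
  \<comment> \<open>the convexity bound for the growth at \<open>(1 - \<theta>) + \<theta> * z1\<close>\<close>
  define g where "g \<theta> j = ((1 - \<theta>) + \<theta> * z1) * rate j + ((1 - \<theta>) * r (opp j) + \<theta> * s (opp j))" for \<theta> j
  have le: "level_growth j (ennreal ((1 - \<theta>) + \<theta> * z1)) \<le> ennreal (g \<theta> j)" if "0 \<le> \<theta>" "\<theta> \<le> 1" "j \<in> {1,2}" for \<theta> j
  proof -
    have "ret (opp j) (ennreal ((1 - \<theta>) + \<theta> * z1)) \<le> ennreal (1 - \<theta>) * ennreal (r (opp j)) + ennreal \<theta> * ennreal (s (opp j))"
      using ret_convex[OF that(1,2), of z1 "opp j"] z1 r(1)[OF opp_in[OF that(3)]] s(1)[of "opp j"] by simp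
    also have "\<dots> = ennreal ((1 - \<theta>) * r (opp j) + \<theta> * s (opp j))"
      using that r(3)[OF opp_in[OF that(3)]] s(2)[of "opp j"] by (simp add: ennreal_plus ennreal_mult)
    finally have "level_growth j (ennreal ((1 - \<theta>) + \<theta> * z1)) \<le> ennreal ((1 - \<theta>) + \<theta> * z1) * ennreal (rate j) + ennreal ((1 - \<theta>) * r (opp j) + \<theta> * s (opp j))"
      unfolding level_growth_def by (rule add_left_mono)
    also have "\<dots> = ennreal (g \<theta> j)"
      unfolding g_def using that z1 rate_pos[of j] r(3)[OF opp_in[OF that(3)]] s(2)[of "opp j"]
      by (subst ennreal_mult[symmetric]) (auto simp: ennreal_plus[symmetric] simp del: ennreal_plus)
    finally show ?thesis .
  qed
  have lim: "((\<lambda>\<theta>. g \<theta> j) \<longlongrightarrow> g 0 j) (at_right 0)" for j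
    unfolding g_def by (intro tendsto_intros)
  have g0: "g 0 j < 1" if "j \<in> {1,2}" for j
    using r(2)[OF opp_in[OF that]] rate_opp[OF that] by (simp add: g_def)
  have "eventually (\<lambda>\<theta>. g \<theta> 1 < 1) (at_right 0)" "eventually (\<lambda>\<theta>. g \<theta> 2 < 1) (at_right 0)"
    using order_tendstoD(2)[OF lim] g0 by simp_all
  moreover have "eventually (\<lambda>\<theta>::real. 0 < \<theta> \<and> \<theta> < 1) (at_right 0)"
    using eventually_at_right_real[of 0 "1::real"] by simp
  ultimately have "eventually (\<lambda>\<theta>. g \<theta> 1 < 1 \<and> g \<theta> 2 < 1 \<and> 0 < \<theta> \<and> \<theta> < 1) (at_right 0)"
    by eventually_elim simp
  then obtain \<theta> where \<theta>: "g \<theta> 1 < 1" "g \<theta> 2 < 1" "0 < \<theta>" "\<theta> < 1"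
    using eventually_happens'[OF trivial_limit_at_right_real] by blast
  define z where "z = (1 - \<theta>) + \<theta> * z1"
  have "z - 1 = \<theta> * (z1 - 1)" by (simp add: z_def algebra_simps)
  moreover have "0 < \<theta> * (z1 - 1)" using \<theta>(3) z1 by simp
  ultimately have "1 < z" by linarith
  moreover have "level_growth j (ennreal z) < 1" if j: "j \<in> {1,2}" for j
    unfolding z_def
  proof (rule le_less_trans[OF le])
    show "ennreal (g \<theta> j) < 1" using \<theta> j by (auto simp: ennreal_less_one_iff)
  qed (use \<theta> j in auto)
  moreover have "level_growth j 1 < 1" if j: "j \<in> {1,2}" for j
    using le[of 0 j] j g0[OF j] by (simp add: le_less_trans ennreal_less_one_iff)
  ultimately show ?thesis by blast
qed

lemma geometric_fixpoint:
  assumes "g < (1::ennreal)"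
  obtains C where "C < \<infinity>" "1 + C * g \<le> C"
proof -
  have gr: "g = ennreal (enn2real g)" using assms by (cases g) auto
  define q where "q = enn2real g"
  have q: "0 \<le> q" "q < 1" "g = ennreal q"
    using assms gr ennreal_less_one_iff[of q] unfolding q_def by simp_all
  have "1 + ennreal (1 / (1 - q)) * g = ennreal (1 + 1 / (1 - q) * q)"
    unfolding q(3) using q by (simp add: ennreal_mult[symmetric])
  also have "1 + 1 / (1 - q) * q = 1 / (1 - q)" using q by (simp add: field_simps)
  finally show ?thesis using that[of "ennreal (1 / (1 - q))"] by simp
qed

text \<open>The mean number of visits to the first level of branch \<open>j\<close>, from \<open>x\<close>, before the branch is left.\<close>
definition reach_mass :: "nat \<Rightarrow> 'a list \<Rightarrow> ennreal" where
  "reach_mass j x = msum (wp 1 x) (level_paths j x)"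

lemma take_path_const:
  assumes "pweight Q x s \<noteq> 0" "k < length x" "\<And>y. y \<in> set s \<Longrightarrow> k < length y"
  shows "take k (last (x # s)) = take k x"
  using assms
proof (induction s arbitrary: x)
  case (Cons y s)
  have "tp x y \<noteq> 0" using Cons.prems(1) by (auto simp: Q_nonzero)
  then have "take k x = take k y" using Cons.prems(2) by (intro tp_take) auto
  moreover have "take k (last (y # s)) = take k y"
    using Cons.prems by (intro Cons.IH) auto
  ultimately show ?case by simp
qed simp

text \<open>From a child, the first level can be reached only through the parent, and the parent is reached with
probability at most \<open>1\<close>.\<close>
lemma reach_mass_child_le:
  assumes j: "j \<in> {1,2}" and u: "u \<in> branch j" and uy: "u @ [y] \<in> branch j"
  shows "reach_mass j (u @ [y]) \<le> reach_mass j u"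
proof -
  let ?k = "length u"
  let ?A = "{c @ [u] | c. u \<notin> set c}"
  have un: "u \<noteq> []" "1 \<le> ?k" using branch_ne[OF u] by (auto simp: Suc_le_eq)
  have pf: "prefix_free ?A" by (rule prefix_free_snoc[where x=u]) auto
  have "reach_mass j (u @ [y]) \<le> msum (\<lambda>c. wp 1 (u @ [y]) c * reach_mass j u) ?A"
    unfolding reach_mass_def
  proof (rule order_trans[OF msum_support_subset], rule subsetI)
    fix s assume "s \<in> {s \<in> level_paths j (u @ [y]). wp 1 (u @ [y]) s \<noteq> 0}"
    then have h: "set s \<subseteq> branch j" "length (last ((u @ [y]) # s)) = 1" "pweight Q (u @ [y]) s \<noteq> 0"
      by (auto simp: level_paths_def wp_1)
    have sne: "s \<noteq> []" using h(2) un by auto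
    then have "length (last s) \<le> ?k" using h(2) un by simp
    then have "\<exists>x\<in>set s. length x \<le> ?k" using sne last_in_set by blast
    then obtain c x d where sp: "s = c @ x # d" "length x \<le> ?k" "\<forall>z\<in>set c. \<not> length z \<le> ?k"
      using split_list_first_prop[of s "\<lambda>x. length x \<le> ?k"] by blast
    have pc: "pweight Q (u @ [y]) c \<noteq> 0" "tp (last ((u @ [y]) # c)) x \<noteq> 0"
      using h(3) sp(1) by (auto simp: pweight_append Q_nonzero simp del: last.simps)
    have cl: "?k < length z" if "z \<in> set c" for z using sp(3) that by (simp add: not_le)
    have t: "take ?k (last ((u @ [y]) # c)) = u"
      using take_path_const[OF pc(1), of ?k] cl by (simp del: last.simps)
    have "?k < length (last ((u @ [y]) # c))"
      using cl[OF last_in_set[of c]] by (cases "c = []") simp_all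
    then have "take ?k (last ((u @ [y]) # c)) = take ?k x" by (intro tp_take[OF pc(2)]) simp
    then have x: "x = u" using t sp(2) by simp
    have "d \<in> level_paths j u" using h(1,2) sp(1) x by (auto simp: level_paths_def)
    moreover have "u \<notin> set c" using sp(3) by auto
    ultimately show "s \<in> (\<lambda>(c, d). c @ d) ` (?A \<times> level_paths j u)"
      using sp(1) x by (intro image_eqI[of _ _ "(c @ [u], d)"]) auto
  next
    show "msum (wp 1 (u @ [y])) ((\<lambda>(c, d). c @ d) ` (?A \<times> level_paths j u))
        \<le> msum (\<lambda>c. wp 1 (u @ [y]) c * msum (wp 1 u) (level_paths j u)) ?A"
    proof (rule msum_decomp[where c="\<lambda>c d. c @ d" and B="\<lambda>_. level_paths j u" and h="\<lambda>_ d. wp 1 u d"])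
      fix c d assume "c \<in> ?A"
      then have "last ((u @ [y]) # c) = u" by auto
      then show "wp 1 (u @ [y]) (c @ d) \<le> wp 1 (u @ [y]) c * wp 1 u d"
        by (simp only: wp_append order_refl)
    qed auto
  qed
  also have "\<dots> = msum (wp 1 (u @ [y])) ?A * reach_mass j u" by (rule msum_multc)
  also have "\<dots> \<le> 1 * reach_mass j u"
    by (intro mult_right_mono kraft branch_FP[OF uy] pf) simp
  finally show ?thesis by simp
qed

text \<open>Split at the last visit to the parent of the end point. The rest of the path is a translated block.\<close>
lemma last_letter_split:
  assumes "pweight Q [] t \<noteq> 0" "last ([] # t) \<noteq> []"
  obtains s i b where "t = s @ map ((@) (last ([] # s))) b" "i \<in> {1,2}" "wt (last ([] # s)) \<noteq> Some i"
    "b \<in> blocks i" "last t = last ([] # s) @ last b" "last ([] # s) \<in> FP"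
proof -
  let ?x = "last ([] # t)"
  have tne: "t \<noteq> []" using assms(2) by auto
  have "\<exists>e\<in>set ([] # t). length e < length ?x" using assms(2) by simp
  then obtain ys e zs where sp: "[] # t = ys @ e # zs" "length e < length ?x" "\<forall>z\<in>set zs. \<not> length z < length ?x"
    using split_list_last_prop[of "[] # t" "\<lambda>e. length e < length ?x"] by blast
  obtain s where s: "ys @ [e] = [] # s" "t = s @ zs" using sp(1) by (cases ys) auto
  have e: "e = last ([] # s)" using s(1) by (metis last_snoc)
  have zne: "zs \<noteq> []"
  proof
    assume "zs = []"
    then have "?x = e" using s e by simp
    then show False using sp(2) by simp
  qed
  have pz: "pweight Q e zs \<noteq> 0" and ps: "pweight Q [] s \<noteq> 0"
    using assms(1) unfolding s(2) e by (auto simp: pweight_append)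
  have eFP: "e \<in> FP"
    using pweight_FP[OF ps Nil_FP] e last_in_set[of s] by (cases "s = []") auto
  have zl: "length e < length z" if "z \<in> set zs" for z using sp(2,3) that by fastforce
  obtain i b where b: "i \<in> {1,2}" "wt e \<noteq> Some i" "set b \<subseteq> branch i" "zs = map ((@) e) b"
    using path_above_cut[OF pz eFP zne zl] by blast
  have bne: "b \<noteq> []" using b zne by auto
  have x: "?x = e @ last b" using s(2) zne bne b(4) by (simp add: last_map)
  have "length (last b) = 1"
  proof -
    have "tp e (hd zs) \<noteq> 0" using pz zne by (cases zs) (auto simp: Q_nonzero)
    then have "length (hd zs) \<le> Suc (length e)" by (auto dest: tp_length)
    moreover have "length ?x \<le> length (hd zs)" using sp(3) zne by (auto simp: not_less)
    moreover have "length ?x = length e + length (last b)" by (simp only: x length_append)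
    ultimately show ?thesis using sp(2) by linarith
  qed
  then have "b \<in> blocks i" using b bne by (simp add: blocks_def)
  moreover have "last t = e @ last b" using x tne by simp
  ultimately show ?thesis
    by (intro that[of s b i, folded e]) (use b s(2) eFP in auto)
qed

text \<open>By induction on the level: after the last visit to level \<open>k\<close> there is one block.\<close>
lemma level_mass_finite:
  assumes G: "msum (wp 1 []) returns < \<infinity>" and B: "\<And>i. i \<in> {1,2} \<Longrightarrow> msum (wp 1 []) (blocks i) < \<infinity>"
  shows "msum (wp 1 []) {s. length (last ([] # s)) = k} < \<infinity>"
proof (induction k)
  case 0
  have "{s. length (last ([] # s)) = 0} = returns" by (auto simp: returns_def)
  then show ?case using G by simp
next
  case (Suc k)
  let ?P = "\<lambda>k. {s. length (last ([] # s)) = k}"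
  let ?F = "\<lambda>i. (\<lambda>(s, b). s @ map ((@) (last ([] # s))) b) ` (SIGMA s:{s\<in>?P k. last ([] # s) \<in> FP \<and> wt (last ([] # s)) \<noteq> Some i}. blocks i)"
  have "msum (wp 1 []) (?P (Suc k)) \<le> msum (wp 1 []) (?F 1 \<union> ?F 2)"
  proof (rule msum_support_subset, rule subsetI)
    fix t assume "t \<in> {t \<in> ?P (Suc k). wp 1 [] t \<noteq> 0}"
    then have t: "length (last ([] # t)) = Suc k" "pweight Q [] t \<noteq> 0" by (auto simp: wp_1 simp del: last.simps)
    then have "last ([] # t) \<noteq> []" by (metis length_0_conv nat.distinct(1))
    then obtain s i b where sib: "t = s @ map ((@) (last ([] # s))) b" "i \<in> {1,2}" "wt (last ([] # s)) \<noteq> Some i"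
      "b \<in> blocks i" "last t = last ([] # s) @ last b" "last ([] # s) \<in> FP"
      using last_letter_split[OF t(2)] by metis
    have "b \<noteq> []" "length (last b) = 1" using sib(4) by (auto simp: blocks_def)
    then have "length (last ([] # t)) = Suc (length (last ([] # s)))" using sib(1,5) by auto
    then have "t \<in> ?F i" using sib t by (intro image_eqI[of _ _ "(s, b)"]) auto
    then show "t \<in> ?F 1 \<union> ?F 2" using sib(2) by auto
  qed
  also have "\<dots> \<le> msum (wp 1 []) (?F 1) + msum (wp 1 []) (?F 2)" by (rule msum_Un_le)
  also have "\<dots> < \<infinity>"
  proof -
    have "msum (wp 1 []) (?F i) < \<infinity>" if i: "i \<in> {1,2}" for i
    proof -
      have "msum (wp 1 []) (?F i) \<le> msum (\<lambda>s. wp 1 [] s * msum (wp 1 []) (blocks i)) {s\<in>?P k. last ([] # s) \<in> FP \<and> wt (last ([] # s)) \<noteq> Some i}"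
      proof (rule msum_decomp[where c="\<lambda>s b. s @ map ((@) (last ([] # s))) b" and B="\<lambda>_. blocks i" and h="\<lambda>_. wp 1 []"])
        fix s b assume s: "s \<in> {s\<in>?P k. last ([] # s) \<in> FP \<and> wt (last ([] # s)) \<noteq> Some i}" and b: "b \<in> blocks i"
        have "wp 1 (last ([] # s)) (map ((@) (last ([] # s))) b) = wp 1 [] b"
          by (rule wp_translate[where j=i]) (use s b i in \<open>auto simp: blocks_def\<close>)
        then show "wp 1 [] (s @ map ((@) (last ([] # s))) b) \<le> wp 1 [] s * wp 1 [] b"
          by (simp only: wp_append order_refl)
      qed auto
      also have "\<dots> \<le> msum (\<lambda>s. wp 1 [] s * msum (wp 1 []) (blocks i)) (?P k)"
        by (rule msum_subset) auto
      also have "\<dots> = msum (wp 1 []) (?P k) * msum (wp 1 []) (blocks i)" by (rule msum_multc)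
      also have "\<dots> < \<infinity>" using Suc B[OF i] by (simp add: ennreal_mult_less_top)
      finally show ?thesis .
    qed
    from this[of 1] this[of 2] show ?thesis by simp
  qed
  finally show ?case .
qed

end

section \<open>Letters met inside a block\<close>

context free_walk begin

definition visits :: "nat \<Rightarrow> 'a list list set" where
  "visits j = {t. t \<noteq> [] \<and> set t \<subseteq> branch j}"

lemma visits_last: "t \<in> visits j \<Longrightarrow> last t \<in> branch j"
  using last_in_set[of t] by (auto simp: visits_def)

text \<open>A pair of a path and a continuation to the first level is a block with a marked position, so the sum
is the mean length of a block.\<close>
lemma visits_reach_mass:
  "msum (\<lambda>t. wp 1 [] t * reach_mass j (last t)) (visits j) \<le> msum (\<lambda>a. wp 1 [] a * of_nat (length a)) (blocks j)"
proof -
  let ?S = "SIGMA t:visits j. level_paths j (last t)"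
  \<comment> \<open>the marked position is the index of the last vertex of \<open>t\<close>\<close>
  let ?c = "\<lambda>(t, d). (t @ d, length t - 1) :: 'a list list \<times> nat"
  have inj: "inj_on ?c ?S"
  proof (rule inj_onI)
    fix x y assume x: "x \<in> ?S" and y: "y \<in> ?S" and e: "?c x = ?c y"
    obtain t d t' d' where [simp]: "x = (t, d)" "y = (t', d')" by (cases x, cases y)
    have "length t = length t'" using x y e by (auto simp: visits_def) (metis One_nat_def Suc_pred length_greater_0_conv)
    then show "x = y" using e by simp
  qed
  have "msum (\<lambda>t. wp 1 [] t * reach_mass j (last t)) (visits j) = msum (\<lambda>(t, d). wp 1 [] t * wp 1 (last t) d) ?S"
    unfolding reach_mass_def by (simp add: msum_Sigma msum_cmult)
  also have "\<dots> = msum (\<lambda>x. case ?c x of (a, i) \<Rightarrow> wp 1 [] a) ?S"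
    by (intro msum_cong) (auto simp: wp_append visits_def)
  also have "\<dots> = msum (\<lambda>(a, i). wp 1 [] a) (?c ` ?S)"
    by (rule msum_reindex[OF inj, symmetric])
  also have "\<dots> \<le> msum (\<lambda>(a, i). wp 1 [] a) (SIGMA a:blocks j. {..<length a})"
  proof (rule msum_subset, rule subsetI)
    fix x assume "x \<in> ?c ` ?S"
    then obtain t d where h: "x = (t @ d, length t - 1)" "t \<in> visits j" "d \<in> level_paths j (last t)" by auto
    then have "t @ d \<in> blocks j" by (auto simp: visits_def level_paths_def blocks_def split: if_splits)
    moreover have "length t - 1 < length (t @ d)" using h(2) by (cases t) (auto simp: visits_def)
    ultimately show "x \<in> (SIGMA a:blocks j. {..<length a})" using h(1) by simp
  qed
  also have "\<dots> = msum (\<lambda>a. wp 1 [] a * of_nat (length a)) (blocks j)"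
    by (simp add: msum_Sigma nn_integral_count_space_finite mult.commute)
  finally show ?thesis .
qed

text \<open>An upper bound for the weight that a path starting at the empty word carries at any of its
vertices: a step increases the weight by at most the last letter of its target.\<close>
definition letter_sum :: "('a \<Rightarrow> ennreal) \<Rightarrow> 'a list list \<Rightarrow> ennreal" where
  "letter_sum L a = (\<Sum>x\<leftarrow>a. L (last x))"

lemma letter_sum_visits:
  "msum (\<lambda>a. wp 1 [] a * letter_sum L a) (blocks j)
     \<le> msum (\<lambda>t. wp 1 [] t * L (last (last t)) * reach_mass j (last t)) (visits j)"
proof -
  have "msum (\<lambda>a. wp 1 [] a * letter_sum L a) (blocks j) = msum (\<lambda>(a, i). wp 1 [] a * L (last (a ! i))) (SIGMA a:blocks j. {..<length a})"
    by (simp add: msum_Sigma nn_integral_count_space_finite letter_sum_def sum_list_sum_nth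
          sum_distrib_left atLeast0LessThan)
  also have "\<dots> \<le> msum (\<lambda>t. wp 1 [] t * L (last (last t)) * reach_mass j (last t)) (visits j)"
  proof (rule msum_decomp[where c="\<lambda>t d. (t @ d, length t - 1)" and B="\<lambda>t. level_paths j (last t)" and h="\<lambda>t d. wp 1 (last t) d"])
    show "(SIGMA a:blocks j. {..<length a}) \<subseteq> (\<lambda>(t, d). (t @ d, length t - 1)) ` (SIGMA t:visits j. level_paths j (last t))"
    proof
      fix x assume "x \<in> (SIGMA a:blocks j. {..<length a})"
      then obtain a i where x: "x = (a, i)" "a \<in> blocks j" "i < length a" by auto
      let ?t = "take (Suc i) a" and ?d = "drop (Suc i) a"
      have td: "set ?t \<subseteq> set a" "set ?d \<subseteq> set a" by (auto dest: in_set_takeD in_set_dropD)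
      have ad: "a = ?t @ ?d" by simp
      have tne: "?t \<noteq> []" using x by (cases a) auto
      have "last (last ?t # ?d) = last a" using ad tne by (metis last_appendR last_append last_ConsR last_ConsL)
      then have "?d \<in> level_paths j (last ?t)" using x(2) td by (auto simp: blocks_def level_paths_def)
      moreover have "?t \<in> visits j" using x(2) td tne by (auto simp: visits_def blocks_def)
      ultimately show "x \<in> (\<lambda>(t, d). (t @ d, length t - 1)) ` (SIGMA t:visits j. level_paths j (last t))"
        using x by (intro image_eqI[of _ _ "(?t, ?d)"]) auto
    qed
  next
    fix t d assume t: "t \<in> visits j"
    then have "(t @ d) ! (length t - 1) = last t" by (auto simp: visits_def last_conv_nth nth_append)
    moreover have "wp 1 [] (t @ d) = wp 1 [] t * wp 1 (last t) d" using t by (simp add: wp_append visits_def)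
    ultimately show "(case (t @ d, length t - 1) of (a, i) \<Rightarrow> wp 1 [] a * L (last (a ! i)))
        \<le> wp 1 [] t * L (last (last t)) * wp 1 (last t) d"
      by (simp add: ac_simps)
  qed (simp add: reach_mass_def)
  finally show ?thesis .
qed

definition letter_mean :: "('a \<Rightarrow> ennreal) \<Rightarrow> nat \<Rightarrow> ennreal" where
  "letter_mean L i = msum (\<lambda>b. wp 1 [] b * L (last (last b))) (blocks i)"

text \<open>Mark a position of a block, and split the path up to this position at the last visit to the parent
of the marked vertex. The piece from the parent to the marked vertex is a translated block, which
contributes \<open>letter_mean L i\<close> whatever the parent is, and by \<open>reach_mass_child_le\<close> the rest weighs
no more than a continuation from the parent. So the sum is at most the letter means times the mean length of a block. The
case where the parent is the empty word is separate: there the rest weighs at most \<open>C\<close>.\<close>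
lemma letter_sum_mass_finite:
  assumes j: "j \<in> {1,2}"
    and C: "C < \<infinity>" "\<And>v. v \<in> N j \<Longrightarrow> reach_mass j [v] \<le> C"
    and SL: "\<And>i. i \<in> {1,2} \<Longrightarrow> letter_mean L i < \<infinity>"
    and T: "msum (\<lambda>a. wp 1 [] a * of_nat (length a)) (blocks j) < \<infinity>"
  shows "msum (\<lambda>a. wp 1 [] a * letter_sum L a) (blocks j) < \<infinity>"
proof -
  let ?f = "\<lambda>t. wp 1 [] t * L (last (last t)) * reach_mass j (last t)"
  let ?B = "\<lambda>i s. {b\<in>blocks i. wt (last s) \<noteq> Some i \<and> last s @ last b \<in> branch j}"
  let ?F = "\<lambda>i. (\<lambda>(s, b). s @ map ((@) (last s)) b) ` (SIGMA s:visits j. ?B i s)"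
  let ?R = "msum (\<lambda>t. wp 1 [] t * reach_mass j (last t)) (visits j)"
  have "msum ?f (visits j) \<le> msum ?f (blocks j \<union> (?F 1 \<union> ?F 2))"
  proof (rule msum_support_subset, rule subsetI)
    fix t assume "t \<in> {t \<in> visits j. ?f t \<noteq> 0}"
    then have t: "t \<in> visits j" "pweight Q [] t \<noteq> 0" by (auto simp: wp_1)
    then have tne: "last ([] # t) \<noteq> []" using visits_last[OF t(1)] branch_ne by (auto simp: visits_def)
    obtain s i b where sib: "t = s @ map ((@) (last ([] # s))) b" "i \<in> {1,2}" "wt (last ([] # s)) \<noteq> Some i"
      "b \<in> blocks i" "last t = last ([] # s) @ last b" "last ([] # s) \<in> FP"
      by (rule last_letter_split[OF t(2) tne])
    show "t \<in> blocks j \<union> (?F 1 \<union> ?F 2)"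
    proof (cases "s = []")
      case True
      then have tb: "t = b" using sib(1) by (simp add: map_idI)
      then have "t \<in> blocks j" using t(1) sib(4) by (auto simp: blocks_def visits_def)
      then show ?thesis by simp
    next
      case False
      then have "s \<in> visits j" using t(1) sib(1) by (auto simp: visits_def)
      moreover have "b \<in> ?B i s" using sib False visits_last[OF t(1)] by simp
      ultimately have "t \<in> ?F i" using sib(1) False by (intro image_eqI[of _ _ "(s, b)"]) auto
      then show ?thesis using sib(2) by auto
    qed
  qed
  also have "\<dots> \<le> msum ?f (blocks j) + msum ?f (?F 1 \<union> ?F 2)" by (rule msum_Un_le)
  also have "\<dots> \<le> msum ?f (blocks j) + (msum ?f (?F 1) + msum ?f (?F 2))"
    by (intro add_left_mono msum_Un_le)
  also have "\<dots> < \<infinity>"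
  proof -
    have "msum ?f (blocks j) \<le> msum (\<lambda>b. wp 1 [] b * L (last (last b)) * C) (blocks j)"
    proof (intro msum_mono mult_left_mono)
      fix b assume "b \<in> blocks j"
      then have "last b \<in> branch j" "length (last b) = 1" using last_in_set[of b] by (auto simp: blocks_def)
      then obtain v where "last b = [v]" "v \<in> N j" by (rule length1_branch)
      then show "reach_mass j (last b) \<le> C" using C(2) by simp
    qed simp
    also have "\<dots> = letter_mean L j * C" unfolding letter_mean_def by (rule msum_multc)
    also have "\<dots> < \<infinity>" using SL[OF j] C(1) by (simp add: ennreal_mult_less_top)
    finally have 1: "msum ?f (blocks j) < \<infinity>" .
    have 2: "msum ?f (?F i) < \<infinity>" if i: "i \<in> {1,2}" for i
    proof -
      have "msum ?f (?F i) \<le> msum (\<lambda>s. (wp 1 [] s * reach_mass j (last s)) * letter_mean L i) (visits j)"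
      proof (rule msum_decomp[where c="\<lambda>s b. s @ map ((@) (last s)) b" and B="?B i" and h="\<lambda>s b. wp 1 [] b * L (last (last b))"])
        fix s b assume s: "s \<in> visits j" and b: "b \<in> ?B i s"
        have sb: "last s \<in> branch j" "s \<noteq> []" using visits_last[OF s] s by (auto simp: visits_def)
        have w: "wp 1 (last s) (map ((@) (last s)) b) = wp 1 [] b"
          by (rule wp_translate[OF branch_FP[OF sb(1)] _ i]) (use b in \<open>auto simp: blocks_def\<close>)
        have bb: "b \<noteq> []" "length (last b) = 1" using b by (auto simp: blocks_def)
        then obtain y where y: "last b = [y]" by (cases "last b") auto
        have l: "last (s @ map ((@) (last s)) b) = last s @ [y]" using bb y by (simp add: last_map)
        have r: "reach_mass j (last s @ [y]) \<le> reach_mass j (last s)"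
          using b y by (intro reach_mass_child_le[OF j sb(1)]) simp
        have "wp 1 [] (s @ map ((@) (last s)) b) = wp 1 [] s * wp 1 [] b"
          using sb(2) w by (simp add: wp_append)
        then have "?f (s @ map ((@) (last s)) b) = wp 1 [] s * wp 1 [] b * L y * reach_mass j (last s @ [y])"
          unfolding l by simp
        also have "\<dots> \<le> wp 1 [] s * wp 1 [] b * L y * reach_mass j (last s)"
          by (intro mult_left_mono r) simp
        also have "\<dots> = wp 1 [] s * reach_mass j (last s) * (wp 1 [] b * L (last (last b)))"
          unfolding y by (simp add: ac_simps)
        finally show "?f (s @ map ((@) (last s)) b) \<le> wp 1 [] s * reach_mass j (last s) * (wp 1 [] b * L (last (last b)))" .
      next
        fix s show "msum (\<lambda>b. wp 1 [] b * L (last (last b))) (?B i s) \<le> letter_mean L i"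
          unfolding letter_mean_def by (rule msum_subset) auto
      qed auto
      also have "\<dots> = ?R * letter_mean L i" by (rule msum_multc)
      also have "\<dots> < \<infinity>"
        using le_less_trans[OF visits_reach_mass T] SL[OF i] by (simp add: ennreal_mult_less_top)
      finally show ?thesis .
    qed
    show ?thesis using 1 2[of 1] 2[of 2] by simp
  qed
  finally show ?thesis using letter_sum_visits[of j L] by (rule le_less_trans[rotated])
qed

lemma length_moment_finite:
  assumes z: "1 < z" and fin: "msum (wp (ennreal z) []) (blocks j) < \<infinity>"
  shows "msum (\<lambda>a. wp 1 [] a * of_nat (length a)) (blocks j) < \<infinity>"
proof -
  have "wp 1 [] a * of_nat (length a) \<le> ennreal (1 / (z - 1)) * wp (ennreal z) [] a" for a
  proof -
    have "real n \<le> 1 / (z - 1) * z ^ n" for n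
    proof -
      have "1 + real n * (z - 1) \<le> (1 + (z - 1)) ^ n"
        by (rule Bernoulli_inequality) (use z in simp)
      then show ?thesis using z by (simp add: field_simps)
    qed
    then have "ennreal (real (length a)) \<le> ennreal (1 / (z - 1) * z ^ length a)" by (intro ennreal_leI)
    also have "\<dots> = ennreal (1 / (z - 1)) * ennreal z ^ length a"
      using z by (subst ennreal_mult) (auto simp: ennreal_power)
    finally have "pweight Q [] a * of_nat (length a) \<le> pweight Q [] a * (ennreal (1 / (z - 1)) * ennreal z ^ length a)"
      by (intro mult_left_mono) (auto simp: ennreal_of_nat_eq_real_of_nat)
    then show ?thesis by (simp add: wp_def ac_simps)
  qed
  then have "msum (\<lambda>a. wp 1 [] a * of_nat (length a)) (blocks j) \<le> msum (\<lambda>a. ennreal (1 / (z - 1)) * wp (ennreal z) [] a) (blocks j)"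
    by (intro msum_mono)
  also have "\<dots> < \<infinity>" unfolding msum_cmult using fin by (simp add: ennreal_mult_less_top)
  finally show ?thesis .
qed

lemma block_moments:
  assumes "1 < z1" "msum (wp (ennreal z1) []) returns < \<infinity>"
  obtains z C where "1 < z" "C < \<infinity>"
    "\<And>j. j \<in> {1,2} \<Longrightarrow> msum (wp (ennreal z) []) (blocks j) < \<infinity>"
    "\<And>j. j \<in> {1,2} \<Longrightarrow> msum (wp 1 []) (blocks j) < \<infinity>"
    "\<And>j v. j \<in> {1,2} \<Longrightarrow> v \<in> N j \<Longrightarrow> reach_mass j [v] \<le> C"
proof -
  obtain z where z: "1 < z" "\<And>j. j \<in> {1,2} \<Longrightarrow> level_growth j (ennreal z) < 1" "\<And>j. j \<in> {1,2} \<Longrightarrow> level_growth j 1 < 1"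
    using level_growth_less_1_beyond_1[OF assms] by blast
  have fin: "msum (wp (ennreal y) []) (blocks j) < \<infinity>" if g: "level_growth j (ennreal y) < 1" and j: "j \<in> {1,2}" for j y
  proof -
    obtain C where "C < \<infinity>" "1 + C * level_growth j (ennreal y) \<le> C" by (rule geometric_fixpoint[OF g])
    then show ?thesis
      using blocks_mass[OF j, of C "ennreal y"] by (auto simp: ennreal_mult_less_top intro: le_less_trans)
  qed
  have "\<exists>C. C < \<infinity> \<and> (\<forall>v\<in>N j. reach_mass j [v] \<le> C)" if j: "j \<in> {1,2}" for j
  proof -
    obtain C where C: "C < \<infinity>" "1 + C * level_growth j 1 \<le> C" by (rule geometric_fixpoint[OF z(3)[OF j]])
    then show ?thesis using level_paths_mass[OF j _ C(2)] unfolding reach_mass_def by blast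
  qed
  then obtain C1 C2 where C12: "C1 < \<infinity>" "\<And>v. v \<in> N 1 \<Longrightarrow> reach_mass 1 [v] \<le> C1"
    "C2 < \<infinity>" "\<And>v. v \<in> N 2 \<Longrightarrow> reach_mass 2 [v] \<le> C2" by (metis insertI1 insertI2)
  show ?thesis
  proof (rule that[of z "C1 + C2"])
    fix j v assume "j \<in> {1,2::nat}" "v \<in> N j"
    then show "reach_mass j [v] \<le> C1 + C2"
      using C12(2,4)[of v] by (auto intro: order_trans add_increasing add_increasing2)
  next
    fix j assume "j \<in> {1,2::nat}"
    then show "msum (wp 1 []) (blocks j) < \<infinity>" using fin[of j 1] z(3) by simp
  qed (use z fin C12 in auto)
qed

end

section \<open>Weighted distance is additive over letters\<close>

context free_walk begin

text \<open>There is a path in factor \<open>i\<close> from the root to \<open>v\<close> with \<open>n\<close> edges and total weight \<open>c\<close>.\<close>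
inductive factor_path :: "nat \<Rightarrow> ('a \<times> 'a \<Rightarrow> real) \<Rightarrow> 'a \<Rightarrow> nat \<Rightarrow> real \<Rightarrow> bool" for i W where
  root: "factor_path i W (rt i) 0 0"
| step: "factor_path i W v n c \<Longrightarrow> (v, w) \<in> factor_edges V p i \<Longrightarrow> factor_path i W w (Suc n) (c + W (v, w))"

lemma factor_path_V: "factor_path i W v n c \<Longrightarrow> i \<in> {1,2} \<Longrightarrow> v \<in> V i"
  by (induction rule: factor_path.induct) (auto simp: factor_edges_def rt_in)

lemma nstep_factor_path:
  assumes "i \<in> {1,2}" "nstep (V i) (p i) m x y \<noteq> 0" "factor_path i W x n c"
  shows "\<exists>n c. factor_path i W y n c"
  using assms(2,3)
proof (induction m arbitrary: x n c)
  case 0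
  then show ?case by (auto split: if_splits)
next
  case (Suc m)
  have "\<exists>w\<in>V i. p i x w * nstep (V i) (p i) m w y \<noteq> 0"
  proof (rule ccontr)
    assume "\<not> ?thesis"
    then have "(\<Sum>\<^sub>\<infinity>w\<in>V i. p i x w * nstep (V i) (p i) m w y) = 0" by (intro infsum_0) auto
    then show False using Suc.prems(1) by simp
  qed
  then obtain w where w: "w \<in> V i" "p i x w \<noteq> 0" "nstep (V i) (p i) m w y \<noteq> 0" by auto
  have x: "x \<in> V i" by (rule factor_path_V[OF Suc.prems(2) assms(1)])
  have "(x, w) \<in> factor_edges V p i"
    using w x p_nonneg[OF assms(1) x w(1)] by (simp add: factor_edges_def)
  then show ?case using Suc.IH[OF w(3)] factor_path.step[OF Suc.prems(2)] by blast
qed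

lemma factor_path_exists: "i \<in> {1,2} \<Longrightarrow> v \<in> V i \<Longrightarrow> \<exists>n c. factor_path i W v n c"
proof -
  assume i: "i \<in> {1,2}" and v: "v \<in> V i"
  have "\<exists>n\<ge>1. nstep (V i) (p i) n (rt i) v > 0"
    using setting i v unfolding free_product_setting_def by blast
  then obtain n where "nstep (V i) (p i) n (rt i) v \<noteq> 0" by (metis less_irrefl)
  then show ?thesis using nstep_factor_path[OF i] factor_path.root by blast
qed

text \<open>The value of a letter, as a function on the whole factor: the root contributes no letter to a word.\<close>
definition pot :: "('a \<Rightarrow> real) \<Rightarrow> nat \<Rightarrow> 'a \<Rightarrow> real" where
  "pot f i v = (if v = rt i then 0 else f v)"

definition word_sum :: "('a \<Rightarrow> real) \<Rightarrow> 'a list \<Rightarrow> real" where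
  "word_sum f x = (\<Sum>a\<leftarrow>x. f a)"

abbreviation "ew \<equiv> extend_weight V rt p"

lemma word_sum_emb: "word_sum f (u @ emb rt i v) = word_sum f u + pot f i v"
  by (simp add: word_sum_def emb_def pot_def)

lemma edge_weight:
  assumes "i \<in> {1,2}" "(v, w) \<in> factor_edges V p i" "u \<in> FP" "wt u \<noteq> Some i"
  shows "ew W (u @ emb rt i v) (u @ emb rt i w) = W (v, w)"
    and "tp (u @ emb rt i v) (u @ emb rt i w) > 0"
proof -
  have vw: "v \<in> V i" "w \<in> V i" "0 < p i v w" using assms(2) by (auto simp: factor_edges_def)
  then have ne: "v \<noteq> w" using p_diag[OF assms(1)] by force
  show "ew W (u @ emb rt i v) (u @ emb rt i w) = W (v, w)"
    by (rule extend_weight_lifts[OF setting assms(1,2)]) (use assms vw in \<open>auto simp: lifts_def\<close>)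
  show "tp (u @ emb rt i v) (u @ emb rt i w) > 0"
    unfolding tp_copy[OF assms(1,3,4) vw(1,2) ne] using vw rate_pos[of i] by simp
qed

text \<open>\<open>f\<close> increases along each edge by at most the weight of the edge.\<close>
definition subadd :: "('a \<Rightarrow> real) \<Rightarrow> ('a \<times> 'a \<Rightarrow> real) \<Rightarrow> bool" where
  "subadd f W \<longleftrightarrow> (\<forall>i\<in>{1,2}. \<forall>v w. (v, w) \<in> factor_edges V p i \<longrightarrow> pot f i w \<le> pot f i v + W (v, w))"

lemma word_sum_edge:
  assumes "subadd f W" "tp x y \<noteq> 0"
  shows "word_sum f y \<le> word_sum f x + ew W x y"
  using assms(2)
proof (rule tp_nonzeroE)
  fix i u v w assume h: "i \<in> {1,2}" "u \<in> FP" "wt u \<noteq> Some i" "v \<in> V i" "w \<in> V i"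
    "x = u @ emb rt i v" "y = u @ emb rt i w" "0 < p i v w"
  then have e: "(v, w) \<in> factor_edges V p i" by (simp add: factor_edges_def)
  have "pot f i w \<le> pot f i v + W (v, w)"
    using assms(1) h(1) e unfolding subadd_def by blast
  then show ?thesis using h word_sum_emb edge_weight(1)[OF h(1) e h(2,3)] by simp
qed

abbreviation "routes \<equiv> paths_between V rt p \<alpha>"

lemma path_weight_snoc:
  assumes "\<pi> \<noteq> []"
  shows "path_weight W (\<pi> @ [y]) = path_weight W \<pi> + W (last \<pi>) y"
proof -
  obtain n where n: "length \<pi> = Suc n" using assms by (cases \<pi>) auto
  have "path_weight W (\<pi> @ [y]) = (\<Sum>i=1..Suc n. W ((\<pi> @ [y]) ! (i - 1)) ((\<pi> @ [y]) ! i))"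
    unfolding path_weight_def using n by simp
  also have "\<dots> = (\<Sum>i=1..n. W ((\<pi> @ [y]) ! (i - 1)) ((\<pi> @ [y]) ! i)) + W (last \<pi>) y"
    using n assms by (simp add: nth_append last_conv_nth)
  also have "(\<Sum>i=1..n. W ((\<pi> @ [y]) ! (i - 1)) ((\<pi> @ [y]) ! i)) = path_weight W \<pi>"
    unfolding path_weight_def using n by (intro sum.cong) (auto simp: nth_append)
  finally show ?thesis .
qed

lemma between_snoc:
  assumes "\<pi> @ [y] \<in> routes x z" "\<pi> \<noteq> []"
  shows "\<pi> \<in> routes x (last \<pi>)" "tp (last \<pi>) y > 0" "y = z"
  using assms by (auto simp: paths_between_def paths_def successively_append_iff)

lemma between_extend:
  assumes "\<pi> \<in> routes x z" "tp z y > 0"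
  shows "\<pi> @ [y] \<in> routes x y"
proof -
  have "y \<in> FP" using assms(2) tp_FP(2)[of z y] by simp
  then show ?thesis using assms
    by (auto simp: paths_between_def paths_def successively_append_iff)
qed

text \<open>Each step of a path lifts an edge of one factor, so \<open>word_sum f\<close> is a potential whose increments are
bounded by the weights of the steps.\<close>
lemma path_weight_lower:
  assumes "subadd f W" "\<pi> \<in> routes x y"
  shows "word_sum f y \<le> word_sum f x + path_weight (ew W) \<pi>"
  using assms(2)
proof (induction \<pi> arbitrary: y rule: rev_induct)
  case Nil
  then show ?case by (simp add: paths_between_def paths_def)
next
  case (snoc z \<pi>)
  show ?case
  proof (cases "\<pi> = []")
    case True
    then have "z = x" "z = y" using snoc.prems by (auto simp: paths_between_def)
    then show ?thesis using True by (simp add: path_weight_def)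
  next
    case False
    have "word_sum f (last \<pi>) \<le> word_sum f x + path_weight (ew W) \<pi>"
      by (rule snoc.IH) (rule between_snoc(1)[OF snoc.prems False])
    moreover have "word_sum f z \<le> word_sum f (last \<pi>) + ew W (last \<pi>) z"
      using between_snoc(2)[OF snoc.prems False] by (intro word_sum_edge[OF assms(1)]) simp
    ultimately show ?thesis
      using between_snoc(3)[OF snoc.prems False] path_weight_snoc[OF False] by simp
  qed
qed

lemma lift_factor_path:
  assumes "factor_path i W v n c" "i \<in> {1,2}" "u \<in> FP" "wt u \<noteq> Some i" "\<pi> \<in> routes x u"
  shows "\<exists>\<pi>'\<in>routes x (u @ emb rt i v). path_weight (ew W) \<pi>' = path_weight (ew W) \<pi> + c
    \<and> length \<pi>' = length \<pi> + n"
  using assms(1)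
proof (induction rule: factor_path.induct)
  case root
  then show ?case using assms(5) by (intro bexI[of _ \<pi>]) (auto simp: emb_def)
next
  case (step v n c w)
  then obtain \<pi>' where p': "\<pi>' \<in> routes x (u @ emb rt i v)"
    "path_weight (ew W) \<pi>' = path_weight (ew W) \<pi> + c" "length \<pi>' = length \<pi> + n" by blast
  have e: "ew W (u @ emb rt i v) (u @ emb rt i w) = W (v, w)" "tp (u @ emb rt i v) (u @ emb rt i w) > 0"
    using edge_weight[OF assms(2) step.hyps(2) assms(3,4)] by auto
  have ne: "\<pi>' \<noteq> []" "last \<pi>' = u @ emb rt i v" using p'(1) by (auto simp: paths_between_def paths_def)
  show ?case
    using between_extend[OF p'(1) e(2)] p'(2,3) e(1) ne path_weight_snoc[OF ne(1), of "ew W"]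
    by (intro bexI[of _ "\<pi>' @ [u @ emb rt i w]"]) auto
qed

definition letter_type :: "'a \<Rightarrow> nat" where
  "letter_type v = (if v \<in> V 1 then 1 else 2)"

lemma letter_type_eq: "v \<in> V i \<Longrightarrow> i \<in> {1,2} \<Longrightarrow> letter_type v = i"
  using disj by (auto simp: letter_type_def)

lemma word_path:
  assumes "x \<in> FP" "\<And>v. v \<in> set x \<Longrightarrow> factor_path (letter_type v) W v (n v) (c v)"
  shows "\<exists>\<pi>\<in>routes [] x. path_weight (ew W) \<pi> = word_sum c x \<and> length \<pi> = Suc (\<Sum>v\<leftarrow>x. n v)"
  using assms
proof (induction x rule: rev_induct)
  case Nil
  have "[[]] \<in> routes [] []" by (simp add: paths_between_def paths_def)
  then show ?case by (intro bexI[of _ "[[]]"]) (auto simp: path_weight_def word_sum_def)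
next
  case (snoc v x)
  have xF: "x \<in> FP" using snoc.prems(1) FP_appendD by blast
  obtain \<pi> where \<pi>: "\<pi> \<in> routes [] x" "path_weight (ew W) \<pi> = word_sum c x" "length \<pi> = Suc (\<Sum>v\<leftarrow>x. n v)"
    using snoc.IH[OF xF] snoc.prems(2) by auto
  have "v \<in> N 1 \<or> v \<in> N 2" using FP_last[OF snoc.prems(1)] by simp
  then obtain i where i: "i \<in> {1,2}" "v \<in> N i" by blast
  then have lt: "letter_type v = i" by (intro letter_type_eq) (auto simp: nonroot_def)
  have "wt x \<noteq> Some i"
  proof
    assume w: "wt x = Some i"
    then have "x \<noteq> []" by auto
    moreover have "last x \<in> N i" using w wt_iff[OF xF \<open>x \<noteq> []\<close> i(1)] by simp
    ultimately show False using snoc.prems(1) i FP_append[of x "[v]"] by auto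
  qed
  moreover have "factor_path i W v (n v) (c v)" using snoc.prems(2)[of v] lt by simp
  ultimately obtain \<pi>' where "\<pi>' \<in> routes [] (x @ emb rt i v)"
     "path_weight (ew W) \<pi>' = path_weight (ew W) \<pi> + c v" "length \<pi>' = length \<pi> + n v"
    using lift_factor_path[OF _ i(1) xF _ \<pi>(1)] by blast
  moreover have "emb rt i v = [v]" using i by (auto simp: emb_def nonroot_def)
  ultimately show ?case using \<pi> by (intro bexI[of _ \<pi>']) (auto simp: word_sum_def)
qed

text \<open>The weighted distance from the root to \<open>v\<close> inside the factor of \<open>v\<close>.\<close>
definition fdist :: "('a \<times> 'a \<Rightarrow> real) \<Rightarrow> 'a \<Rightarrow> real" where
  "fdist W v = Inf {c. \<exists>n. factor_path (letter_type v) W v n c}"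

definition nonneg_weight :: "('a \<times> 'a \<Rightarrow> real) \<Rightarrow> bool" where
  "nonneg_weight W \<longleftrightarrow> (\<forall>e\<in>factor_edges V p 1 \<union> factor_edges V p 2. 0 \<le> W e)"

lemma factor_path_nonneg:
  assumes "nonneg_weight W" "i \<in> {1,2}" "factor_path i W v n c"
  shows "0 \<le> c"
  using assms(3)
proof (induction rule: factor_path.induct)
  case (step v n c w)
  moreover have "0 \<le> W (v, w)" using assms(1,2) step.hyps(2) unfolding nonneg_weight_def by auto
  ultimately show ?case by simp
qed simp

lemma letter_type_in: "letter_type v \<in> {1,2}"
  by (simp add: letter_type_def)

lemma fdist_bdd: "nonneg_weight W \<Longrightarrow> bdd_below {c. \<exists>n. factor_path (letter_type v) W v n c}"
  by (rule bdd_belowI[of _ 0]) (use factor_path_nonneg letter_type_in in blast)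

lemma fdist_le:
  assumes "nonneg_weight W" "i \<in> {1,2}" "factor_path i W v n c"
  shows "fdist W v \<le> c"
proof -
  have "letter_type v = i" by (rule letter_type_eq[OF factor_path_V[OF assms(3,2)] assms(2)])
  then show ?thesis unfolding fdist_def using assms(3) by (intro cInf_lower fdist_bdd assms(1)) auto
qed

lemma fdist_approx:
  assumes "nonneg_weight W" "i \<in> {1,2}" "v \<in> V i" "0 < e"
  shows "\<exists>n c. factor_path i W v n c \<and> c < fdist W v + e"
proof -
  have lt: "letter_type v = i" by (rule letter_type_eq[OF assms(3,2)])
  have "{c. \<exists>n. factor_path (letter_type v) W v n c} \<noteq> {}"
    using factor_path_exists[OF assms(2,3), of W] lt by auto
  then have "\<exists>c\<in>{c. \<exists>n. factor_path (letter_type v) W v n c}. c < fdist W v + e"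
    unfolding fdist_def using assms(4) by (intro cInf_lessD) auto
  then show ?thesis using lt by auto
qed

lemma fdist_nonneg: "nonneg_weight W \<Longrightarrow> i \<in> {1,2} \<Longrightarrow> v \<in> V i \<Longrightarrow> 0 \<le> fdist W v"
proof (rule ccontr)
  assume h: "nonneg_weight W" "i \<in> {1,2}" "v \<in> V i" "\<not> 0 \<le> fdist W v"
  then obtain n c where nc: "factor_path i W v n c" "c < fdist W v + (- fdist W v)"
    using fdist_approx[OF h(1-3), of "- fdist W v"] by auto
  then show False using factor_path_nonneg[OF h(1,2) nc(1)] by simp
qed

lemma fdist_rt: "nonneg_weight W \<Longrightarrow> i \<in> {1,2} \<Longrightarrow> fdist W (rt i) = 0"
  using fdist_le[OF _ _ factor_path.root, of W i] fdist_nonneg[of W i "rt i"] rt_in[of i] by force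

lemma fdist_subadd:
  assumes "nonneg_weight W"
  shows "subadd (fdist W) W"
  unfolding subadd_def
proof (intro ballI allI impI)
  fix i v w assume i: "i \<in> {1,2::nat}" and e: "(v, w) \<in> factor_edges V p i"
  have v: "v \<in> V i" using e by (simp add: factor_edges_def)
  have "fdist W w \<le> fdist W v + W (v, w)"
  proof (rule field_le_epsilon)
    fix e' :: real assume "0 < e'"
    then obtain n c where "factor_path i W v n c" "c < fdist W v + e'"
      using fdist_approx[OF assms i v] by blast
    then show "fdist W w \<le> fdist W v + W (v, w) + e'"
      using fdist_le[OF assms i factor_path.step[OF _ e]] by force
  qed
  moreover have "pot (fdist W) i x = fdist W x" for x
    using fdist_rt[OF assms i] by (simp add: pot_def)
  ultimately show "pot (fdist W) i w \<le> pot (fdist W) i v + W (v, w)" by simp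
qed

lemma FP_letter_V: "x \<in> FP \<Longrightarrow> a \<in> set x \<Longrightarrow> a \<in> N (letter_type a) \<and> a \<in> V (letter_type a)"
proof -
  assume "x \<in> FP" "a \<in> set x"
  then have "a \<in> N 1 \<union> N 2" by (auto simp: free_product_def)
  then show ?thesis using letter_type_eq[of a 1] letter_type_eq[of a 2] by (auto simp: nonroot_def)
qed

text \<open>The lower bound is the potential argument for \<open>fdist W\<close>. For the upper bound, nearly optimal paths
inside the factors are lifted and joined letter by letter.\<close>
theorem weight_dist_word_sum:
  assumes W: "nonneg_weight W" and x: "x \<in> FP"
  shows "weight_dist V rt p \<alpha> (ew W) [] x = ereal (word_sum (fdist W) x)"
proof (rule antisym)
  show "ereal (word_sum (fdist W) x) \<le> weight_dist V rt p \<alpha> (ew W) [] x"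
    unfolding weight_dist_def
  proof (rule INF_greatest)
    fix \<pi> assume "\<pi> \<in> routes [] x"
    then show "ereal (word_sum (fdist W) x) \<le> ereal (path_weight (ew W) \<pi>)"
      using path_weight_lower[OF fdist_subadd[OF W], of \<pi> "[]" x] by (simp add: word_sum_def)
  qed
  show "weight_dist V rt p \<alpha> (ew W) [] x \<le> ereal (word_sum (fdist W) x)"
  proof (rule ereal_le_epsilon2)
    fix r :: real assume e: "0 < r"
    show "weight_dist V rt p \<alpha> (ew W) [] x \<le> ereal (word_sum (fdist W) x) + ereal r"
    proof -
      \<comment> \<open>an error of \<open>d\<close> per letter adds up to at most \<open>r\<close>\<close>
      define d where "d = r / real (Suc (length x))"
      have d: "0 < d" using e by (simp add: d_def)
      have "\<forall>v\<in>set x. \<exists>n c. factor_path (letter_type v) W v n c \<and> c < fdist W v + d"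
        using fdist_approx[OF W letter_type_in _ d] FP_letter_V[OF x] by blast
      then obtain n c where nc: "\<And>v. v \<in> set x \<Longrightarrow> factor_path (letter_type v) W v (n v) (c v) \<and> c v < fdist W v + d"
        by metis
      obtain \<pi> where \<pi>: "\<pi> \<in> routes [] x" "path_weight (ew W) \<pi> = word_sum c x"
        using word_path[OF x, of W n c] nc by blast
      have "word_sum c x \<le> (\<Sum>v\<leftarrow>x. fdist W v + d)"
        unfolding word_sum_def using nc by (intro sum_list_mono) (simp add: less_imp_le)
      also have "\<dots> = word_sum (fdist W) x + real (length x) * d"
        by (simp add: word_sum_def sum_list_addf sum_list_triv)
      also have "real (length x) * d \<le> r" using e by (simp add: d_def field_simps)
      finally have "ereal (path_weight (ew W) \<pi>) \<le> ereal (word_sum (fdist W) x) + ereal r" using \<pi> by simp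
      then show ?thesis unfolding weight_dist_def using \<pi>(1) by (meson INF_lower order_trans)
    qed
  qed
qed

definition steps :: "'a \<Rightarrow> nat" where
  "steps v = (LEAST n. \<exists>c. factor_path (letter_type v) (\<lambda>_. 1) v n c)"

lemma factor_path_reweight: "factor_path i W v n c \<Longrightarrow> \<exists>c. factor_path i W' v n c"
  by (induction rule: factor_path.induct) (blast intro: factor_path.intros)+

lemma steps_path: "i \<in> {1,2} \<Longrightarrow> v \<in> V i \<Longrightarrow> \<exists>c. factor_path i W v (steps v) c"
proof -
  assume i: "i \<in> {1,2}" and v: "v \<in> V i"
  have lt: "letter_type v = i" by (rule letter_type_eq[OF v i])
  have "\<exists>c. factor_path (letter_type v) (\<lambda>_. 1) v (steps v) c"
    unfolding steps_def by (rule LeastI_ex) (use factor_path_exists[OF i v] lt in simp)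
  then show ?thesis using factor_path_reweight lt by metis
qed

lemma steps_le:
  assumes i: "i \<in> {1,2}" and f: "factor_path i W v n c"
  shows "steps v \<le> n"
proof -
  have lt: "letter_type v = i" by (rule letter_type_eq[OF factor_path_V[OF f i] i])
  show ?thesis unfolding steps_def lt using factor_path_reweight[OF f] by (intro Least_le)
qed

lemma steps_rt: "i \<in> {1,2} \<Longrightarrow> steps (rt i) = 0"
  using steps_le[OF _ factor_path.root] by force

lemma steps_subadd: "subadd (\<lambda>v. real (steps v)) (\<lambda>_. 1)"
  unfolding subadd_def
proof (intro ballI allI impI)
  fix i v w assume i: "i \<in> {1,2::nat}" and e: "(v, w) \<in> factor_edges V p i"
  have v: "v \<in> V i" using e by (simp add: factor_edges_def)
  obtain c where "factor_path i (\<lambda>_. 1) v (steps v) c" using steps_path[OF i v] by blast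
  then have "steps w \<le> Suc (steps v)" using steps_le[OF i factor_path.step[OF _ e]] by blast
  moreover have "pot (\<lambda>v. real (steps v)) i x = real (steps x)" for x
    using steps_rt[OF i] by (simp add: pot_def)
  ultimately show "pot (\<lambda>v. real (steps v)) i w \<le> pot (\<lambda>v. real (steps v)) i v + 1" by simp
qed

lemma ew_one: "tp x y \<noteq> 0 \<Longrightarrow> ew (\<lambda>_. 1) x y = 1"
proof (erule tp_nonzeroE)
  fix i u v w assume h: "i \<in> {1,2}" "u \<in> FP" "wt u \<noteq> Some i" "v \<in> V i" "w \<in> V i"
    "x = u @ emb rt i v" "y = u @ emb rt i w" "0 < p i v w"
  then have e: "(v, w) \<in> factor_edges V p i" by (simp add: factor_edges_def)
  show "ew (\<lambda>_. 1) x y = 1" using edge_weight(1)[OF h(1) e h(2,3)] h by simp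
qed

lemma path_weight_one:
  assumes "\<pi> \<in> paths V rt p \<alpha>"
  shows "path_weight (ew (\<lambda>_. 1)) \<pi> = real (length \<pi> - 1)"
proof -
  have "ew (\<lambda>_. 1) (\<pi> ! (i - 1)) (\<pi> ! i) = 1" if "i \<in> {1..length \<pi> - 1}" for i
  proof -
    have "successively (\<lambda>x y. tp x y > 0) \<pi>" using assms by (simp add: paths_def)
    then have "tp (\<pi> ! (i - 1)) (\<pi> ! Suc (i - 1)) > 0"
      by (rule successively_nth) (use that in auto)
    then show ?thesis using that ew_one[of "\<pi> ! (i - 1)" "\<pi> ! i"] by simp
  qed
  then show ?thesis unfolding path_weight_def by simp
qed

text \<open>The potential argument with unit weights: leaving the factor does not shorten a path.\<close>
lemma graph_dist_emb:
  assumes i: "i \<in> {1,2}" and v: "v \<in> V i"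
  shows "graph_dist V rt p \<alpha> [] (emb rt i v) = enat (steps v)"
proof (rule antisym)
  obtain c where c: "factor_path i (\<lambda>_. 1) v (steps v) c" using steps_path[OF i v] by blast
  have "[[]] \<in> routes [] []" by (simp add: paths_between_def paths_def)
  then obtain \<pi> where "\<pi> \<in> routes [] ([] @ emb rt i v)" "length \<pi> = length [[]::'a list] + steps v"
    using lift_factor_path[OF c i, of "[]" "[[]]" "[]"] by auto
  then show "graph_dist V rt p \<alpha> [] (emb rt i v) \<le> enat (steps v)"
    unfolding graph_dist_def by (intro INF_lower2[of \<pi>]) auto
  show "enat (steps v) \<le> graph_dist V rt p \<alpha> [] (emb rt i v)"
    unfolding graph_dist_def
  proof (rule INF_greatest)
    fix \<pi> assume \<pi>: "\<pi> \<in> routes [] (emb rt i v)"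
    have "word_sum (\<lambda>v. real (steps v)) (emb rt i v) = real (steps v)"
      using steps_rt[OF i] by (simp add: word_sum_def emb_def)
    then show "enat (steps v) \<le> enat (length \<pi> - 1)"
      using path_weight_lower[OF steps_subadd \<pi>] \<pi> path_weight_one[of \<pi>]
      by (simp add: word_sum_def paths_between_def)
  qed
qed

lemma steps_path_length:
  assumes "pweight Q [] s \<noteq> 0"
  shows "word_sum (\<lambda>v. real (steps v)) (last ([] # s)) \<le> real (length s)"
proof -
  have "pweight Q x s \<noteq> 0 \<Longrightarrow> word_sum (\<lambda>v. real (steps v)) (last (x # s)) \<le> word_sum (\<lambda>v. real (steps v)) x + real (length s)" for x
  proof (induction s arbitrary: x)
    case (Cons y s)
    then have t: "tp x y \<noteq> 0" "pweight Q y s \<noteq> 0" by (auto simp: Q_nonzero)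
    have "word_sum (\<lambda>v. real (steps v)) y \<le> word_sum (\<lambda>v. real (steps v)) x + 1"
      using word_sum_edge[OF steps_subadd t(1)] ew_one[OF t(1)] by simp
    then show ?case using Cons.IH[OF t(2)] by simp
  qed simp
  from this[OF assms] show ?thesis by (simp add: word_sum_def)
qed

lemma start_emb: "i \<in> {1,2} \<Longrightarrow> (v, w) \<in> factor_edges V p i \<Longrightarrow> start rt (v, w) = emb rt i v"
proof -
  assume i: "i \<in> {1,2}" and e: "(v, w) \<in> factor_edges V p i"
  then have "v \<in> V i" by (simp add: factor_edges_def)
  then have "v \<in> {rt 1, rt 2} \<longleftrightarrow> v = rt i" using i disj rt_in[of 1] rt_in[of 2] by auto
  then show ?thesis by (simp add: start_def emb_def)
qed

lemma steps_pred:
  assumes i: "i \<in> {1,2}" and v: "v \<in> V i" and s: "steps v = Suc m"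
  obtains u where "(u, v) \<in> factor_edges V p i" "steps u = m" "u \<in> V i"
proof -
  obtain c where "factor_path i (\<lambda>_. 1) v (Suc m) c" using steps_path[OF i v] s by metis
  then obtain u c' where u: "factor_path i (\<lambda>_. 1) u m c'" "(u, v) \<in> factor_edges V p i"
    by (auto elim: factor_path.cases)
  have uV: "u \<in> V i" using u(2) by (simp add: factor_edges_def)
  obtain c'' where "factor_path i (\<lambda>_. 1) u (steps u) c''" using steps_path[OF i uV] by blast
  then have "steps v \<le> Suc (steps u)" using steps_le[OF i factor_path.step[OF _ u(2)]] by blast
  then show ?thesis using that[OF u(2) _ uV] steps_le[OF i u(1)] s by simp
qed

end

section \<open>Growth of the weighted distance\<close>

context free_walk begin

text \<open>Every vertex at positive distance has a predecessor that is closer by one. So if no edge starts at some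
distance, then none starts further out, and finitely many of the bounds at fixed distance
suffice. Otherwise, choose at each distance an edge that violates the bound, if there is one; the
growth condition for this sequence shows that violations stop.\<close>
lemma weight_growth_bound:
  assumes W: "nonneg_weight W" and l: "0 < l"
    and growth: "\<forall>e :: nat \<Rightarrow> 'a \<times> 'a.
          (\<forall>n\<ge>1. e n \<in> factor_edges V p 1 \<union> factor_edges V p 2 \<and>
                  graph_dist V rt p \<alpha> [] (start rt (e n)) = enat n) \<longrightarrow>
          limsup (\<lambda>n. ereal (\<bar>W (e n)\<bar> / exp (l * real n))) = 0"
    and bdd: "\<And>n::nat. bdd_above (W ` {e \<in> factor_edges V p 1 \<union> factor_edges V p 2.
                graph_dist V rt p \<alpha> [] (start rt e) = enat n})"
  shows "\<exists>C\<ge>0. \<forall>i\<in>{1,2}. \<forall>v w. (v, w) \<in> factor_edges V p i \<longrightarrow> W (v, w) \<le> C * exp (l * real (steps v))"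
proof -
  define E where "E n = {e \<in> factor_edges V p 1 \<union> factor_edges V p 2. graph_dist V rt p \<alpha> [] (start rt e) = enat n}" for n
  have E_iff: "(v, w) \<in> E n \<longleftrightarrow> steps v = n" if "i \<in> {1,2}" "(v, w) \<in> factor_edges V p i" for i v w n
  proof -
    have "v \<in> V i" using that(2) by (simp add: factor_edges_def)
    then have "graph_dist V rt p \<alpha> [] (start rt (v, w)) = enat (steps v)"
      using start_emb[OF that] graph_dist_emb[OF that(1)] by simp
    then show ?thesis using that unfolding E_def by auto
  qed
  have "\<exists>B. \<forall>n. \<forall>e\<in>E n. W e \<le> B n"
    using bdd unfolding E_def bdd_above_def by (intro choice) auto
  then obtain B where B: "\<And>n e. e \<in> E n \<Longrightarrow> W e \<le> B n" by blast
  have "\<exists>N. \<forall>n\<ge>N. \<forall>e\<in>E n. W e \<le> exp (l * real n)"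
  proof (cases "\<exists>N\<ge>1. E N = {}")
    case True
    then obtain N where N: "E N = {}" by blast
    have "E (N + n) = {}" for n
    proof (induction n)
      case (Suc n)
      show ?case
      proof (rule ccontr)
        assume "E (N + Suc n) \<noteq> {}"
        then obtain v w where vw: "(v, w) \<in> E (N + Suc n)" by auto
        then obtain i where i: "i \<in> {1,2}" "(v, w) \<in> factor_edges V p i" unfolding E_def by blast
        then have s: "steps v = Suc (N + n)" using E_iff vw by auto
        have "v \<in> V i" using i(2) by (simp add: factor_edges_def)
        then obtain u where "(u, v) \<in> factor_edges V p i" "steps u = N + n"
          by (rule steps_pred[OF i(1) _ s])
        then have "(u, v) \<in> E (N + n)" using E_iff[OF i(1)] by simp
        then show False using Suc by simp
      qed
    qed (simp add: N)
    then have "\<forall>n\<ge>N. \<forall>e\<in>E n. W e \<le> exp (l * real n)" using le_Suc_ex by blast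
    then show ?thesis by blast
  next
    case False
    \<comment> \<open>an edge at distance \<open>n\<close> that violates the bound, or any edge at that distance if none does\<close>
    define e where "e n = (if \<exists>x\<in>E n. W x > exp (l * real n) then SOME x. x \<in> E n \<and> W x > exp (l * real n) else SOME x. x \<in> E n)" for n
    have e1: "e n \<in> E n \<and> ((\<exists>x\<in>E n. W x > exp (l * real n)) \<longrightarrow> W (e n) > exp (l * real n))" if "n \<ge> 1" for n
    proof (cases "\<exists>x\<in>E n. W x > exp (l * real n)")
      case True
      then have "\<exists>x. x \<in> E n \<and> W x > exp (l * real n)" by blast
      from someI_ex[OF this] show ?thesis unfolding e_def using True by simp
    next
      case f: False
      have "\<exists>x. x \<in> E n" using False that by blast
      from someI_ex[OF this] show ?thesis unfolding e_def using f by simp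
    qed
    have "limsup (\<lambda>n. ereal (\<bar>W (e n)\<bar> / exp (l * real n))) = 0"
      by (rule growth[rule_format]) (use e1 in \<open>auto simp: E_def\<close>)
    then have "limsup (\<lambda>n. ereal (\<bar>W (e n)\<bar> / exp (l * real n))) < 1" by simp
    then have "eventually (\<lambda>n. ereal (\<bar>W (e n)\<bar> / exp (l * real n)) < 1) sequentially"
      by (rule Limsup_lessD)
    then obtain N where N: "\<And>n. n \<ge> N \<Longrightarrow> \<bar>W (e n)\<bar> / exp (l * real n) < 1"
      by (auto simp: eventually_sequentially)
    have "W x \<le> exp (l * real n)" if "n \<ge> max N 1" "x \<in> E n" for n x
    proof (rule ccontr)
      assume "\<not> W x \<le> exp (l * real n)"
      then have "W (e n) > exp (l * real n)" using e1[of n] that by force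
      then show False using N[of n] that by (simp add: field_simps)
    qed
    then show ?thesis by blast
  qed
  then obtain N where N: "\<And>n e. n \<ge> N \<Longrightarrow> e \<in> E n \<Longrightarrow> W e \<le> exp (l * real n)" by blast
  define C where "C = 1 + (\<Sum>n<N. \<bar>B n\<bar>)"
  have C: "1 \<le> C" unfolding C_def by (simp add: sum_nonneg)
  have "W (v, w) \<le> C * exp (l * real (steps v))" if "i \<in> {1,2}" "(v, w) \<in> factor_edges V p i" for i v w
  proof -
    have e: "(v, w) \<in> E (steps v)" using E_iff[OF that] by simp
    have ex: "1 \<le> exp (l * real (steps v))" using l by simp
    show ?thesis
    proof (cases "steps v \<ge> N")
      case True
      have "W (v, w) \<le> 1 * exp (l * real (steps v))" using N[OF True e] by simp
      also have "\<dots> \<le> C * exp (l * real (steps v))" using C by (intro mult_right_mono) auto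
      finally show ?thesis .
    next
      case False
      have "W (v, w) \<le> B (steps v)" by (rule B[OF e])
      also have "\<dots> \<le> (\<Sum>n<N. \<bar>B n\<bar>)"
        using member_le_sum[of "steps v" "{..<N}" "\<lambda>n. \<bar>B n\<bar>"] False by simp
      also have "\<dots> \<le> C * 1" by (simp add: C_def)
      also have "\<dots> \<le> C * exp (l * real (steps v))" by (intro mult_left_mono ex) (use C in linarith)
      finally show ?thesis .
    qed
  qed
  then show ?thesis using C by (intro exI[of _ C]) auto
qed

text \<open>A geometric series along a shortest path.\<close>
lemma fdist_growth:
  assumes W: "nonneg_weight W" and z: "1 < z" and C: "0 \<le> C"
    and bound: "\<And>i v w. i \<in> {1,2} \<Longrightarrow> (v, w) \<in> factor_edges V p i \<Longrightarrow> W (v, w) \<le> C * z ^ steps v"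
    and i: "i \<in> {1,2}" and v: "v \<in> V i"
  shows "fdist W v * (z - 1) \<le> C * z ^ steps v"
proof -
  have "v \<in> V i \<Longrightarrow> steps v = m \<Longrightarrow> fdist W v * (z - 1) \<le> C * (z ^ m - 1)" for m
  proof (induction m arbitrary: v)
    case 0
    then obtain c where "factor_path i W v 0 c" using steps_path[OF i, of v W] by auto
    then have "v = rt i" by (auto elim: factor_path.cases)
    then show ?case using fdist_rt[OF W i] by simp
  next
    case (Suc m)
    obtain u where u: "(u, v) \<in> factor_edges V p i" "steps u = m" "u \<in> V i"
      by (rule steps_pred[OF i Suc.prems])
    have "pot (fdist W) i v \<le> pot (fdist W) i u + W (u, v)"
      using fdist_subadd[OF W] i u(1) unfolding subadd_def by blast
    then have "fdist W v \<le> fdist W u + C * z ^ m"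
      using bound[OF i u(1)] u(2) fdist_rt[OF W i] by (auto simp: pot_def split: if_splits)
    then have "fdist W v * (z - 1) \<le> (fdist W u + C * z ^ m) * (z - 1)"
      using z by (intro mult_right_mono) auto
    also have "\<dots> = fdist W u * (z - 1) + C * z ^ m * (z - 1)" by (simp add: algebra_simps)
    also have "\<dots> \<le> C * (z ^ m - 1) + C * z ^ m * (z - 1)"
      by (intro add_right_mono Suc.IH u)
    also have "\<dots> = C * (z ^ Suc m - 1)" by (simp add: algebra_simps)
    finally show ?case .
  qed
  from this[OF v refl] show ?thesis using C by (simp add: algebra_simps)
qed

text \<open>A block that ends in \<open>v\<close> has at least \<open>steps v\<close> steps.\<close>
lemma letter_mean_finite:
  assumes z: "1 < z" and fin: "msum (wp (ennreal z) []) (blocks i) < \<infinity>" and i: "i \<in> {1,2}" and K: "0 \<le> K"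
    and L: "\<And>v. v \<in> V i \<Longrightarrow> L v \<le> K * z ^ steps v"
  shows "letter_mean (\<lambda>v. ennreal (L v)) i < \<infinity>"
proof -
  have "letter_mean (\<lambda>v. ennreal (L v)) i \<le> msum (\<lambda>b. ennreal K * wp (ennreal z) [] b) (blocks i)"
    unfolding letter_mean_def
  proof (rule msum_mono)
    fix b assume b: "b \<in> blocks i"
    show "wp 1 [] b * ennreal (L (last (last b))) \<le> ennreal K * wp (ennreal z) [] b"
    proof (cases "pweight Q [] b = 0")
      case True
      then show ?thesis by (simp add: wp_def)
    next
      case False
      have "last b \<in> branch i" "length (last b) = 1" using b last_in_set[of b] by (auto simp: blocks_def)
      then obtain v where v: "last b = [v]" "v \<in> N i" by (rule length1_branch)
      have "steps v \<le> length b"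
        using steps_path_length[OF False] b v(1) by (simp add: blocks_def word_sum_def)
      then have "z ^ steps v \<le> z ^ length b" using z by (intro power_increasing) auto
      then have "L v \<le> K * z ^ length b"
        using L[of v] v(2) mult_left_mono[OF _ K, of "z ^ steps v" "z ^ length b"] by (simp add: nonroot_def)
      then have "ennreal (L v) \<le> ennreal (K * z ^ length b)" by (rule ennreal_leI)
      also have "\<dots> = ennreal K * ennreal z ^ length b"
        using K z by (simp add: ennreal_mult ennreal_power)
      finally have "ennreal (L v) \<le> ennreal K * ennreal z ^ length b" .
      then have "pweight Q [] b * ennreal (L v) \<le> pweight Q [] b * (ennreal K * ennreal z ^ length b)"
        by (intro mult_left_mono) auto
      then show ?thesis using v by (simp add: wp_def ac_simps)
    qed
  qed
  also have "\<dots> < \<infinity>" unfolding msum_cmult using fin by (simp add: ennreal_mult_less_top)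
  finally show ?thesis .
qed

section \<open>Last exits of a trajectory\<close>

definition good :: "(nat \<Rightarrow> 'a list) \<Rightarrow> bool" where
  "good \<xi> \<longleftrightarrow> \<xi> 0 = [] \<and> (\<forall>n. tp (\<xi> n) (\<xi> (Suc n)) \<noteq> 0) \<and> (\<forall>k. \<exists>m. \<forall>n>m. k < length (\<xi> n))"

text \<open>The last time at which the word has at most \<open>k\<close> letters, written as a least number so that
its measurability is immediate.\<close>
definition exit_time :: "nat \<Rightarrow> (nat \<Rightarrow> 'a list) \<Rightarrow> nat" where
  "exit_time k \<xi> = (LEAST n. \<forall>n'>n. k < length (\<xi> n'))"

definition seg :: "(nat \<Rightarrow> 'a list) \<Rightarrow> nat \<Rightarrow> nat \<Rightarrow> 'a list list" where
  "seg \<xi> a b = map (\<lambda>n. \<xi> (Suc n)) [a..<b]"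

text \<open>The common prefix is removed, so that a block is a path from the empty word.\<close>
definition blk :: "nat \<Rightarrow> (nat \<Rightarrow> 'a list) \<Rightarrow> 'a list list" where
  "blk k \<xi> = map (drop k) (seg \<xi> (exit_time k \<xi>) (exit_time (Suc k) \<xi>))"

lemma exit_time_after:
  assumes "good \<xi>" "exit_time k \<xi> < n"
  shows "k < length (\<xi> n)"
proof -
  have "\<exists>m. \<forall>n>m. k < length (\<xi> n)" using assms(1) unfolding good_def by blast
  from LeastI_ex[OF this] show ?thesis using assms(2) unfolding exit_time_def by blast
qed

lemma exit_time_eqI:
  assumes "length (\<xi> t) \<le> k" "\<And>n. t < n \<Longrightarrow> k < length (\<xi> n)"
  shows "exit_time k \<xi> = t"
  unfolding exit_time_def
proof (rule Least_equality)
  fix y assume "\<forall>n'>y. k < length (\<xi> n')"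
  then show "t \<le> y" using assms(1) by (meson not_le)
qed (use assms(2) in blast)

lemma exit_time_length:
  assumes "good \<xi>"
  shows "length (\<xi> (exit_time k \<xi>)) = k"
proof (rule antisym)
  show "length (\<xi> (exit_time k \<xi>)) \<le> k"
  proof (cases "exit_time k \<xi>")
    case 0
    then show ?thesis using assms by (simp add: good_def)
  next
    case (Suc m)
    then have "\<not> (\<forall>n'>m. k < length (\<xi> n'))"
      using not_less_Least[of m "\<lambda>n. \<forall>n'>n. k < length (\<xi> n')"] unfolding exit_time_def by simp
    then obtain n' where n': "m < n'" "length (\<xi> n') \<le> k" by (auto simp: not_less)
    then have "n' \<le> Suc m" using exit_time_after[OF assms, of k n'] Suc by (cases "n' \<le> Suc m") auto
    then show ?thesis using n' Suc by (simp add: le_Suc_eq)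
  qed
  have "tp (\<xi> (exit_time k \<xi>)) (\<xi> (Suc (exit_time k \<xi>))) \<noteq> 0" using assms by (simp add: good_def)
  then have "length (\<xi> (Suc (exit_time k \<xi>))) \<le> Suc (length (\<xi> (exit_time k \<xi>)))" using tp_length by blast
  moreover have "k < length (\<xi> (Suc (exit_time k \<xi>)))" by (rule exit_time_after[OF assms]) simp
  ultimately show "k \<le> length (\<xi> (exit_time k \<xi>))" by simp
qed

lemma exit_time_mono:
  assumes "good \<xi>"
  shows "exit_time k \<xi> < exit_time (Suc k) \<xi>"
proof (rule ccontr)
  assume "\<not> exit_time k \<xi> < exit_time (Suc k) \<xi>"
  then consider "exit_time (Suc k) \<xi> < exit_time k \<xi>" | "exit_time (Suc k) \<xi> = exit_time k \<xi>" by linarith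
  then show False
  proof cases
    case 1
    then show ?thesis using exit_time_after[OF assms 1] exit_time_length[OF assms, of k] by simp
  next
    case 2
    then show ?thesis using exit_time_length[OF assms, of k] exit_time_length[OF assms, of "Suc k"] by simp
  qed
qed

lemma exit_time_mono_le:
  assumes "good \<xi>" "a \<le> b"
  shows "exit_time a \<xi> \<le> exit_time b \<xi>"
  using less_imp_le[OF exit_time_mono[OF assms(1)]] assms(2)
  by (rule lift_Suc_mono_le[where f="\<lambda>k. exit_time k \<xi>"])

lemma seg_append: "a \<le> b \<Longrightarrow> b \<le> c \<Longrightarrow> seg \<xi> a b @ seg \<xi> b c = seg \<xi> a c"
proof -
  assume "a \<le> b" "b \<le> c"
  then have "[a..<c] = [a..<b] @ [b..<c]" using upt_add_eq_append[of a b "c - b"] by simp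
  then show ?thesis by (simp add: seg_def)
qed

lemma length_seg [simp]: "length (seg \<xi> a b) = b - a"
  by (simp add: seg_def)

lemma seg_Suc: "a \<le> b \<Longrightarrow> seg \<xi> a (Suc b) = seg \<xi> a b @ [\<xi> (Suc b)]"
  by (simp add: seg_def)

lemma last_seg: "a \<le> b \<Longrightarrow> last (\<xi> a # seg \<xi> a b) = \<xi> b"
  by (cases "a = b") (auto simp: seg_def last_map last_upt)

lemma set_seg: "set (seg \<xi> a b) = {\<xi> n | n. a < n \<and> n \<le> b}"
proof -
  have "set (seg \<xi> a b) = \<xi> ` Suc ` {a..<b}" by (simp only: seg_def set_map set_upt image_image)
  also have "Suc ` {a..<b} = {n. a < n \<and> n \<le> b}" by (auto simp: image_Suc_atLeastLessThan)
  finally show ?thesis by blast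
qed

lemma pweight_seg: "good \<xi> \<Longrightarrow> a \<le> b \<Longrightarrow> pweight Q (\<xi> a) (seg \<xi> a b) \<noteq> 0"
proof (induction b)
  case (Suc b)
  show ?case
  proof (cases "a = Suc b")
    case False
    then have ab: "a \<le> b" using Suc.prems by simp
    have "Q (\<xi> b) (\<xi> (Suc b)) \<noteq> 0" using Suc.prems by (simp add: Q_nonzero good_def)
    then show ?thesis
      using Suc.IH[OF Suc.prems(1) ab] by (simp add: seg_Suc[OF ab] pweight_append last_seg[OF ab] del: last.simps)
  qed (simp add: seg_def)
qed (simp add: seg_def)

lemma good_FP: "good \<xi> \<Longrightarrow> \<xi> n \<in> FP"
  unfolding good_def using tp_FP(1) by blast

lemma take_after_exit:
  assumes "good \<xi>" "exit_time k \<xi> \<le> n"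
  shows "take k (\<xi> n) = \<xi> (exit_time k \<xi>)"
  using assms(2)
proof (induction n rule: dec_induct)
  case base
  then show ?case using exit_time_length[OF assms(1), of k] by simp
next
  case (step n)
  have "tp (\<xi> n) (\<xi> (Suc n)) \<noteq> 0" using assms(1) by (simp add: good_def)
  then have "take k (\<xi> n) = take k (\<xi> (Suc n))"
    by (rule tp_take) (use exit_time_after[OF assms(1), of k "Suc n"] step in auto)
  then show ?case using step by simp
qed

lemma after_exit_split:
  assumes "good \<xi>" "exit_time k \<xi> \<le> n"
  shows "\<xi> n = \<xi> (exit_time k \<xi>) @ drop k (\<xi> n)"
  unfolding take_after_exit[OF assms, symmetric] by (rule append_take_drop_id[symmetric])

lemma seg_blk:
  assumes "good \<xi>"
  shows "seg \<xi> (exit_time k \<xi>) (exit_time (Suc k) \<xi>) = map ((@) (\<xi> (exit_time k \<xi>))) (blk k \<xi>)"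
proof -
  have "\<xi> (exit_time k \<xi>) @ drop k y = y" if y: "y \<in> set (seg \<xi> (exit_time k \<xi>) (exit_time (Suc k) \<xi>))" for y
  proof -
    obtain n where n: "y = \<xi> n" "exit_time k \<xi> < n" using y unfolding set_seg by blast
    have "exit_time k \<xi> \<le> n" using n(2) by simp
    from after_exit_split[OF assms this] show ?thesis unfolding n(1) by (rule sym)
  qed
  then show ?thesis unfolding blk_def by (simp add: map_idI)
qed

lemma exit_word_Suc:
  assumes "good \<xi>"
  shows "\<xi> (exit_time (Suc k) \<xi>) = \<xi> (exit_time k \<xi>) @ last (blk k \<xi>)" "blk k \<xi> \<noteq> []"
proof -
  let ?a = "exit_time k \<xi>" and ?b = "exit_time (Suc k) \<xi>"
  have ab: "?a < ?b" by (rule exit_time_mono[OF assms])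
  have "length (blk k \<xi>) = ?b - ?a" by (simp add: blk_def)
  then show ne: "blk k \<xi> \<noteq> []" using ab by (cases "blk k \<xi>") simp_all
  have "\<xi> ?b = last (\<xi> ?a # seg \<xi> ?a ?b)"
    by (rule last_seg[symmetric]) (use ab in simp)
  also have "\<dots> = last (map ((@) (\<xi> ?a)) (blk k \<xi>))"
    unfolding seg_blk[OF assms] using ne by (cases "blk k \<xi>") simp_all
  also have "\<dots> = \<xi> ?a @ last (blk k \<xi>)" by (rule last_map[OF ne])
  finally show "\<xi> ?b = \<xi> ?a @ last (blk k \<xi>)" .
qed

lemma blk_block:
  assumes "good \<xi>"
  obtains i where "i \<in> {1,2}" "wt (\<xi> (exit_time k \<xi>)) \<noteq> Some i" "blk k \<xi> \<in> blocks i"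
    "wt (\<xi> (exit_time (Suc k) \<xi>)) = Some i"
proof -
  let ?u = "\<xi> (exit_time k \<xi>)"
  let ?s = "seg \<xi> (exit_time k \<xi>) (exit_time (Suc k) \<xi>)"
  have le: "exit_time k \<xi> \<le> exit_time (Suc k) \<xi>" using exit_time_mono[OF assms, of k] by simp
  have ne: "?s \<noteq> []" using exit_word_Suc(2)[OF assms, of k] unfolding seg_blk[OF assms] by (cases "blk k \<xi>") simp_all
  have "length ?u < length y" if "y \<in> set ?s" for y
    using that exit_time_after[OF assms, of k] exit_time_length[OF assms, of k] by (auto simp: set_seg)
  then obtain i t where it: "i \<in> {1,2}" "wt ?u \<noteq> Some i" "set t \<subseteq> branch i" "?s = map ((@) ?u) t"
    using path_above_cut[OF pweight_seg[OF assms le] good_FP[OF assms] ne] by blast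
  then have "map ((@) ?u) t = map ((@) ?u) (blk k \<xi>)" using seg_blk[OF assms, of k] by simp
  then have t: "t = blk k \<xi>" by (simp add: inj_map_eq_map inj_def)
  have "length (\<xi> (exit_time (Suc k) \<xi>)) = length ?u + length (last (blk k \<xi>))"
    unfolding exit_word_Suc(1)[OF assms, of k] by (rule length_append)
  then have len: "length (last (blk k \<xi>)) = 1"
    unfolding exit_time_length[OF assms] by simp
  have lb: "last (blk k \<xi>) \<in> branch i"
    using it(3) last_in_set[OF exit_word_Suc(2)[OF assms, of k]] unfolding t by (rule subsetD)
  have bi: "blk k \<xi> \<in> blocks i"
    using it(3) t len exit_word_Suc(2)[OF assms, of k] by (simp add: blocks_def)
  obtain v where v: "last (blk k \<xi>) = [v]" "v \<in> N i" by (rule length1_branch[OF lb len])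
  then have "wt (\<xi> (exit_time (Suc k) \<xi>)) = Some i"
    using exit_word_Suc(1)[OF assms, of k] wt_singleton[OF v(2) it(1)] by (simp add: wt_last)
  then show ?thesis by (rule that[OF it(1,2) bi])
qed

definition alt_type :: "nat \<Rightarrow> nat \<Rightarrow> nat" where
  "alt_type i k = (if even k then i else opp i)"

lemma blk_alternate:
  assumes "good \<xi>"
  obtains i where "i \<in> {1,2}" "\<And>k. blk k \<xi> \<in> blocks (alt_type i k)"
proof -
  obtain i where i: "i \<in> {1,2}" "wt (\<xi> (exit_time 0 \<xi>)) \<noteq> Some i" "blk 0 \<xi> \<in> blocks i"
    "wt (\<xi> (exit_time (Suc 0) \<xi>)) = Some i"
    by (rule blk_block[OF assms, of 0])
  have "blk k \<xi> \<in> blocks (alt_type i k) \<and> wt (\<xi> (exit_time (Suc k) \<xi>)) = Some (alt_type i k)" for k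
  proof (induction k)
    case (Suc k)
    obtain j where j: "j \<in> {1,2}" "wt (\<xi> (exit_time (Suc k) \<xi>)) \<noteq> Some j" "blk (Suc k) \<xi> \<in> blocks j"
      "wt (\<xi> (exit_time (Suc (Suc k)) \<xi>)) = Some j" by (rule blk_block[OF assms, of "Suc k"])
    have "alt_type i k \<in> {1,2}" using i(1) by (auto simp: alt_type_def opp_def)
    moreover have "j \<noteq> alt_type i k" using j(2) Suc by simp
    ultimately have "j = opp (alt_type i k)" by (intro opp_neq j(1))
    moreover have "opp (alt_type i k) = alt_type i (Suc k)" using i(1) by (simp add: alt_type_def)
    ultimately show ?case using j by simp
  qed (use i in \<open>simp add: alt_type_def\<close>)
  then show ?thesis by (intro that[OF i(1)]) simp
qed

text \<open>Each block is put back at the word that the previous ones have reached.\<close>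
primrec join_blocks :: "'a list \<Rightarrow> 'a list list list \<Rightarrow> 'a list list" where
  "join_blocks u [] = []"
| "join_blocks u (b # bs) = map ((@) u) b @ join_blocks (u @ last b) bs"

lemma cat_blks:
  assumes "good \<xi>"
  shows "seg \<xi> (exit_time k \<xi>) (exit_time (k + m) \<xi>) = join_blocks (\<xi> (exit_time k \<xi>)) (map (\<lambda>j. blk (k + j) \<xi>) [0..<m])"
proof (induction m arbitrary: k)
  case (Suc m)
  have mono: "exit_time k \<xi> \<le> exit_time (k + m) \<xi>" for k m
    by (rule exit_time_mono_le[OF assms]) simp
  have "map (\<lambda>j. blk (k + j) \<xi>) [0..<Suc m] = blk k \<xi> # map (\<lambda>j. blk (Suc k + j) \<xi>) [0..<m]"
    by (simp add: upt_conv_Cons map_Suc_upt[symmetric] del: upt_Suc)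
  then have "join_blocks (\<xi> (exit_time k \<xi>)) (map (\<lambda>j. blk (k + j) \<xi>) [0..<Suc m])
    = seg \<xi> (exit_time k \<xi>) (exit_time (Suc k) \<xi>) @ seg \<xi> (exit_time (Suc k) \<xi>) (exit_time (Suc k + m) \<xi>)"
    using Suc.IH[of "Suc k"] by (simp add: seg_blk[OF assms] exit_word_Suc(1)[OF assms, symmetric])
  also have "\<dots> = seg \<xi> (exit_time k \<xi>) (exit_time (k + Suc m) \<xi>)"
    using mono[of "Suc k" m] less_imp_le[OF exit_time_mono[OF assms, of k]] by (simp add: seg_append)
  finally show ?case by simp
qed (simp add: seg_def)

fun alternating :: "nat \<Rightarrow> 'a list list list \<Rightarrow> bool" where
  "alternating i [] = True"
| "alternating i (b # bs) = (b \<in> blocks i \<and> alternating (opp i) bs)"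

lemma cat_length_gt:
  assumes "alternating i bs" "y \<in> set (join_blocks u bs)"
  shows "length u < length y"
  using assms
proof (induction bs arbitrary: i u)
  case (Cons b bs)
  then show ?case
    using branch_ne[of _ i] by (fastforce simp: blocks_def)
qed simp

lemma length_cat_end:
  assumes "alternating i bs"
  shows "length (last (u # join_blocks u bs)) = length u + length bs"
  using assms
proof (induction bs arbitrary: i u)
  case (Cons b bs)
  then have b: "b \<noteq> []" "length (last b) = 1" by (auto simp: blocks_def)
  have "last (u # join_blocks u (b # bs)) = last ((u @ last b) # join_blocks (u @ last b) bs)"
    using b by (cases "join_blocks (u @ last b) bs = []") (auto simp: last_map)
  then show ?case using Cons.IH[of "opp i" "u @ last b"] Cons.prems b by simp
qed simp

lemma blks_of_cat:
  assumes "alternating i bs" "exit_time k \<xi> = t" "length (\<xi> t) = k"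
    and "seg \<xi> t (t + length (join_blocks (\<xi> t) bs)) = join_blocks (\<xi> t) bs"
    and "\<And>n. t + length (join_blocks (\<xi> t) bs) < n \<Longrightarrow> k + length bs < length (\<xi> n)"
  shows "\<forall>j<length bs. blk (k + j) \<xi> = bs ! j"
  using assms
proof (induction bs arbitrary: i k t)
  case (Cons b bs)
  have b: "b \<noteq> []" "length (last b) = 1" "b \<in> blocks i" using Cons.prems(1) by (auto simp: blocks_def)
  let ?t = "t + length b"
  let ?c = "join_blocks (\<xi> t @ last b) bs"
  have sp: "seg \<xi> t ?t @ seg \<xi> ?t (?t + length ?c) = map ((@) (\<xi> t)) b @ ?c"
    using Cons.prems(4) by (simp add: seg_append add.assoc)
  then have s1: "seg \<xi> t ?t = map ((@) (\<xi> t)) b" and s2: "seg \<xi> ?t (?t + length ?c) = ?c"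
    by (simp_all add: append_eq_append_conv)
  have xt: "\<xi> ?t = \<xi> t @ last b"
    using last_seg[of t ?t \<xi>] s1 b(1) by (simp add: last_map)
  have gt: "Suc k < length (\<xi> n)" if "?t < n" for n
  proof (cases "n \<le> ?t + length ?c")
    case True
    then have "\<xi> n \<in> set ?c" using that s2 set_seg[of \<xi> ?t "?t + length ?c"] by auto
    then have "length (\<xi> t @ last b) < length (\<xi> n)"
      by (intro cat_length_gt[of "opp i" bs]) (use Cons.prems(1) in simp)
    then show ?thesis using b Cons.prems(3) by simp
  next
    case False
    then show ?thesis using Cons.prems(5)[of n] by simp
  qed
  have ex: "exit_time (Suc k) \<xi> = ?t"
    by (rule exit_time_eqI) (use gt xt b Cons.prems(3) in auto)
  have b0: "blk k \<xi> = b"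
    unfolding blk_def Cons.prems(2) ex s1 using Cons.prems(3) by (simp add: comp_def map_idI)
  have "\<forall>j<length bs. blk (Suc k + j) \<xi> = bs ! j"
  proof (rule Cons.IH)
    show "alternating (opp i) bs" using Cons.prems(1) by simp
    show "length (\<xi> ?t) = Suc k" using xt b Cons.prems(3) by simp
    show "seg \<xi> ?t (?t + length (join_blocks (\<xi> ?t) bs)) = join_blocks (\<xi> ?t) bs" using s2 xt by simp
    show "Suc k + length bs < length (\<xi> n)" if "?t + length (join_blocks (\<xi> ?t) bs) < n" for n
      using Cons.prems(5)[of n] that xt by (simp add: add.assoc)
  qed (rule ex)
  then show ?case using b0 by (auto simp: nth_Cons split: nat.split)
qed simp

text \<open>The first blocks are given ones iff the path starts accordingly and then stays above the level that
it has reached. The second condition determines the exit times, and it concerns only the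
future after the last of them.\<close>
lemma decomposition_iff:
  assumes g: "good \<xi>" and s: "s \<in> returns" and alt: "alternating i bs"
  shows "(seg \<xi> 0 (exit_time 0 \<xi>) = s \<and> (\<forall>k<length bs. blk k \<xi> = bs ! k)) \<longleftrightarrow>
    (seg \<xi> 0 (length (s @ join_blocks [] bs)) = s @ join_blocks [] bs \<and> (\<forall>n>length (s @ join_blocks [] bs). length bs < length (\<xi> n)))"
    (is "?L \<longleftrightarrow> ?R")
proof
  assume L: ?L
  have x0: "\<xi> (exit_time 0 \<xi>) = []" using exit_time_length[OF g, of 0] by simp
  have "map (\<lambda>j. blk (0 + j) \<xi>) [0..<length bs] = bs" using L by (intro nth_equalityI) auto
  then have c: "seg \<xi> (exit_time 0 \<xi>) (exit_time (length bs) \<xi>) = join_blocks [] bs"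
    using cat_blks[OF g, of 0 "length bs"] x0 by simp
  have le: "exit_time 0 \<xi> \<le> exit_time m \<xi>" for m
    by (rule exit_time_mono_le[OF g]) simp
  have all: "s @ join_blocks [] bs = seg \<xi> 0 (exit_time (length bs) \<xi>)"
    using L c seg_append[OF _ le[of "length bs"], of 0 \<xi>] by simp
  then have "length (s @ join_blocks [] bs) = exit_time (length bs) \<xi>" by simp
  then show ?R using all exit_time_after[OF g, of "length bs"] by simp
next
  assume R: ?R
  let ?t = "length s"
  have sp: "seg \<xi> 0 ?t @ seg \<xi> ?t (?t + length (join_blocks [] bs)) = s @ join_blocks [] bs"
    using R by (simp add: seg_append)
  then have s1: "seg \<xi> 0 ?t = s" and s2: "seg \<xi> ?t (?t + length (join_blocks [] bs)) = join_blocks [] bs"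
    by (simp_all add: append_eq_append_conv)
  have "last (\<xi> 0 # seg \<xi> 0 ?t) = []" using s s1 g by (simp add: returns_def good_def)
  then have xt: "\<xi> ?t = []" using last_seg[of 0 ?t \<xi>] by simp
  have ex: "exit_time 0 \<xi> = ?t"
  proof (rule exit_time_eqI)
    fix n assume n: "?t < n"
    show "0 < length (\<xi> n)"
    proof (cases "n \<le> ?t + length (join_blocks [] bs)")
      case True
      then have "\<xi> n \<in> set (join_blocks [] bs)" using n s2 set_seg[of \<xi> ?t "?t + length (join_blocks [] bs)"] by auto
      then show ?thesis using cat_length_gt[OF alt] by fastforce
    next
      case False
      then have "length bs < length (\<xi> n)" using R by simp
      then show ?thesis by linarith
    qed
  qed (simp add: xt)
  have "\<forall>j<length bs. blk (0 + j) \<xi> = bs ! j"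
    by (rule blks_of_cat[OF alt ex]) (use xt s2 R in auto)
  then show ?L using ex s1 by simp
qed

end

section \<open>The random walk\<close>

lemma measurable_countable_rangeI:
  assumes "countable A" "\<And>\<omega>. \<omega> \<in> space M \<Longrightarrow> f \<omega> \<in> A"
    and "\<And>a. a \<in> A \<Longrightarrow> {\<omega>\<in>space M. f \<omega> = a} \<in> sets M"
  shows "f \<in> M \<rightarrow>\<^sub>M count_space UNIV"
proof (rule measurableI)
  fix B
  have "f -` B \<inter> space M = (\<Union>a\<in>A \<inter> B. {\<omega>\<in>space M. f \<omega> = a})" using assms(2) by auto
  also have "\<dots> \<in> sets M"
    using assms(1,3) by (intro sets.countable_UN') (auto intro: countable_subset)
  finally show "f -` B \<inter> space M \<in> sets M" .
qed simp

lemma msum_list_prod: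
  "msum (\<lambda>l. \<Prod>k<m. w (l ! k)) {l. length l = m \<and> (\<forall>k<m. l ! k \<in> A k)} = (\<Prod>k<m. msum w (A k))"
proof (induction m arbitrary: A)
  case 0
  have "{l :: 'a list. length l = 0 \<and> (\<forall>k<0. l ! k \<in> A k)} = {[]}" by auto
  then show ?case by (simp only: msum_singleton) simp
next
  case (Suc m)
  let ?L = "\<lambda>m A. {l :: 'a list. length l = m \<and> (\<forall>k<m. l ! k \<in> A k)}"
  have eq: "?L (Suc m) A = (\<lambda>(x, l). x # l) ` (A 0 \<times> ?L m (\<lambda>k. A (Suc k)))"
  proof (intro equalityI subsetI)
    fix l assume "l \<in> ?L (Suc m) A"
    then obtain x l' where l: "l = x # l'" "length l' = m" "\<forall>k<Suc m. l ! k \<in> A k"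
      by (cases l) auto
    have "x \<in> A 0" using l(1) l(3)[rule_format, of 0] by simp
    moreover have "l' ! k \<in> A (Suc k)" if "k < m" for k
      using l(1) l(3)[rule_format, of "Suc k"] that by simp
    ultimately show "l \<in> (\<lambda>(x, l). x # l) ` (A 0 \<times> ?L m (\<lambda>k. A (Suc k)))"
      using l(1,2) by (intro image_eqI[of _ _ "(x, l')"]) auto
  next
    fix l assume "l \<in> (\<lambda>(x, l). x # l) ` (A 0 \<times> ?L m (\<lambda>k. A (Suc k)))"
    then show "l \<in> ?L (Suc m) A" by (auto simp: nth_Cons split: nat.split)
  qed
  have "msum (\<lambda>l. \<Prod>k<Suc m. w (l ! k)) (?L (Suc m) A)
      = msum (\<lambda>(x, l). w x * (\<Prod>k<m. w (l ! k))) (A 0 \<times> ?L m (\<lambda>k. A (Suc k)))"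
    unfolding eq by (subst msum_reindex) (auto simp: inj_on_def prod.lessThan_Suc_shift intro!: msum_cong simp del: prod.lessThan_Suc)
  also have "\<dots> = msum w (A 0) * (\<Prod>k<m. msum w (A (Suc k)))"
    unfolding msum_Times Suc ..
  also have "\<dots> = (\<Prod>k<Suc m. msum w (A k))"
    by (simp add: prod.lessThan_Suc_shift del: prod.lessThan_Suc)
  finally show ?case .
qed

locale random_walk = free_walk V rt p \<alpha>
  for V :: "nat \<Rightarrow> 'a set" and rt p \<alpha> +
  fixes M :: "'w measure" and X :: "nat \<Rightarrow> 'w \<Rightarrow> 'a list"
  assumes walk: "markov_chain M FP tp [] X"
    and radius: "conv_radius (\<lambda>n. measure M {\<omega>\<in>space M. X n \<omega> = []}) > 1"
begin

sublocale prob_space M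
  using walk by (simp add: markov_chain_def)

lemma countable_FP: "countable FP"
proof -
  have "FP \<subseteq> lists (V 1 \<union> V 2)"
    by (auto simp: free_product_def nonroot_def)
  moreover have "countable (lists (V 1 \<union> V 2))"
    using countable_V by (intro countable_lists) auto
  ultimately show ?thesis by (rule countable_subset)
qed

lemma X_FP: "\<omega> \<in> space M \<Longrightarrow> X n \<omega> \<in> FP"
  using walk measurable_space[of "X n" M "count_space FP" \<omega>] by (simp add: markov_chain_def)

lemma X_measurable [measurable]: "X n \<in> M \<rightarrow>\<^sub>M count_space UNIV"
proof (rule measurable_countable_rangeI[OF countable_FP X_FP])
  fix a assume "a \<in> FP"
  have "X n \<in> M \<rightarrow>\<^sub>M count_space FP" using walk by (simp add: markov_chain_def)
  then have "X n -` {a} \<inter> space M \<in> sets M" by (rule measurable_sets) (simp add: \<open>a \<in> FP\<close>)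
  then show "{\<omega>\<in>space M. X n \<omega> = a} \<in> sets M" by (simp add: vimage_def Int_def conj_commute)
qed

lemma X_0: "AE \<omega> in M. X 0 \<omega> = []"
  using walk by (simp add: markov_chain_def)

abbreviation "traj \<omega> \<equiv> (\<lambda>n. X n \<omega>)"
abbreviation "walked n \<omega> \<equiv> seg (traj \<omega>) 0 n"

lemma countable_lists_FP: "countable (lists FP)"
  by (rule countable_lists[OF countable_FP])

lemma seg_lists: "\<omega> \<in> space M \<Longrightarrow> seg (traj \<omega>) a b \<in> lists FP"
  using X_FP by (auto simp: seg_def)

lemma seg_eq_iff: "seg \<xi> a b = t \<longleftrightarrow> length t = b - a \<and> (\<forall>k<b - a. \<xi> (Suc (a + k)) = t ! k)"
  by (auto simp: seg_def list_eq_iff_nth_eq)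

lemma seg_measurable [measurable]: "(\<lambda>\<omega>. seg (traj \<omega>) a b) \<in> M \<rightarrow>\<^sub>M count_space UNIV"
  by (rule measurable_countable_rangeI[OF countable_lists_FP seg_lists]) (auto simp: seg_eq_iff)

lemma discrete_event: "f \<in> M \<rightarrow>\<^sub>M count_space UNIV \<Longrightarrow> {\<omega>\<in>space M. R (f \<omega>)} \<in> sets M"
proof -
  assume f: "f \<in> M \<rightarrow>\<^sub>M count_space UNIV"
  have "{\<omega>\<in>space M. R (f \<omega>)} = f -` Collect R \<inter> space M" by auto
  then show ?thesis using measurable_sets[OF f, of "Collect R"] by simp
qed

lemmas X_event = discrete_event[OF X_measurable]
lemmas seg_event = discrete_event[OF seg_measurable]

lemma path_prob_eq:
  "length s = n \<Longrightarrow> emeasure M {\<omega>\<in>space M. walked n \<omega> = s} = pweight Q [] s"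
proof (induction s arbitrary: n rule: rev_induct)
  case Nil
  then show ?case using emeasure_space_1 by (simp add: seg_def)
next
  case (snoc y s)
  then obtain m where n: "n = Suc m" "length s = m" by auto
  define c where "c k = ([] # s @ [y]) ! k" for k
  have cyl: "measure M {\<omega>\<in>space M. walked (length t) \<omega> = t} = measure M {\<omega>\<in>space M. \<forall>k\<le>length t. X k \<omega> = ([] # t @ r) ! k}" for t r
  proof (rule measure_eq_AE)
    show "AE \<omega> in M. (\<omega> \<in> {\<omega>\<in>space M. walked (length t) \<omega> = t}) = (\<omega> \<in> {\<omega>\<in>space M. \<forall>k\<le>length t. X k \<omega> = ([] # t @ r) ! k})"
      using X_0
    proof eventually_elim
      case (elim \<omega>)
      have "(\<forall>k\<le>length t. X k \<omega> = ([] # t @ r) ! k) \<longleftrightarrow> (\<forall>k<length t. X (Suc k) \<omega> = t ! k)"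
      proof
        assume h: "\<forall>k\<le>length t. X k \<omega> = ([] # t @ r) ! k"
        show "\<forall>k<length t. X (Suc k) \<omega> = t ! k"
        proof (intro allI impI)
          fix k assume "k < length t"
          then show "X (Suc k) \<omega> = t ! k" using h[rule_format, of "Suc k"] by (simp add: nth_append)
        qed
      next
        assume h: "\<forall>k<length t. X (Suc k) \<omega> = t ! k"
        show "\<forall>k\<le>length t. X k \<omega> = ([] # t @ r) ! k"
        proof (intro allI impI)
          fix k assume "k \<le> length t"
          then show "X k \<omega> = ([] # t @ r) ! k" using h elim by (cases k) (auto simp: nth_append)
        qed
      qed
      then show ?case by (simp add: seg_eq_iff)
    qed
  qed measurable
  show ?case
  proof (cases "set (s @ [y]) \<subseteq> FP")
    case True
    have c_FP: "\<forall>k\<le>Suc m. c k \<in> FP"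
    proof (intro allI impI)
      fix k assume "k \<le> Suc m"
      then have "c k \<in> set ([] # s @ [y])" unfolding c_def by (intro nth_mem) (use n in simp)
      then show "c k \<in> FP" using True by auto
    qed
    have "measure M {\<omega>\<in>space M. \<forall>k\<le>Suc m. X k \<omega> = c k} = measure M {\<omega>\<in>space M. \<forall>k\<le>m. X k \<omega> = c k} * tp (c m) (c (Suc m))"
      using walk c_FP unfolding markov_chain_def by blast
    moreover have "measure M {\<omega>\<in>space M. walked n \<omega> = s @ [y]} = measure M {\<omega>\<in>space M. \<forall>k\<le>Suc m. X k \<omega> = c k}"
      using cyl[of "s @ [y]" "[]"] n by (simp add: c_def[abs_def])
    moreover have "measure M {\<omega>\<in>space M. walked m \<omega> = s} = measure M {\<omega>\<in>space M. \<forall>k\<le>m. X k \<omega> = c k}"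
      using cyl[of s "[y]"] n by (simp add: c_def[abs_def])
    moreover have "c m = last ([] # s)" "c (Suc m) = y"
      using n by (cases s rule: rev_cases; auto simp: c_def nth_append nth_Cons split: nat.split)+
    ultimately have "measure M {\<omega>\<in>space M. walked n \<omega> = s @ [y]} = measure M {\<omega>\<in>space M. walked m \<omega> = s} * tp (last ([] # s)) y"
      by simp
    then have "emeasure M {\<omega>\<in>space M. walked n \<omega> = s @ [y]} = emeasure M {\<omega>\<in>space M. walked m \<omega> = s} * Q (last ([] # s)) y"
      unfolding emeasure_eq_measure Q_def using tp_nonneg by (simp add: ennreal_mult)
    then show ?thesis using snoc.IH[of m] n by (simp add: pweight_append del: last.simps)
  next
    case False
    have e: "{\<omega>\<in>space M. walked n \<omega> = s @ [y]} = {}"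
    proof -
      have "walked n \<omega> \<noteq> s @ [y]" if "\<omega> \<in> space M" for \<omega>
        using seg_lists[OF that, of 0 n] False by auto
      then show ?thesis by blast
    qed
    have "pweight Q [] (s @ [y]) = 0" using False pweight_FP[of "[]" "s @ [y]"] Nil_FP by blast
    then show ?thesis unfolding e by simp
  qed
qed

lemma path_prob:
  "emeasure M {\<omega>\<in>space M. walked n \<omega> \<in> F} = msum (pweight Q []) {s\<in>F. length s = n}"
proof -
  let ?A = "{s\<in>F. length s = n \<and> s \<in> lists FP}"
  have "{\<omega>\<in>space M. walked n \<omega> \<in> F} = (\<Union>s\<in>?A. {\<omega>\<in>space M. walked n \<omega> = s})"
    using seg_lists by auto
  then have "emeasure M {\<omega>\<in>space M. walked n \<omega> \<in> F} = emeasure M (\<Union>s\<in>?A. {\<omega>\<in>space M. walked n \<omega> = s})" by simp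
  also have "\<dots> = (\<integral>\<^sup>+s. emeasure M {\<omega>\<in>space M. walked n \<omega> = s} \<partial>count_space ?A)"
  proof (rule emeasure_UN_countable)
    show "countable ?A" by (rule countable_subset[OF _ countable_lists_FP]) auto
  qed (auto simp: disjoint_family_on_def)
  also have "\<dots> = msum (pweight Q []) ?A"
    by (intro msum_cong path_prob_eq) simp
  also have "\<dots> = msum (pweight Q []) {s\<in>F. length s = n}"
  proof (rule nn_integral_count_space_eq)
    fix s assume "s \<in> {s\<in>F. length s = n} - ?A"
    then have "\<not> set s \<subseteq> FP" by auto
    then show "pweight Q [] s = 0" using pweight_FP[of "[]" s] Nil_FP by blast
  qed auto
  finally show ?thesis .
qed

lemma path_positive: "AE \<omega> in M. \<forall>n. pweight Q [] (walked n \<omega>) \<noteq> 0"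
proof (subst AE_all_countable, rule allI)
  fix n
  have "emeasure M {\<omega>\<in>space M. walked n \<omega> \<in> {s. pweight Q [] s = 0}} = msum (pweight Q []) {s\<in>{s. pweight Q [] s = 0}. length s = n}"
    by (rule path_prob)
  also have "\<dots> = msum (\<lambda>_. 0) {s\<in>{s. pweight Q [] s = 0}. length s = n}" by (rule msum_cong) simp
  finally have "emeasure M {\<omega>\<in>space M. \<not> pweight Q [] (walked n \<omega>) \<noteq> 0} = 0" by simp
  then show "AE \<omega> in M. pweight Q [] (walked n \<omega>) \<noteq> 0"
    by (subst AE_iff_measurable[OF _ refl]) auto
qed

lemma last_path: "X 0 \<omega> = [] \<Longrightarrow> last ([] # walked n \<omega>) = X n \<omega>"
  using last_seg[of 0 n "traj \<omega>"] by simp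

lemma steps_positive: "AE \<omega> in M. \<forall>n. tp (X n \<omega>) (X (Suc n) \<omega>) \<noteq> 0"
  using path_positive X_0
proof eventually_elim
  case (elim \<omega>)
  show ?case
  proof
    fix n
    have "pweight Q [] (walked n \<omega> @ [X (Suc n) \<omega>]) \<noteq> 0"
      using elim(1)[rule_format, of "Suc n"] seg_Suc[of 0 n "traj \<omega>"] by simp
    then show "tp (X n \<omega>) (X (Suc n) \<omega>) \<noteq> 0"
      unfolding pweight_append last_path[OF elim(2)] by (simp add: Q_nonzero)
  qed
qed

lemma returns_mass:
  "\<exists>z>1. msum (wp (ennreal z) []) returns < \<infinity>"
proof -
  let ?a = "\<lambda>n. measure M {\<omega>\<in>space M. X n \<omega> = []}"
  obtain z where z: "1 < ereal z" "ereal z < conv_radius ?a"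
    using ereal_dense2[OF radius] by blast
  then have z1: "1 < z" by simp
  have sm: "summable (\<lambda>n. ?a n * z ^ n)"
    by (rule summable_in_conv_radius) (use z z1 in simp)
  have "msum (wp (ennreal z) []) {s\<in>returns. length s = n} = ennreal (?a n * z ^ n)" for n
  proof -
    have "msum (wp (ennreal z) []) {s\<in>returns. length s = n} = msum (\<lambda>s. ennreal z ^ n * pweight Q [] s) {s\<in>returns. length s = n}"
      by (intro msum_cong) (simp add: wp_def)
    also have "\<dots> = ennreal z ^ n * emeasure M {\<omega>\<in>space M. walked n \<omega> \<in> returns}"
      unfolding msum_cmult path_prob ..
    also have "emeasure M {\<omega>\<in>space M. walked n \<omega> \<in> returns} = emeasure M {\<omega>\<in>space M. X n \<omega> = []}"
    proof (rule emeasure_eq_AE)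
      show "AE \<omega> in M. (\<omega> \<in> {\<omega>\<in>space M. walked n \<omega> \<in> returns}) = (\<omega> \<in> {\<omega>\<in>space M. X n \<omega> = []})"
        using X_0 by eventually_elim (simp add: returns_def last_path del: last.simps)
    qed (rule seg_event X_event)+
    finally show ?thesis
      using z1 by (simp add: emeasure_eq_measure ennreal_power ennreal_mult mult.commute)
  qed
  then have "msum (wp (ennreal z) []) returns = (\<Sum>n. ennreal (?a n * z ^ n))"
    by (subst msum_by_size[where g=length]) simp
  also have "\<dots> < \<infinity>"
    using sm z1 by (simp add: suminf_ennreal2)
  finally show ?thesis using z1 by blast
qed

lemma returns_mass_1: "msum (wp 1 []) returns < \<infinity>"
proof -
  obtain z where z: "1 < z" "msum (wp (ennreal z) []) returns < \<infinity>" using returns_mass by blast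
  have "wp 1 [] s \<le> wp (ennreal z) [] s" for s
    unfolding wp_def using z by (intro mult_right_mono power_mono) auto
  then have "msum (wp 1 []) returns \<le> msum (wp (ennreal z) []) returns" by (rule msum_mono)
  then show ?thesis using z(2) by (rule le_less_trans)
qed

lemma block_bounds:
  obtains z C where "1 < z" "C < \<infinity>"
    "\<And>j. j \<in> {1,2} \<Longrightarrow> msum (wp (ennreal z) []) (blocks j) < \<infinity>"
    "\<And>j. j \<in> {1,2} \<Longrightarrow> msum (wp 1 []) (blocks j) < \<infinity>"
    "\<And>j v. j \<in> {1,2} \<Longrightarrow> v \<in> N j \<Longrightarrow> reach_mass j [v] \<le> C"
proof -
  obtain z where "1 < z" "msum (wp (ennreal z) []) returns < \<infinity>" using returns_mass by blast
  from block_moments[OF this] show ?thesis using that .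
qed

lemma blocks_mass_1: "j \<in> {1,2} \<Longrightarrow> msum (wp 1 []) (blocks j) < \<infinity>"
  using block_bounds by metis

text \<open>Borel--Cantelli, since the mean number of visits to a level is finite.\<close>
lemma leaves_level: "AE \<omega> in M. eventually (\<lambda>n. length (X n \<omega>) \<noteq> k) sequentially"
proof -
  let ?A = "\<lambda>n. {\<omega>\<in>space M. length (X n \<omega>) = k}"
  let ?F = "{s. length (last ([] # s)) = k}"
  have "emeasure M (?A n) = msum (wp 1 []) {s\<in>?F. length s = n}" for n
  proof -
    have "emeasure M (?A n) = emeasure M {\<omega>\<in>space M. walked n \<omega> \<in> ?F}"
    proof (rule emeasure_eq_AE)
      show "AE \<omega> in M. (\<omega> \<in> ?A n) = (\<omega> \<in> {\<omega>\<in>space M. walked n \<omega> \<in> ?F})"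
        using X_0 by eventually_elim (simp add: last_path del: last.simps)
    qed (rule seg_event X_event)+
    then show ?thesis unfolding path_prob wp_1 .
  qed
  then have "(\<Sum>n. emeasure M (?A n)) = msum (wp 1 []) ?F"
    by (subst msum_by_size[where g=length]) simp
  also have "\<dots> < \<infinity>" by (rule level_mass_finite[OF returns_mass_1 blocks_mass_1])
  finally have "(\<Sum>n. ennreal (measure M (?A n))) \<noteq> \<infinity>" by (simp add: emeasure_eq_measure)
  then have "summable (\<lambda>n. measure M (?A n))" by (intro summable_suminf_not_top) auto
  then have "AE \<omega> in M. eventually (\<lambda>n. \<omega> \<in> space M - ?A n) sequentially"
    by (intro borel_cantelli_AE1) (auto simp: emeasure_eq_measure)
  then show ?thesis by eventually_elim (auto elim: eventually_mono)
qed

lemma trajectory_good: "AE \<omega> in M. good (traj \<omega>)"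
proof -
  have "AE \<omega> in M. \<forall>k. eventually (\<lambda>n. length (X n \<omega>) \<noteq> k) sequentially"
    by (subst AE_all_countable) (simp add: leaves_level)
  then show ?thesis using X_0 steps_positive
  proof eventually_elim
    case (elim \<omega>)
    have "\<exists>m. \<forall>n>m. k < length (X n \<omega>)" for k
    proof -
      have "eventually (\<lambda>n. \<forall>j\<in>{..k}. length (X n \<omega>) \<noteq> j) sequentially"
        using elim(1) by (intro eventually_ball_finite) auto
      then obtain m where m: "\<And>n. n \<ge> m \<Longrightarrow> \<forall>j\<in>{..k}. length (X n \<omega>) \<noteq> j"
        by (auto simp: eventually_sequentially)
      have "k < length (X n \<omega>)" if "n > m" for n
        by (rule ccontr) (use m[of n] that in auto)
      then show ?thesis by blast
    qed
    then show ?case using elim(2,3) by (simp add: good_def)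
  qed
qed

end

section \<open>Joint law of the blocks\<close>

context free_walk begin

lemma alternating_iff:
  assumes "i \<in> {1,2}"
  shows "alternating i bs \<longleftrightarrow> (\<forall>k<length bs. bs ! k \<in> blocks (alt_type i k))"
  using assms
proof (induction bs arbitrary: i)
  case (Cons b bs)
  have "alt_type i (Suc k) = alt_type (opp i) k" for k
    using Cons.prems by (simp add: alt_type_def)
  moreover have "alt_type i 0 = i" by (simp add: alt_type_def)
  ultimately show ?case
    by (simp only: alternating.simps Cons.IH[OF opp_in[OF Cons.prems]] length_Cons All_less_Suc2 nth_Cons_0 nth_Cons_Suc)
qed simp

lemma alt_type_in: "i \<in> {1,2} \<Longrightarrow> alt_type i k \<in> {1,2}"
  by (auto simp: alt_type_def opp_def)

lemma cat_weight:
  assumes "i \<in> {1,2}" "alternating i bs" "u \<in> FP" "wt u \<noteq> Some i"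
  shows "pweight Q u (join_blocks u bs) = (\<Prod>b\<leftarrow>bs. pweight Q [] b)"
    and "last (u # join_blocks u bs) \<in> FP"
    and "bs \<noteq> [] \<Longrightarrow> wt (last (u # join_blocks u bs)) = Some (alt_type i (length bs - 1))"
proof -
  have "pweight Q u (join_blocks u bs) = (\<Prod>b\<leftarrow>bs. pweight Q [] b) \<and> last (u # join_blocks u bs) \<in> FP \<and>
    (bs \<noteq> [] \<longrightarrow> wt (last (u # join_blocks u bs)) = Some (alt_type i (length bs - 1)))"
    using assms
  proof (induction bs arbitrary: i u)
    case (Cons b bs)
    have b: "b \<noteq> []" "set b \<subseteq> branch i" "length (last b) = 1" and alt: "alternating (opp i) bs"
      using Cons.prems(2) by (auto simp: blocks_def)
    have lb: "last b \<in> branch i" using b last_in_set[of b] by auto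
    obtain v where v: "last b = [v]" "v \<in> N i" by (rule length1_branch[OF lb b(3)])
    let ?u = "u @ last b"
    have u: "?u \<in> FP" by (rule FP_append_branch[OF Cons.prems(3,4) lb Cons.prems(1)])
    have wtu: "wt ?u = Some i" using v wt_singleton[OF v(2) Cons.prems(1)] by (simp add: wt_last)
    have wtu': "wt ?u \<noteq> Some (opp i)" using wtu Cons.prems(1) by (auto simp: opp_def)
    note IH = Cons.IH[OF opp_in[OF Cons.prems(1)] alt u wtu']
    have l1: "last (u # map ((@) u) b) = ?u" using b(1) by (simp add: last_map)
    have l: "last (u # join_blocks u (b # bs)) = last (?u # join_blocks ?u bs)"
      using b(1) by (cases "join_blocks ?u bs = []") (auto simp: last_map)
    have "pweight Q u (map ((@) u) b) = pweight Q [] b"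
      using pweight_translate[OF Cons.prems(3,4,1), of "[]" b] b(2) by auto
    then have w: "pweight Q u (join_blocks u (b # bs)) = (\<Prod>b\<leftarrow>b # bs. pweight Q [] b)"
      using IH l1 by (simp add: pweight_append del: last.simps)
    have "wt (last (u # join_blocks u (b # bs))) = Some (alt_type i (length (b # bs) - 1))"
    proof (cases "bs = []")
      case True
      then show ?thesis unfolding l using wtu by (simp add: alt_type_def)
    next
      case False
      then obtain m where m: "length bs = Suc m" by (cases bs) auto
      have "alt_type (opp i) m = alt_type i (Suc m)" using Cons.prems(1) by (simp add: alt_type_def)
      then show ?thesis unfolding l using IH False m by simp
    qed
    then show ?case using w IH unfolding l by simp
  qed simp
  then show "pweight Q u (join_blocks u bs) = (\<Prod>b\<leftarrow>bs. pweight Q [] b)" "last (u # join_blocks u bs) \<in> FP"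
    "bs \<noteq> [] \<Longrightarrow> wt (last (u # join_blocks u bs)) = Some (alt_type i (length bs - 1))" by blast+
qed

end

context random_walk begin

text \<open>The probability that the walk never leaves branch \<open>j\<close> after time \<open>0\<close>.\<close>
definition escape :: "nat \<Rightarrow> ennreal" where
  "escape j = emeasure M {\<omega>\<in>space M. \<forall>n. set (walked n \<omega>) \<subseteq> branch j}"

lemma walked_mono: "set (walked n \<omega>) \<subseteq> set (walked (n + m) \<omega>)"
  unfolding set_seg by auto

lemma stay_tendsto:
  "(\<lambda>K. emeasure M {\<omega>\<in>space M. walked K \<omega> \<in> {t. set t \<subseteq> branch j}}) \<longlonglongrightarrow> escape j"
proof -
  let ?A = "\<lambda>K. {\<omega>\<in>space M. walked K \<omega> \<in> {t. set t \<subseteq> branch j}}"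
  have "(\<lambda>K. emeasure M (?A K)) \<longlonglongrightarrow> emeasure M (\<Inter>K. ?A K)"
  proof (rule Lim_emeasure_decseq)
    show "range ?A \<subseteq> sets M" by (rule image_subsetI) (rule seg_event)
    show "decseq ?A"
    proof (rule decseq_SucI, rule subsetI)
      fix n \<omega> assume "\<omega> \<in> ?A (Suc n)"
      then have "\<omega> \<in> space M" "set (walked (Suc n) \<omega>) \<subseteq> branch j" by simp_all
      moreover have "set (walked n \<omega>) \<subseteq> set (walked (Suc n) \<omega>)" using walked_mono[where n=n and m=1] by simp
      ultimately show "\<omega> \<in> ?A n" by (simp add: subset_trans)
    qed
  qed simp
  also have "(\<Inter>K. ?A K) = {\<omega>\<in>space M. \<forall>n. set (walked n \<omega>) \<subseteq> branch j}" by auto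
  finally show ?thesis unfolding escape_def .
qed

lemma above_cut_mass:
  assumes i: "i \<in> {1,2}" and u: "u \<in> FP" "wt u = Some i"
  shows "msum (pweight Q u) {t. length t = K \<and> (\<forall>y\<in>set t. length u < length y)}
    = emeasure M {\<omega>\<in>space M. walked K \<omega> \<in> {t. set t \<subseteq> branch (opp i)}}"
proof -
  let ?T = "{t. length t = K \<and> (\<forall>y\<in>set t. length u < length y)}"
  let ?S = "{t\<in>{t. set t \<subseteq> branch (opp i)}. length t = K}"
  have u': "wt u \<noteq> Some (opp i)" using u(2) i by (auto simp: opp_def)
  have sub: "map ((@) u) ` ?S \<subseteq> ?T" using branch_ne by fastforce
  have "msum (pweight Q u) ?T = msum (pweight Q u) (map ((@) u) ` ?S)"
  proof (rule nn_integral_count_space_eq)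
    fix t assume t: "t \<in> ?T - map ((@) u) ` ?S"
    show "pweight Q u t = 0"
    proof (rule ccontr)
      assume nz: "pweight Q u t \<noteq> 0"
      have "t \<noteq> []"
      proof
        assume "t = []"
        then have "t \<in> map ((@) u) ` ?S" using t by (intro image_eqI[of _ _ "[]"]) auto
        then show False using t by simp
      qed
      then obtain j t' where j: "j \<in> {1,2}" "wt u \<noteq> Some j" "set t' \<subseteq> branch j" "t = map ((@) u) t'"
        using path_above_cut[OF nz u(1)] t by blast
      then have "j = opp i" using opp_neq[OF i j(1)] u(2) by blast
      then have "t \<in> map ((@) u) ` ?S" using j t by (intro image_eqI[of _ _ t']) auto
      then show False using t by simp
    qed
  qed (use sub in blast)
  also have "\<dots> = msum (\<lambda>t. pweight Q u (map ((@) u) t)) ?S"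
    by (rule msum_reindex) (auto simp: inj_on_def intro: map_injective)
  also have "\<dots> = msum (pweight Q []) ?S"
  proof (rule msum_cong)
    fix t assume "t \<in> ?S"
    then show "pweight Q u (map ((@) u) t) = pweight Q [] t"
      using pweight_translate[OF u(1) u' opp_in[OF i], of "[]" t] by auto
  qed
  also have "\<dots> = emeasure M {\<omega>\<in>space M. walked K \<omega> \<in> {t. set t \<subseteq> branch (opp i)}}"
    by (rule path_prob[symmetric])
  finally show ?thesis .
qed

text \<open>The Markov property at the end \<open>u\<close> of \<open>s\<close>. Staying above \<open>u\<close> means staying in the one branch at \<open>u\<close>
that extends the word, which is a translate of branch \<open>opp i\<close>.\<close>
lemma last_exit_prob:
  assumes i: "i \<in> {1,2}" and u: "last ([] # s) \<in> FP" "wt (last ([] # s)) = Some i"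
  shows "emeasure M {\<omega>\<in>space M. walked (length s) \<omega> = s \<and> (\<forall>n>length s. length (last ([] # s)) < length (X n \<omega>))}
    = pweight Q [] s * escape (opp i)"
proof -
  let ?u = "last ([] # s)" and ?N = "length s"
  let ?T = "\<lambda>K. {t. length t = K \<and> (\<forall>y\<in>set t. length ?u < length y)}"
  let ?B = "\<lambda>K. (\<lambda>t. s @ t) ` ?T K"
  \<comment> \<open>the walk follows \<open>s\<close> and stays above its end for \<open>K\<close> further steps\<close>
  let ?A = "\<lambda>K. {\<omega>\<in>space M. walked (?N + K) \<omega> \<in> ?B K}"
  have A_iff: "\<omega> \<in> ?A K \<longleftrightarrow> \<omega> \<in> space M \<and> walked ?N \<omega> = s \<and> (\<forall>n. ?N < n \<and> n \<le> ?N + K \<longrightarrow> length ?u < length (X n \<omega>))" for \<omega> K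
  proof -
    have "walked (?N + K) \<omega> = walked ?N \<omega> @ seg (traj \<omega>) ?N (?N + K)"
      by (rule seg_append[symmetric]) auto
    then have "walked (?N + K) \<omega> \<in> ?B K \<longleftrightarrow> walked ?N \<omega> = s \<and> seg (traj \<omega>) ?N (?N + K) \<in> ?T K"
      by (auto simp: image_iff)
    also have "seg (traj \<omega>) ?N (?N + K) \<in> ?T K \<longleftrightarrow> (\<forall>n. ?N < n \<and> n \<le> ?N + K \<longrightarrow> length ?u < length (X n \<omega>))"
      unfolding mem_Collect_eq set_seg by auto
    finally show ?thesis by auto
  qed
  have "emeasure M (?A K) = pweight Q [] s * emeasure M {\<omega>\<in>space M. walked K \<omega> \<in> {t. set t \<subseteq> branch (opp i)}}" for K
  proof -
    have "emeasure M (?A K) = msum (pweight Q []) {t\<in>?B K. length t = ?N + K}" by (rule path_prob)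
    also have "{t\<in>?B K. length t = ?N + K} = ?B K" by auto
    also have "msum (pweight Q []) (?B K) = msum (\<lambda>t. pweight Q [] (s @ t)) (?T K)"
      by (rule msum_reindex) (auto simp: inj_on_def)
    also have "\<dots> = pweight Q [] s * msum (pweight Q ?u) (?T K)"
      by (simp only: pweight_append msum_cmult)
    finally show ?thesis unfolding above_cut_mass[OF i u] .
  qed
  moreover have "pweight Q [] s < \<top>"
    using path_prob_eq[of s, OF refl] emeasure_finite[of "{\<omega>\<in>space M. walked (length s) \<omega> = s}"]
    by (simp add: less_top)
  ultimately have 1: "(\<lambda>K. emeasure M (?A K)) \<longlonglongrightarrow> pweight Q [] s * escape (opp i)"
    using stay_tendsto[of "opp i"] by (simp add: ennreal_tendsto_cmult)
  have "(\<lambda>K. emeasure M (?A K)) \<longlonglongrightarrow> emeasure M (\<Inter>K. ?A K)"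
  proof (rule Lim_emeasure_decseq)
    show "range ?A \<subseteq> sets M" by (rule image_subsetI) (rule seg_event)
    show "decseq ?A" by (rule decseq_SucI, rule subsetI) (simp only: A_iff, simp)
  qed simp
  then have "emeasure M (\<Inter>K. ?A K) = pweight Q [] s * escape (opp i)"
    using 1 by (rule LIMSEQ_unique)
  also have "(\<Inter>K. ?A K) = {\<omega>\<in>space M. walked ?N \<omega> = s \<and> (\<forall>n>?N. length ?u < length (X n \<omega>))}"
  proof (rule set_eqI)
    fix \<omega>
    have "\<omega> \<in> (\<Inter>K. ?A K) \<longleftrightarrow> \<omega> \<in> space M \<and> walked ?N \<omega> = s \<and> (\<forall>K n. ?N < n \<and> n \<le> ?N + K \<longrightarrow> length ?u < length (X n \<omega>))"
      unfolding INT_iff A_iff by auto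
    moreover have "(\<forall>K n. ?N < n \<and> n \<le> ?N + K \<longrightarrow> P n) \<longleftrightarrow> (\<forall>n>?N. P n)" for P
      by (metis le_add2)
    ultimately show "\<omega> \<in> (\<Inter>K. ?A K) \<longleftrightarrow> \<omega> \<in> {\<omega>\<in>space M. walked ?N \<omega> = s \<and> (\<forall>n>?N. length ?u < length (X n \<omega>))}"
      by auto
  qed
  finally show ?thesis .
qed

lemma exit_time_measurable [measurable]: "(\<lambda>\<omega>. exit_time k (traj \<omega>)) \<in> M \<rightarrow>\<^sub>M count_space UNIV"
proof -
  have [measurable]: "Measurable.pred M (\<lambda>\<omega>. k < length (X n \<omega>))" for n
    by (rule measurable_compose[OF X_measurable]) simp
  show ?thesis unfolding exit_time_def by measurable
qed

lemma random_seg_measurable: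
  assumes [measurable]: "a \<in> M \<rightarrow>\<^sub>M count_space (UNIV :: nat set)" "b \<in> M \<rightarrow>\<^sub>M count_space (UNIV :: nat set)"
  shows "(\<lambda>\<omega>. seg (traj \<omega>) (a \<omega>) (b \<omega>)) \<in> M \<rightarrow>\<^sub>M count_space UNIV"
proof (rule measurable_countable_rangeI[OF countable_lists_FP seg_lists])
  fix t
  have [measurable]: "Measurable.pred M (\<lambda>\<omega>. seg (traj \<omega>) i j = t)" for i j
    by (rule measurable_compose[OF seg_measurable]) simp
  have "{\<omega>\<in>space M. seg (traj \<omega>) (a \<omega>) (b \<omega>) = t} = {\<omega>\<in>space M. \<exists>i j. a \<omega> = i \<and> b \<omega> = j \<and> seg (traj \<omega>) i j = t}" by auto
  also have "\<dots> \<in> sets M" by measurable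
  finally show "{\<omega>\<in>space M. seg (traj \<omega>) (a \<omega>) (b \<omega>) = t} \<in> sets M" .
qed

definition block_at :: "nat \<Rightarrow> 'w \<Rightarrow> 'a list list" where
  "block_at k \<omega> = blk k (traj \<omega>)"

definition start_path :: "'w \<Rightarrow> 'a list list" where
  "start_path \<omega> = walked (exit_time 0 (traj \<omega>)) \<omega>"

lemma block_at_measurable [measurable]: "block_at k \<in> M \<rightarrow>\<^sub>M count_space UNIV"
  unfolding block_at_def[abs_def] blk_def
  by (rule measurable_compose[OF random_seg_measurable]) simp_all

lemma start_path_measurable [measurable]: "start_path \<in> M \<rightarrow>\<^sub>M count_space UNIV"
  unfolding start_path_def[abs_def] by (rule random_seg_measurable) simp_all

lemma block_at_lists: "\<omega> \<in> space M \<Longrightarrow> block_at k \<omega> \<in> lists FP"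
proof -
  assume w: "\<omega> \<in> space M"
  have "drop k x \<in> FP" if "x \<in> FP" for x
    using that FP_appendD(2)[of "take k x" "drop k x"] by simp
  moreover have "y \<in> FP" if "y \<in> set (seg (traj \<omega>) a b)" for y a b
    using seg_lists[OF w, of a b] that by (auto simp: in_lists_conv_set)
  ultimately show ?thesis unfolding block_at_def blk_def by (simp add: in_lists_conv_set)
qed

lemma decomposition_prob:
  assumes s: "s \<in> returns" and i: "i \<in> {1,2}" and alt: "alternating i bs" and ne: "bs \<noteq> []"
  shows "emeasure M {\<omega>\<in>space M. start_path \<omega> = s \<and> (\<forall>k<length bs. block_at k \<omega> = bs ! k)}
    = pweight Q [] s * (\<Prod>b\<leftarrow>bs. pweight Q [] b) * escape (opp (alt_type i (length bs - 1)))"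
proof -
  let ?p = "s @ join_blocks [] bs"
  have ls: "last ([] # s) = []" using s by (simp add: returns_def)
  have lp: "last ([] # ?p) = last ([] # join_blocks [] bs)"
    using ls by (cases "join_blocks [] bs = []") auto
  have wNil: "wt [] \<noteq> Some i" by simp
  note cw = cat_weight[OF i alt Nil_FP wNil]
  have pw: "pweight Q [] ?p = pweight Q [] s * (\<Prod>b\<leftarrow>bs. pweight Q [] b)"
    using cw(1) ls by (simp only: pweight_append)
  have len: "length (last ([] # ?p)) = length bs"
    unfolding lp using length_cat_end[OF alt, of "[]"] by simp
  have "emeasure M {\<omega>\<in>space M. start_path \<omega> = s \<and> (\<forall>k<length bs. block_at k \<omega> = bs ! k)}
    = emeasure M {\<omega>\<in>space M. walked (length ?p) \<omega> = ?p \<and> (\<forall>n>length ?p. length (last ([] # ?p)) < length (X n \<omega>))}"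
  proof (rule emeasure_eq_AE)
    show "AE \<omega> in M. (\<omega> \<in> {\<omega>\<in>space M. start_path \<omega> = s \<and> (\<forall>k<length bs. block_at k \<omega> = bs ! k)})
      = (\<omega> \<in> {\<omega>\<in>space M. walked (length ?p) \<omega> = ?p \<and> (\<forall>n>length ?p. length (last ([] # ?p)) < length (X n \<omega>))})"
      using trajectory_good
    proof eventually_elim
      case (elim \<omega>)
      show ?case
        using decomposition_iff[OF elim s alt] unfolding len start_path_def block_at_def by blast
    qed
    have [measurable]: "Measurable.pred M (\<lambda>\<omega>. start_path \<omega> = s)" "Measurable.pred M (\<lambda>\<omega>. block_at k \<omega> = b)"
      "Measurable.pred M (\<lambda>\<omega>. walked n \<omega> = t)" "Measurable.pred M (\<lambda>\<omega>. m < length (X n \<omega>))" for k b n t m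
      by (rule measurable_compose[OF start_path_measurable] measurable_compose[OF block_at_measurable]
          measurable_compose[OF seg_measurable] measurable_compose[OF X_measurable]; simp)+
    show "{\<omega>\<in>space M. start_path \<omega> = s \<and> (\<forall>k<length bs. block_at k \<omega> = bs ! k)} \<in> sets M" by measurable
    show "{\<omega>\<in>space M. walked (length ?p) \<omega> = ?p \<and> (\<forall>n>length ?p. length (last ([] # ?p)) < length (X n \<omega>))} \<in> sets M" by measurable
  qed
  also have "\<dots> = pweight Q [] ?p * escape (opp (alt_type i (length bs - 1)))"
  proof (rule last_exit_prob[OF alt_type_in[OF i]])
    show "last ([] # ?p) \<in> FP" unfolding lp by (rule cw(2))
    show "wt (last ([] # ?p)) = Some (alt_type i (length bs - 1))" unfolding lp by (rule cw(3)[OF ne])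
  qed
  finally show ?thesis unfolding pw .
qed

end

section \<open>Pairs of blocks are independent\<close>

context random_walk begin

definition pairs :: "('a list list \<times> 'a list list) set" where
  "pairs = blocks 1 \<times> blocks 2"

definition pair_weight :: "'a list list \<times> 'a list list \<Rightarrow> ennreal" where
  "pair_weight z = pweight Q [] (fst z) * pweight Q [] (snd z)"

text \<open>The types of the blocks alternate, but the type of the first one is random. Two consecutive blocks
are therefore listed by type, so that the law of a pair does not depend on that choice.\<close>
definition pair_at :: "nat \<Rightarrow> 'w \<Rightarrow> 'a list list \<times> 'a list list" where
  "pair_at k \<omega> = (if block_at (2 * k) \<omega> \<in> blocks 1 then (block_at (2 * k) \<omega>, block_at (2 * k + 1) \<omega>)
     else (block_at (2 * k + 1) \<omega>, block_at (2 * k) \<omega>))"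

text \<open>The \<open>k\<close>-th block that underlies the pairs \<open>zs\<close> if the first block has type \<open>i\<close>.\<close>
definition pick :: "nat \<Rightarrow> (nat \<Rightarrow> 'a list list \<times> 'a list list) \<Rightarrow> nat \<Rightarrow> 'a list list" where
  "pick i zs k = (if even k = (i = 1) then fst (zs (k div 2)) else snd (zs (k div 2)))"

lemma blocks_disjoint: "b \<in> blocks 1 \<Longrightarrow> b \<notin> blocks 2"
proof
  assume b: "b \<in> blocks 1" "b \<in> blocks 2"
  then have "hd b \<in> branch 1" "hd b \<in> branch 2" using hd_in_set[of b] by (auto simp: blocks_def)
  then show False using branch_disjoint by blast
qed

lemma pick_even_odd:
  "pick 1 zs (2 * q) = fst (zs q)" "pick 1 zs (2 * q + 1) = snd (zs q)"
  "pick 2 zs (2 * q) = snd (zs q)" "pick 2 zs (2 * q + 1) = fst (zs q)"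
  by (simp_all add: pick_def)

lemma all_less_double: "(\<forall>k<2 * m. P k) \<longleftrightarrow> (\<forall>q<m. P (2 * q) \<and> P (2 * q + 1))" for m :: nat
proof
  assume h: "\<forall>q<m. P (2 * q) \<and> P (2 * q + 1)"
  show "\<forall>k<2 * m. P k"
  proof (intro allI impI)
    fix k assume "k < 2 * m"
    then have "k div 2 < m" by simp
    then have "P (2 * (k div 2)) \<and> P (2 * (k div 2) + 1)" using h by blast
    then show "P k" by (cases "even k") (auto elim!: evenE oddE)
  qed
qed auto

lemma pick_alternating:
  assumes i: "i \<in> {1,2}" and zs: "\<And>k. k < m \<Longrightarrow> zs k \<in> pairs"
  shows "alternating i (map (pick i zs) [0..<2 * m])"
proof -
  have "\<forall>q<m. pick i zs (2 * q) \<in> blocks (alt_type i (2 * q)) \<and> pick i zs (2 * q + 1) \<in> blocks (alt_type i (2 * q + 1))"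
    using i zs by (auto simp: pick_def alt_type_def pairs_def opp_def mem_Times_iff)
  then have "\<forall>k<2 * m. pick i zs k \<in> blocks (alt_type i k)" by (simp only: all_less_double)
  then show ?thesis by (simp add: alternating_iff[OF i])
qed

lemma pick_weight:
  assumes i: "i \<in> {1,2}"
  shows "(\<Prod>b\<leftarrow>map (pick i zs) [0..<2 * m]. pweight Q [] b) = (\<Prod>k<m. pair_weight (zs k))"
proof (induction m)
  case (Suc m)
  have "[0..<2 * Suc m] = [0..<2 * m] @ [2 * m, 2 * m + 1]" by simp
  moreover have "pweight Q [] (pick i zs (2 * m)) * pweight Q [] (pick i zs (2 * m + 1)) = pair_weight (zs m)"
    using i by (auto simp: pick_def pair_weight_def mult.commute)
  ultimately show ?case using Suc by (simp add: mult.assoc del: upt_Suc)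
qed simp

lemma pair_at_iff:
  assumes g: "good (traj \<omega>)" and zs: "\<And>k. k < m \<Longrightarrow> zs k \<in> pairs"
  shows "(\<forall>k<m. pair_at k \<omega> = zs k) \<longleftrightarrow> (\<exists>i\<in>{1,2}. \<forall>k<2 * m. block_at k \<omega> = pick i zs k)"
proof
  assume h: "\<forall>k<m. pair_at k \<omega> = zs k"
  obtain i where i: "i \<in> {1,2}" "\<And>k. blk k (traj \<omega>) \<in> blocks (alt_type i k)"
    using blk_alternate[OF g] by blast
  then have b: "block_at (2 * q) \<omega> \<in> blocks i" for q
    using i(2)[of "2 * q"] by (simp add: block_at_def alt_type_def)
  have "block_at (2 * q) \<omega> = pick i zs (2 * q) \<and> block_at (2 * q + 1) \<omega> = pick i zs (2 * q + 1)" if q: "q < m" for q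
  proof -
    have z: "zs q = pair_at q \<omega>" using h q by simp
    consider "i = 1" | "i = 2" using i(1) by blast
    then show ?thesis
    proof cases
      case 1
      then have "block_at (2 * q) \<omega> \<in> blocks 1" using b by simp
      then have "zs q = (block_at (2 * q) \<omega>, block_at (2 * q + 1) \<omega>)" using z by (simp add: pair_at_def)
      then show ?thesis unfolding 1 pick_even_odd by simp
    next
      case 2
      then have "block_at (2 * q) \<omega> \<notin> blocks 1" using b blocks_disjoint by blast
      then have "zs q = (block_at (2 * q + 1) \<omega>, block_at (2 * q) \<omega>)" using z by (simp add: pair_at_def)
      then show ?thesis unfolding 2 pick_even_odd by simp
    qed
  qed
  then have "\<forall>k<2 * m. block_at k \<omega> = pick i zs k" unfolding all_less_double by blast
  then show "\<exists>i\<in>{1,2}. \<forall>k<2 * m. block_at k \<omega> = pick i zs k" using i(1) by blast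
next
  assume "\<exists>i\<in>{1,2}. \<forall>k<2 * m. block_at k \<omega> = pick i zs k"
  then obtain i where i: "i \<in> {1,2}" "\<forall>k<2 * m. block_at k \<omega> = pick i zs k" by blast
  show "\<forall>k<m. pair_at k \<omega> = zs k"
  proof (intro allI impI)
    fix q assume q: "q < m"
    have b: "block_at (2 * q) \<omega> = pick i zs (2 * q)" "block_at (2 * q + 1) \<omega> = pick i zs (2 * q + 1)"
      using i(2) q by auto
    have z: "fst (zs q) \<in> blocks 1" "snd (zs q) \<in> blocks 2" using zs[OF q] by (auto simp: pairs_def)
    have z2: "snd (zs q) \<notin> blocks 1" using z(2) blocks_disjoint by blast
    consider "i = 1" | "i = 2" using i(1) by blast
    then show "pair_at q \<omega> = zs q"
    proof cases
      case 1
      then show ?thesis unfolding pair_at_def b unfolding 1 pick_even_odd using z by simp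
    next
      case 2
      then show ?thesis unfolding pair_at_def b unfolding 2 pick_even_odd using z2 by simp
    qed
  qed
qed

lemma pair_at_in: "good (traj \<omega>) \<Longrightarrow> pair_at k \<omega> \<in> pairs"
proof -
  assume g: "good (traj \<omega>)"
  obtain i where i: "i \<in> {1,2}" "\<And>k. blk k (traj \<omega>) \<in> blocks (alt_type i k)"
    using blk_alternate[OF g] by blast
  have "block_at (2 * k) \<omega> \<in> blocks i" "block_at (2 * k + 1) \<omega> \<in> blocks (opp i)"
    using i(2)[of "2 * k"] i(2)[of "2 * k + 1"] by (simp_all add: block_at_def alt_type_def)
  then show ?thesis using i(1) blocks_disjoint by (auto simp: pair_at_def pairs_def opp_def)
qed

lemma pair_at_lists: "\<omega> \<in> space M \<Longrightarrow> pair_at k \<omega> \<in> lists FP \<times> lists FP"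
  using block_at_lists unfolding pair_at_def by (auto simp del: in_lists_conv_set)

lemma pair_at_measurable [measurable]: "pair_at k \<in> M \<rightarrow>\<^sub>M count_space UNIV"
proof (rule measurable_countable_rangeI[OF _ pair_at_lists])
  show "countable (lists FP \<times> lists FP)" using countable_lists_FP by simp
  fix z
  have [measurable]: "Measurable.pred M (\<lambda>\<omega>. block_at k \<omega> = b)" "Measurable.pred M (\<lambda>\<omega>. block_at k \<omega> \<in> B)" for k b B
    by (rule measurable_compose[OF block_at_measurable]; simp)+
  have "{\<omega>\<in>space M. pair_at k \<omega> = z} = {\<omega>\<in>space M. if block_at (2 * k) \<omega> \<in> blocks 1
      then block_at (2 * k) \<omega> = fst z \<and> block_at (2 * k + 1) \<omega> = snd z
      else block_at (2 * k + 1) \<omega> = fst z \<and> block_at (2 * k) \<omega> = snd z}"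
    unfolding pair_at_def by (cases z) auto
  also have "\<dots> \<in> sets M" by measurable
  finally show "{\<omega>\<in>space M. pair_at k \<omega> = z} \<in> sets M" .
qed

text \<open>The mass of the initial returns times that of the final escapes. It is shown to be \<open>1\<close> in
\<open>law_normalized\<close>.\<close>
definition law_const :: ennreal where
  "law_const = msum (wp 1 []) returns * (escape 1 + escape 2)"

text \<open>Summing over the initial path and over the type \<open>i\<close> of the first block. An even number of blocks ends
with type \<open>opp i\<close>, so the final escape goes through branch \<open>i\<close>; these factors do not depend on the
blocks.\<close>
lemma pair_prob:
  assumes m: "1 \<le> m" and zs: "\<And>k. k < m \<Longrightarrow> zs k \<in> pairs"
  shows "emeasure M {\<omega>\<in>space M. \<forall>k<m. pair_at k \<omega> = zs k} = law_const * (\<Prod>k<m. pair_weight (zs k))"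
proof -
  let ?R = "returns \<inter> lists FP"
  let ?J = "?R \<times> {1,2::nat}"
  let ?W = "\<Prod>k<m. pair_weight (zs k)"
  let ?bs = "\<lambda>i. map (pick i zs) [0..<2 * m]"
  define E where "E = (\<lambda>(s, i). {\<omega>\<in>space M. start_path \<omega> = s \<and> (\<forall>k<2 * m. block_at k \<omega> = pick i zs k)})"
  have [measurable]: "Measurable.pred M (\<lambda>\<omega>. start_path \<omega> = s)" "Measurable.pred M (\<lambda>\<omega>. block_at k \<omega> = b)"
     "Measurable.pred M (\<lambda>\<omega>. pair_at k \<omega> = z)" for s k b z
    by (rule measurable_compose[OF start_path_measurable] measurable_compose[OF block_at_measurable]
       measurable_compose[OF pair_at_measurable]; simp)+
  have Esets: "E x \<in> sets M" for x unfolding E_def by (cases x) simp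
  have cJ: "countable ?J"
    by (intro countable_SIGMA countable_subset[OF _ countable_lists_FP]) auto
  have pos: "0 < 2 * m" using m by simp
  have "emeasure M {\<omega>\<in>space M. \<forall>k<m. pair_at k \<omega> = zs k} = emeasure M (\<Union>(E ` ?J))"
  proof (rule emeasure_eq_AE)
    show "AE \<omega> in M. (\<omega> \<in> {\<omega>\<in>space M. \<forall>k<m. pair_at k \<omega> = zs k}) = (\<omega> \<in> \<Union>(E ` ?J))"
      using trajectory_good AE_space
    proof eventually_elim
      case (elim \<omega>)
      have "last ([] # start_path \<omega>) = X (exit_time 0 (traj \<omega>)) \<omega>"
        unfolding start_path_def using elim(1) by (intro last_path) (simp add: good_def)
      then have "start_path \<omega> \<in> returns"
        using exit_time_length[OF elim(1), of 0] by (simp add: returns_def)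
      then have sR: "start_path \<omega> \<in> ?R" using seg_lists[OF elim(2)] by (simp add: start_path_def)
      have e: "\<omega> \<in> \<Union>(E ` ?J) \<longleftrightarrow> (\<exists>i\<in>{1,2}. \<forall>k<2 * m. block_at k \<omega> = pick i zs k)"
      proof
        assume "\<omega> \<in> \<Union>(E ` ?J)"
        then obtain s i where "i \<in> {1,2::nat}" "\<omega> \<in> E (s, i)" by blast
        then show "\<exists>i\<in>{1,2}. \<forall>k<2 * m. block_at k \<omega> = pick i zs k"
          unfolding E_def by (intro bexI[of _ i]) simp_all
      next
        assume "\<exists>i\<in>{1,2}. \<forall>k<2 * m. block_at k \<omega> = pick i zs k"
        then obtain i where i: "i \<in> {1,2}" "\<forall>k<2 * m. block_at k \<omega> = pick i zs k" by blast
        have "\<omega> \<in> E (start_path \<omega>, i)" using elim(2) i(2) by (simp add: E_def)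
        moreover have "(start_path \<omega>, i) \<in> ?J" using sR i(1) by simp
        ultimately show "\<omega> \<in> \<Union>(E ` ?J)" by (rule UN_I[rotated])
      qed
      have "(\<forall>k<m. pair_at k \<omega> = zs k) \<longleftrightarrow> (\<exists>i\<in>{1,2}. \<forall>k<2 * m. block_at k \<omega> = pick i zs k)"
        by (rule pair_at_iff[OF elim(1)]) (rule zs)
      then show ?case unfolding e mem_Collect_eq using elim(2) by simp
    qed
    show "{\<omega>\<in>space M. \<forall>k<m. pair_at k \<omega> = zs k} \<in> sets M" by measurable
    show "\<Union>(E ` ?J) \<in> sets M" by (rule sets.countable_UN'[OF cJ]) (use Esets in blast)
  qed
  also have "\<dots> = (\<integral>\<^sup>+x. emeasure M (E x) \<partial>count_space ?J)"
  proof (rule emeasure_UN_countable[OF Esets cJ])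
    show "disjoint_family_on E ?J"
      unfolding disjoint_family_on_def
    proof (intro ballI impI)
      fix x y assume xy: "x \<in> ?J" "y \<in> ?J" "x \<noteq> y"
      obtain s i s' i' where [simp]: "x = (s, i)" "y = (s', i')" by (cases x, cases y)
      have p: "pick 1 zs 0 \<in> blocks 1" "pick 2 zs 0 \<in> blocks 2"
        using zs[of 0] m by (auto simp: pick_def pairs_def)
      have "pick 1 zs 0 \<noteq> pick 2 zs 0"
      proof
        assume "pick 1 zs 0 = pick 2 zs 0"
        then show False using p(2) blocks_disjoint[OF p(1)] by simp
      qed
      moreover have "i = 1 \<or> i = 2" "i' = 1 \<or> i' = 2" using xy(1,2) by simp_all
      ultimately have pn: "i \<noteq> i' \<Longrightarrow> pick i zs 0 \<noteq> pick i' zs 0" by (elim disjE) simp_all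
      show "E x \<inter> E y = {}"
      proof (rule ccontr)
        assume "E x \<inter> E y \<noteq> {}"
        then obtain \<omega> where w: "\<omega> \<in> E x" "\<omega> \<in> E y" by blast
        have "start_path \<omega> = s" "block_at 0 \<omega> = pick i zs 0" using w(1) pos by (simp_all add: E_def)
        moreover have "start_path \<omega> = s'" "block_at 0 \<omega> = pick i' zs 0" using w(2) pos by (simp_all add: E_def)
        ultimately have "s = s'" "pick i zs 0 = pick i' zs 0" by simp_all
        then show False using pn xy(3) by (cases "i = i'") simp_all
      qed
    qed
  qed
  also have "\<dots> = msum (\<lambda>(s, i). (pweight Q [] s * ?W) * escape i) ?J"
  proof (rule msum_cong)
    fix x assume x: "x \<in> ?J"
    then obtain s i where xe: "x = (s, i)" "s \<in> returns" "i \<in> {1,2}" by auto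
    have "E x = {\<omega>\<in>space M. start_path \<omega> = s \<and> (\<forall>k<length (?bs i). block_at k \<omega> = ?bs i ! k)}"
      unfolding E_def xe(1) by simp
    then have "emeasure M (E x) = pweight Q [] s * (\<Prod>b\<leftarrow>?bs i. pweight Q [] b) * escape (opp (alt_type i (length (?bs i) - 1)))"
      using decomposition_prob[OF xe(2,3) pick_alternating[OF xe(3) zs], of m] m by simp
    moreover have "opp (alt_type i (length (?bs i) - 1)) = i"
      using m xe(3) by (auto simp: alt_type_def opp_def)
    ultimately show "emeasure M (E x) = (case x of (s, i) \<Rightarrow> (pweight Q [] s * ?W) * escape i)"
      unfolding xe(1) pick_weight[OF xe(3)] by simp
  qed
  also have "\<dots> = msum (\<lambda>s. pweight Q [] s * ?W) ?R * msum escape {1,2}" by (rule msum_Times)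
  also have "\<dots> = msum (pweight Q []) ?R * ?W * (escape 1 + escape 2)"
    by (simp add: msum_multc nn_integral_count_space_finite)
  also have "msum (pweight Q []) ?R = msum (wp 1 []) returns"
    unfolding wp_1
  proof (rule nn_integral_count_space_eq)
    fix s assume "s \<in> returns - ?R"
    then have "\<not> set s \<subseteq> FP" by auto
    then show "pweight Q [] s = 0" using pweight_FP[of "[]" s] Nil_FP by blast
  qed auto
  finally show ?thesis by (simp add: law_const_def ac_simps)
qed

definition pair_mass :: "('a list list \<times> 'a list list) set \<Rightarrow> ennreal" where
  "pair_mass A = msum pair_weight (A \<inter> pairs)"

lemma pair_mass_lists: "msum pair_weight (A \<inter> (pairs \<inter> lists FP \<times> lists FP)) = pair_mass A"
  unfolding pair_mass_def
proof (rule nn_integral_count_space_eq)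
  fix z assume z: "z \<in> A \<inter> pairs - A \<inter> (pairs \<inter> lists FP \<times> lists FP)"
  then have "\<not> set (fst z) \<subseteq> FP \<or> \<not> set (snd z) \<subseteq> FP" by (cases z) auto
  then have "pweight Q [] (fst z) = 0 \<or> pweight Q [] (snd z) = 0"
    using pweight_FP[of "[]"] Nil_FP by blast
  then show "pair_weight z = 0" by (auto simp: pair_weight_def)
qed auto

lemma pair_law_const:
  assumes m: "1 \<le> m"
  shows "emeasure M {\<omega>\<in>space M. \<forall>k<m. pair_at k \<omega> \<in> A k} = law_const * (\<Prod>k<m. pair_mass (A k))"
proof -
  let ?P = "pairs \<inter> lists FP \<times> lists FP"
  let ?L = "{l. length l = m \<and> (\<forall>k<m. l ! k \<in> A k \<inter> ?P)}"
  define E where "E l = {\<omega>\<in>space M. \<forall>k<m. pair_at k \<omega> = l ! k}" for l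
  have [measurable]: "Measurable.pred M (\<lambda>\<omega>. pair_at k \<omega> = z)" "Measurable.pred M (\<lambda>\<omega>. pair_at k \<omega> \<in> B)" for k z B
    by (rule measurable_compose[OF pair_at_measurable]; simp)+
  have Esets: "E l \<in> sets M" for l unfolding E_def by measurable
  have cL: "countable ?L"
  proof (rule countable_subset)
    show "?L \<subseteq> lists (lists FP \<times> lists FP)"
    proof
      fix l assume l: "l \<in> ?L"
      have "set l \<subseteq> lists FP \<times> lists FP"
      proof
        fix x assume "x \<in> set l"
        then obtain k where "k < length l" "x = l ! k" by (metis in_set_conv_nth)
        then show "x \<in> lists FP \<times> lists FP" using l by blast
      qed
      then show "l \<in> lists (lists FP \<times> lists FP)" unfolding lists_eq_set by blast
    qed
    show "countable (lists (lists FP \<times> lists FP))" using countable_lists_FP by (intro countable_lists) simp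
  qed
  have "emeasure M {\<omega>\<in>space M. \<forall>k<m. pair_at k \<omega> \<in> A k} = emeasure M (\<Union>(E ` ?L))"
  proof (rule emeasure_eq_AE)
    show "AE \<omega> in M. (\<omega> \<in> {\<omega>\<in>space M. \<forall>k<m. pair_at k \<omega> \<in> A k}) = (\<omega> \<in> \<Union>(E ` ?L))"
      using trajectory_good AE_space
    proof eventually_elim
      case (elim \<omega>)
      let ?l = "map (\<lambda>k. pair_at k \<omega>) [0..<m]"
      have P: "pair_at k \<omega> \<in> ?P" for k using pair_at_in[OF elim(1)] pair_at_lists[OF elim(2)] by blast
      show ?case
      proof
        assume "\<omega> \<in> {\<omega>\<in>space M. \<forall>k<m. pair_at k \<omega> \<in> A k}"
        then have "?l \<in> ?L" using P by simp
        moreover have "\<omega> \<in> E ?l" using elim(2) by (simp add: E_def)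
        ultimately show "\<omega> \<in> \<Union>(E ` ?L)" by blast
      qed (auto simp: E_def)
    qed
    show "{\<omega>\<in>space M. \<forall>k<m. pair_at k \<omega> \<in> A k} \<in> sets M" by measurable
    show "\<Union>(E ` ?L) \<in> sets M" by (rule sets.countable_UN'[OF cL]) (use Esets in blast)
  qed
  also have "\<dots> = (\<integral>\<^sup>+l. emeasure M (E l) \<partial>count_space ?L)"
  proof (rule emeasure_UN_countable[OF Esets cL])
    show "disjoint_family_on E ?L"
      unfolding disjoint_family_on_def E_def by (auto simp: list_eq_iff_nth_eq)
  qed
  also have "\<dots> = msum (\<lambda>l. law_const * (\<Prod>k<m. pair_weight (l ! k))) ?L"
    unfolding E_def by (intro msum_cong pair_prob[OF m]) auto
  also have "\<dots> = law_const * (\<Prod>k<m. msum pair_weight (A k \<inter> ?P))"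
    unfolding msum_cmult using msum_list_prod[where m=m and w=pair_weight and A="\<lambda>k. A k \<inter> ?P"] by simp
  finally show ?thesis unfolding pair_mass_lists .
qed

text \<open>The total probability computed from one pair and from two pairs gives two equations for the two
unknown constants.\<close>
lemma law_normalized: "law_const = 1" "pair_mass UNIV = 1"
proof -
  have 1: "law_const * pair_mass UNIV = 1" and 2: "law_const * (pair_mass UNIV * pair_mass UNIV) = 1"
    using pair_law_const[of 1 "\<lambda>_. UNIV"] pair_law_const[of 2 "\<lambda>_. UNIV"] emeasure_space_1
    by (simp_all add: numeral_2_eq_2 del: One_nat_def)
  have "law_const * (pair_mass UNIV * pair_mass UNIV) = (law_const * pair_mass UNIV) * pair_mass UNIV"
    by (simp add: mult.assoc)
  then show w: "pair_mass UNIV = 1" using 1 2 by simp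
  show "law_const = 1" using 1 unfolding w by simp
qed

lemma pair_law: "emeasure M {\<omega>\<in>space M. \<forall>k<m. pair_at k \<omega> \<in> A k} = (\<Prod>k<m. pair_mass (A k))"
proof (cases "1 \<le> m")
  case True
  then show ?thesis using pair_law_const[of m A] by (simp add: law_normalized)
next
  case False
  then have "m = 0" by simp
  then show ?thesis using emeasure_space_1 by simp
qed

lemma pair_at_law: "emeasure M {\<omega>\<in>space M. pair_at k \<omega> \<in> B} = pair_mass B"
proof -
  let ?A = "\<lambda>j. if j = k then B else UNIV"
  have "{\<omega>\<in>space M. pair_at k \<omega> \<in> B} = {\<omega>\<in>space M. \<forall>j<Suc k. pair_at j \<omega> \<in> ?A j}" by auto
  then have "emeasure M {\<omega>\<in>space M. pair_at k \<omega> \<in> B} = (\<Prod>j<Suc k. pair_mass (?A j))"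
    using pair_law[of "Suc k" ?A] by simp
  also have "\<dots> = pair_mass B" by (simp add: law_normalized)
  finally show ?thesis .
qed

lemma pairs_indep: "indep_vars (\<lambda>_. count_space UNIV) pair_at UNIV"
  unfolding indep_vars_def2
proof (intro conjI ballI)
  fix k show "random_variable (count_space UNIV) (pair_at k)" by measurable
next
  have ev: "pair_at k -` B \<inter> space M = {\<omega>\<in>space M. pair_at k \<omega> \<in> B}" for k B by auto
  show "indep_sets (\<lambda>i. {pair_at i -` A \<inter> space M |A. A \<in> sets (count_space UNIV)}) UNIV"
  proof (rule indep_setsI)
    fix i show "{pair_at i -` A \<inter> space M |A. A \<in> sets (count_space UNIV)} \<subseteq> events"
      using measurable_sets[OF pair_at_measurable] by auto
  next
    fix A J assume J: "J \<noteq> {}" "J \<subseteq> UNIV" "finite J"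
      and A: "\<forall>j\<in>J. A j \<in> {pair_at j -` B \<inter> space M |B. B \<in> sets (count_space UNIV)}"
    have "\<forall>j\<in>J. \<exists>B. A j = {\<omega>\<in>space M. pair_at j \<omega> \<in> B}" using A ev by auto
    then obtain B where B: "\<And>j. j \<in> J \<Longrightarrow> A j = {\<omega>\<in>space M. pair_at j \<omega> \<in> B j}" by metis
    let ?m = "Suc (Max J)"
    let ?C = "\<lambda>j. if j \<in> J then B j else UNIV"
    have Jm: "J \<subseteq> {..<?m}" using J(3) by (auto simp: less_Suc_eq_le)
    have "(\<Inter>j\<in>J. A j) = {\<omega>\<in>space M. \<forall>j<?m. pair_at j \<omega> \<in> ?C j}"
      using J(1) Jm B by auto
    then have "emeasure M (\<Inter>j\<in>J. A j) = (\<Prod>j<?m. pair_mass (?C j))" using pair_law[of ?m ?C] by simp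
    also have "\<dots> = (\<Prod>j\<in>J. pair_mass (?C j))"
      using Jm by (intro prod.mono_neutral_right) (auto simp: law_normalized)
    also have "\<dots> = (\<Prod>j\<in>J. emeasure M (A j))"
      using B pair_at_law by (intro prod.cong) auto
    finally have "ennreal (prob (\<Inter>j\<in>J. A j)) = ennreal (\<Prod>j\<in>J. prob (A j))"
      by (simp add: emeasure_eq_measure prod_ennreal)
    then show "prob (\<Inter>j\<in>J. A j) = (\<Prod>j\<in>J. prob (A j))"
      by (subst (asm) ennreal_inj) (auto intro: prod_nonneg)
  qed
qed

definition pair_mean :: "('a list list \<times> 'a list list \<Rightarrow> real) \<Rightarrow> ennreal" where
  "pair_mean f = msum (\<lambda>z. pair_weight z * ennreal (f z)) pairs"

lemma pair_distr: "distr M (count_space UNIV) (pair_at k) = density (count_space UNIV) (\<lambda>z. pair_weight z * indicator pairs z)"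
proof (rule measure_eqI)
  fix B assume "B \<in> sets (distr M (count_space UNIV) (pair_at k))"
  have "emeasure (distr M (count_space UNIV) (pair_at k)) B = emeasure M {\<omega>\<in>space M. pair_at k \<omega> \<in> B}"
    by (subst emeasure_distr) (auto intro!: arg_cong[where f="emeasure M"])
  also have "\<dots> = pair_mass B" by (rule pair_at_law)
  also have "\<dots> = (\<integral>\<^sup>+z. pair_weight z * indicator pairs z * indicator B z \<partial>count_space UNIV)"
    unfolding pair_mass_def msum_indicator[of "B \<inter> pairs"]
    by (intro nn_integral_cong) (auto split: split_indicator)
  finally show "emeasure (distr M (count_space UNIV) (pair_at k)) B = emeasure (density (count_space UNIV) (\<lambda>z. pair_weight z * indicator pairs z)) B"
    by (simp add: emeasure_density)
qed simp

lemma pair_nn_integral: "(\<integral>\<^sup>+\<omega>. ennreal (f (pair_at k \<omega>)) \<partial>M) = pair_mean f"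
proof -
  have "(\<integral>\<^sup>+\<omega>. ennreal (f (pair_at k \<omega>)) \<partial>M) = (\<integral>\<^sup>+z. ennreal (f z) \<partial>distr M (count_space UNIV) (pair_at k))"
    by (subst nn_integral_distr) auto
  also have "\<dots> = (\<integral>\<^sup>+z. pair_weight z * indicator pairs z * ennreal (f z) \<partial>count_space UNIV)"
    unfolding pair_distr by (subst nn_integral_density) auto
  also have "\<dots> = pair_mean f"
    unfolding pair_mean_def msum_indicator[of pairs] by (intro nn_integral_cong) (simp add: ac_simps)
  finally show ?thesis .
qed

lemma pair_function_iid:
  fixes f :: "'a list list \<times> 'a list list \<Rightarrow> real"
  shows "indep_vars (\<lambda>_. borel) (\<lambda>k \<omega>. f (pair_at k \<omega>)) UNIV"
    and "distr M borel (\<lambda>\<omega>. f (pair_at k \<omega>)) = distr M borel (\<lambda>\<omega>. f (pair_at 0 \<omega>))"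
proof -
  show "indep_vars (\<lambda>_. borel) (\<lambda>k \<omega>. f (pair_at k \<omega>)) UNIV"
    by (rule indep_vars_compose2[OF pairs_indep]) simp
  have "distr M borel (\<lambda>\<omega>. f (pair_at k \<omega>)) = distr (distr M (count_space UNIV) (pair_at k)) borel f" for k
    by (subst distr_distr) (auto simp: comp_def)
  then show "distr M borel (\<lambda>\<omega>. f (pair_at k \<omega>)) = distr M borel (\<lambda>\<omega>. f (pair_at 0 \<omega>))"
    unfolding pair_distr by simp
qed

lemma pair_average_finite:
  fixes f :: "'a list list \<times> 'a list list \<Rightarrow> real"
  assumes f: "\<And>z. 0 \<le> f z" and fin: "pair_mean f < \<infinity>"
  shows "AE \<omega> in M. (\<lambda>n. (\<Sum>k<n. f (pair_at k \<omega>)) / real n) \<longlonglongrightarrow> enn2real (pair_mean f)"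
proof -
  have [measurable]: "(\<lambda>\<omega>. f (pair_at k \<omega>)) \<in> borel_measurable M" for k
    by (rule measurable_compose[OF pair_at_measurable]) simp
  have int: "integrable M (\<lambda>\<omega>. f (pair_at 0 \<omega>))"
    by (rule integrableI_nonneg) (use f fin pair_nn_integral[of f 0] in auto)
  have "expectation (\<lambda>\<omega>. f (pair_at 0 \<omega>)) = enn2real (pair_mean f)"
    using pair_nn_integral[of f 0] f by (subst integral_eq_nn_integral) auto
  then show ?thesis
    using iid_average_tendsto_expectation[OF pair_function_iid int] by simp
qed

lemma pair_average_infinite:
  fixes f :: "'a list list \<times> 'a list list \<Rightarrow> real"
  assumes f: "\<And>z. 0 \<le> f z" and inf: "pair_mean f = \<infinity>"
  shows "AE \<omega> in M. filterlim (\<lambda>n. (\<Sum>k<n. f (pair_at k \<omega>)) / real n) at_top sequentially"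
  by (rule iid_average_tendsto_infinity[OF pair_function_iid f]) (simp add: pair_nn_integral inf)

end

section \<open>Renewal limits\<close>

lemma interval_index:
  fixes T :: "nat \<Rightarrow> nat"
  assumes "\<And>m. T m < T (Suc m)"
  shows "\<exists>idx. (\<forall>n\<ge>T 0. T (idx n) \<le> n \<and> n < T (Suc (idx n))) \<and> filterlim idx at_top sequentially"
proof -
  have mono: "strict_mono T" using assms by (simp add: strict_mono_Suc_iff)
  define idx where "idx n = (LEAST m. n < T (Suc m))" for n
  have ex: "\<exists>m. n < T (Suc m)" for n
    using seq_suble[OF mono, of "Suc n"] by (intro exI[of _ n]) simp
  have up: "n < T (Suc (idx n))" for n unfolding idx_def by (rule LeastI_ex[OF ex])
  have low: "T (idx n) \<le> n" if "T 0 \<le> n" for n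
  proof (cases "idx n")
    case (Suc m)
    then have "\<not> n < T (Suc m)" using not_less_Least[of m "\<lambda>m. n < T (Suc m)"] by (simp add: idx_def)
    then show ?thesis using Suc by simp
  qed (use that in simp)
  have "filterlim idx at_top sequentially"
    unfolding filterlim_at_top
  proof
    fix Z
    show "eventually (\<lambda>n. Z \<le> idx n) sequentially"
      using eventually_ge_at_top[of "T Z"]
    proof eventually_elim
      case (elim n)
      then have "T Z < T (Suc (idx n))" using up[of n] by simp
      then show ?case using strict_mono_less[OF mono] by (simp add: less_Suc_eq_le)
    qed
  qed
  then show ?thesis using up low by (intro exI[of _ idx]) simp
qed

lemma ratio_Suc_tendsto:
  fixes S :: "nat \<Rightarrow> real"
  assumes "(\<lambda>m. S m / real m) \<longlonglongrightarrow> c"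
  shows "(\<lambda>m. S (Suc m) / real m) \<longlonglongrightarrow> c"
proof -
  have 1: "(\<lambda>m. S (Suc m) / real (Suc m)) \<longlonglongrightarrow> c" using assms by (rule LIMSEQ_Suc)
  have "(\<lambda>m. 1 + 1 / real m) \<longlonglongrightarrow> 1 + 0" by (intro tendsto_intros lim_const_over_n)
  then have "(\<lambda>m. S (Suc m) / real (Suc m) * (1 + 1 / real m)) \<longlonglongrightarrow> c * 1"
    using 1 by (intro tendsto_mult) simp_all
  moreover have "eventually (\<lambda>m. S (Suc m) / real (Suc m) * (1 + 1 / real m) = S (Suc m) / real m) sequentially"
    using eventually_gt_at_top[of 0]
  proof eventually_elim
    case (elim m)
    then have "1 + 1 / real m = real (Suc m) / real m" by (simp add: field_simps)
    then show ?case by simp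
  qed
  ultimately show ?thesis by (simp add: tendsto_cong)
qed

lemma renewal_ratio:
  fixes T :: "nat \<Rightarrow> nat"
  assumes T: "(\<lambda>m. real (T m) / real m) \<longlonglongrightarrow> D"
    and idx: "\<forall>n\<ge>T 0. T (idx n) \<le> n \<and> n < T (Suc (idx n))" "filterlim idx at_top sequentially"
  shows "(\<lambda>n. real n / real (idx n)) \<longlonglongrightarrow> D"
proof (rule tendsto_sandwich)
  show "(\<lambda>n. real (T (idx n)) / real (idx n)) \<longlonglongrightarrow> D"
    by (rule filterlim_compose[OF T idx(2)])
  show "(\<lambda>n. real (T (Suc (idx n))) / real (idx n)) \<longlonglongrightarrow> D"
    by (rule filterlim_compose[OF ratio_Suc_tendsto[OF T] idx(2)])
  have nb: "real (T (idx n)) \<le> real n" "real n \<le> real (T (Suc (idx n)))" if "T 0 \<le> n" for n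
    using idx(1) that by (simp_all add: less_imp_le)
  show "eventually (\<lambda>n. real (T (idx n)) / real (idx n) \<le> real n / real (idx n)) sequentially"
    using eventually_ge_at_top[of "T 0"]
    by eventually_elim (intro divide_right_mono nb of_nat_0_le_iff)
  show "eventually (\<lambda>n. real n / real (idx n) \<le> real (T (Suc (idx n))) / real (idx n)) sequentially"
    using eventually_ge_at_top[of "T 0"]
    by eventually_elim (intro divide_right_mono nb of_nat_0_le_iff)
qed

text \<open>Both the time and the sum are compared with the number of completed pairs.\<close>
lemma renewal_limit_finite:
  fixes T :: "nat \<Rightarrow> nat" and f H U :: "nat \<Rightarrow> real"
  assumes mono: "\<And>m. T m < T (Suc m)"
    and f: "\<And>m n. T m \<le> n \<Longrightarrow> n \<le> T (Suc m) \<Longrightarrow> H m \<le> f n \<and> f n \<le> H m + U m"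
    and T: "(\<lambda>m. real (T m) / real m) \<longlonglongrightarrow> D" "0 < D"
    and H: "(\<lambda>m. H m / real m) \<longlonglongrightarrow> \<mu>" and U: "(\<lambda>m. U m / real m) \<longlonglongrightarrow> 0"
  shows "(\<lambda>n. f n / real n) \<longlonglongrightarrow> \<mu> / D"
proof -
  obtain idx where idx: "\<forall>n\<ge>T 0. T (idx n) \<le> n \<and> n < T (Suc (idx n))" "filterlim idx at_top sequentially"
    using interval_index[of T, OF mono] by blast
  have nb: "T (idx n) \<le> n" "n \<le> T (Suc (idx n))" if "T 0 \<le> n" for n
    using idx(1) that by (auto intro: less_imp_le)
  have HU: "(\<lambda>m. H m / real m + U m / real m) \<longlonglongrightarrow> \<mu> + 0" by (rule tendsto_add[OF H U])
  have fi: "(\<lambda>n. f n / real (idx n)) \<longlonglongrightarrow> \<mu>"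
  proof (rule tendsto_sandwich)
    show "(\<lambda>n. H (idx n) / real (idx n)) \<longlonglongrightarrow> \<mu>" by (rule filterlim_compose[OF H idx(2)])
    show "(\<lambda>n. H (idx n) / real (idx n) + U (idx n) / real (idx n)) \<longlonglongrightarrow> \<mu>"
      using filterlim_compose[OF HU idx(2)] by simp
    show "eventually (\<lambda>n. H (idx n) / real (idx n) \<le> f n / real (idx n)) sequentially"
      using eventually_ge_at_top[of "T 0"]
      by eventually_elim (use f nb in \<open>auto intro!: divide_right_mono\<close>)
    show "eventually (\<lambda>n. f n / real (idx n) \<le> H (idx n) / real (idx n) + U (idx n) / real (idx n)) sequentially"
      using eventually_ge_at_top[of "T 0"]
      by eventually_elim (use f nb in \<open>auto simp: add_divide_distrib[symmetric] intro!: divide_right_mono\<close>)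
  qed
  have ni: "(\<lambda>n. real n / real (idx n)) \<longlonglongrightarrow> D" by (rule renewal_ratio[OF T(1) idx])
  have "(\<lambda>n. (f n / real (idx n)) / (real n / real (idx n))) \<longlonglongrightarrow> \<mu> / D"
    using T(2) by (intro tendsto_divide fi ni) simp
  moreover have "eventually (\<lambda>n. (f n / real (idx n)) / (real n / real (idx n)) = f n / real n) sequentially"
    using idx(2)[unfolded filterlim_at_top, rule_format, of 1]
    by eventually_elim simp
  ultimately show ?thesis by (rule Lim_transform_eventually)
qed

lemma renewal_limit_infinite:
  fixes T :: "nat \<Rightarrow> nat" and f H :: "nat \<Rightarrow> real"
  assumes mono: "\<And>m. T m < T (Suc m)"
    and f: "\<And>m n. T m \<le> n \<Longrightarrow> n \<le> T (Suc m) \<Longrightarrow> H m \<le> f n"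
    and T: "(\<lambda>m. real (T m) / real m) \<longlonglongrightarrow> D" "0 < D"
    and H: "filterlim (\<lambda>m. H m / real m) at_top sequentially"
  shows "filterlim (\<lambda>n. f n / real n) at_top sequentially"
proof -
  obtain idx where idx: "\<forall>n\<ge>T 0. T (idx n) \<le> n \<and> n < T (Suc (idx n))" "filterlim idx at_top sequentially"
    using interval_index[of T, OF mono] by blast
  have ni: "(\<lambda>n. inverse (real n / real (idx n))) \<longlonglongrightarrow> inverse D"
    using T(2) by (intro tendsto_inverse renewal_ratio[OF T(1) idx]) simp
  have Hi: "filterlim (\<lambda>n. H (idx n) / real (idx n)) at_top sequentially"
    by (rule filterlim_compose[OF H idx(2)])
  have "filterlim (\<lambda>n. inverse (real n / real (idx n)) * (H (idx n) / real (idx n))) at_top sequentially"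
    by (rule filterlim_tendsto_pos_mult_at_top[OF ni _ Hi]) (use T(2) in simp)
  then show ?thesis
  proof (rule filterlim_at_top_mono)
    show "eventually (\<lambda>n. inverse (real n / real (idx n)) * (H (idx n) / real (idx n)) \<le> f n / real n) sequentially"
      using idx(2)[unfolded filterlim_at_top, rule_format, of 1] eventually_ge_at_top[of "T 0"]
    proof eventually_elim
      case (elim n)
      have "H (idx n) \<le> f n" using f idx(1) elim(2) by (simp add: less_imp_le)
      then have "H (idx n) / real n \<le> f n / real n" by (rule divide_right_mono) simp
      then show ?case using elim(1) by simp
    qed
  qed
qed

context free_walk begin

section \<open>The rate of the weighted distance\<close>

lemma word_sum_nonneg: "(\<And>v. 0 \<le> L v) \<Longrightarrow> 0 \<le> word_sum L x"
  unfolding word_sum_def by (intro sum_list_nonneg) auto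

lemma word_sum_append: "word_sum L (x @ y) = word_sum L x + word_sum L y"
  by (simp add: word_sum_def)

lemma word_sum_step:
  assumes L: "\<And>v. 0 \<le> L v" and "tp x y \<noteq> 0" "y \<noteq> []"
  shows "word_sum L y \<le> word_sum L x + L (last y)"
  using assms(2)
proof (rule tp_nonzeroE)
  fix i u v w assume h: "x = u @ emb rt i v" "y = u @ emb rt i w"
  have u: "word_sum L u \<le> word_sum L x"
    using word_sum_nonneg[of L "emb rt i v"] L unfolding h(1) word_sum_append by simp
  show ?thesis
  proof (cases "w = rt i")
    case True
    then have "y = u" using h(2) by (simp add: emb_def)
    then show ?thesis using u L[of "last y"] by simp
  next
    case False
    then show ?thesis using u unfolding h(2) by (simp add: emb_def word_sum_def)
  qed
qed

lemma word_sum_seg: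
  assumes L: "\<And>v. 0 \<le> L v" and g: "good \<xi>" and ab: "a \<le> n"
    and ne: "\<And>y. y \<in> set (seg \<xi> a n) \<Longrightarrow> y \<noteq> []"
  shows "word_sum L (\<xi> n) \<le> word_sum L (\<xi> a) + (\<Sum>x\<leftarrow>seg \<xi> a n. L (last x))"
  using ab ne
proof (induction n rule: dec_induct)
  case base
  then show ?case by (simp add: seg_def)
next
  case (step n)
  have s: "seg \<xi> a (Suc n) = seg \<xi> a n @ [\<xi> (Suc n)]" by (rule seg_Suc) (use step in simp)
  have "tp (\<xi> n) (\<xi> (Suc n)) \<noteq> 0" using g by (simp add: good_def)
  moreover have "\<xi> (Suc n) \<noteq> []" using step.prems s by simp
  ultimately have "word_sum L (\<xi> (Suc n)) \<le> word_sum L (\<xi> n) + L (last (\<xi> (Suc n)))"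
    by (intro word_sum_step L)
  moreover have "word_sum L (\<xi> n) \<le> word_sum L (\<xi> a) + (\<Sum>x\<leftarrow>seg \<xi> a n. L (last x))"
    using step.prems s by (intro step.IH) simp
  ultimately show ?case by (simp add: s)
qed

definition last_sum :: "('a \<Rightarrow> real) \<Rightarrow> 'a list list \<Rightarrow> real" where
  "last_sum L b = (\<Sum>x\<leftarrow>b. L (last x))"

definition end_letter :: "('a \<Rightarrow> real) \<Rightarrow> 'a list list \<Rightarrow> real" where
  "end_letter L b = L (last (last b))"

lemma blk_last_sum:
  assumes "good \<xi>"
  shows "last_sum L (seg \<xi> (exit_time k \<xi>) (exit_time (Suc k) \<xi>)) = last_sum L (blk k \<xi>)"
proof -
  obtain i where "blk k \<xi> \<in> blocks i" by (rule blk_block[OF assms, of k])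
  then have "x \<noteq> []" if "x \<in> set (blk k \<xi>)" for x using that branch_ne by (auto simp: blocks_def)
  then show ?thesis unfolding seg_blk[OF assms] last_sum_def by (auto intro!: arg_cong[where f=sum_list])
qed

lemma word_sum_exit:
  assumes "good \<xi>"
  shows "word_sum L (\<xi> (exit_time (Suc k) \<xi>)) = word_sum L (\<xi> (exit_time k \<xi>)) + end_letter L (blk k \<xi>)"
proof -
  obtain i where b: "blk k \<xi> \<in> blocks i" by (rule blk_block[OF assms, of k])
  then have "length (last (blk k \<xi>)) = 1" by (simp add: blocks_def)
  then obtain v where "last (blk k \<xi>) = [v]" by (cases "last (blk k \<xi>)") auto
  then show ?thesis unfolding exit_word_Suc(1)[OF assms] end_letter_def by (simp add: word_sum_def)
qed

lemma length_blk: "length (blk k \<xi>) = exit_time (Suc k) \<xi> - exit_time k \<xi>"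
  by (simp add: blk_def)

text \<open>The word at the exit time remains a prefix, which gives the lower bound. Each later step adds
at most the last letter of the word it leads to.\<close>
lemma word_sum_between_exits:
  assumes L: "\<And>v. 0 \<le> L v" and g: "good \<xi>"
    and n: "exit_time (2 * m) \<xi> \<le> n" "n \<le> exit_time (2 * Suc m) \<xi>"
  shows "word_sum L (\<xi> (exit_time (2 * m) \<xi>)) \<le> word_sum L (\<xi> n)"
    and "word_sum L (\<xi> n) \<le> word_sum L (\<xi> (exit_time (2 * m) \<xi>)) + (last_sum L (blk (2 * m) \<xi>) + last_sum L (blk (2 * m + 1) \<xi>))"
proof -
  let ?a = "exit_time (2 * m) \<xi>" and ?c = "exit_time (Suc (2 * m)) \<xi>" and ?b = "exit_time (Suc (Suc (2 * m))) \<xi>"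
  have nb: "n \<le> ?b" using n(2) by simp
  have "word_sum L (\<xi> n) = word_sum L (\<xi> ?a) + word_sum L (drop (2 * m) (\<xi> n))"
    by (subst after_exit_split[OF g n(1)]) (rule word_sum_append)
  then show "word_sum L (\<xi> ?a) \<le> word_sum L (\<xi> n)"
    using word_sum_nonneg[of L "drop (2 * m) (\<xi> n)"] L by simp
  have ne: "y \<noteq> []" if "y \<in> set (seg \<xi> ?a n)" for y
    using that exit_time_after[OF g, of "2 * m"] unfolding set_seg by fastforce
  have "word_sum L (\<xi> n) \<le> word_sum L (\<xi> ?a) + last_sum L (seg \<xi> ?a n)"
    unfolding last_sum_def by (rule word_sum_seg[OF L g n(1) ne])
  also have "last_sum L (seg \<xi> ?a n) \<le> last_sum L (seg \<xi> ?a n) + last_sum L (seg \<xi> n ?b)"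
    unfolding last_sum_def using L by (auto intro!: sum_list_nonneg)
  also have "\<dots> = last_sum L (seg \<xi> ?a ?b)"
    unfolding seg_append[OF n(1) nb, symmetric] by (simp add: last_sum_def)
  also have "\<dots> = last_sum L (seg \<xi> ?a ?c) + last_sum L (seg \<xi> ?c ?b)"
    unfolding seg_append[OF less_imp_le[OF exit_time_mono[OF g]] less_imp_le[OF exit_time_mono[OF g]], symmetric]
    by (simp add: last_sum_def)
  also have "\<dots> = last_sum L (blk (2 * m) \<xi>) + last_sum L (blk (2 * m + 1) \<xi>)"
    unfolding blk_last_sum[OF g] by simp
  finally show "word_sum L (\<xi> n) \<le> word_sum L (\<xi> ?a) + (last_sum L (blk (2 * m) \<xi>) + last_sum L (blk (2 * m + 1) \<xi>))"
    by simp
qed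

end

context random_walk begin

lemma block_bounds_ex:
  "\<exists>z C. 1 < z \<and> C < \<infinity> \<and> (\<forall>j\<in>{1,2}. msum (wp (ennreal z) []) (blocks j) < \<infinity>) \<and>
    (\<forall>j\<in>{1,2}. \<forall>v\<in>N j. reach_mass j [v] \<le> C)"
  by (rule block_bounds) blast

definition pair_fun :: "('a list list \<Rightarrow> real) \<Rightarrow> 'a list list \<times> 'a list list \<Rightarrow> real" where
  "pair_fun g z = g (fst z) + g (snd z)"

definition block_mean :: "('a list list \<Rightarrow> real) \<Rightarrow> nat \<Rightarrow> ennreal" where
  "block_mean g i = msum (\<lambda>b. wp 1 [] b * ennreal (g b)) (blocks i)"

lemma pair_fun_at: "pair_fun g (pair_at k \<omega>) = g (block_at (2 * k) \<omega>) + g (block_at (2 * k + 1) \<omega>)"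
  by (simp add: pair_fun_def pair_at_def)

lemma pair_mean_eq:
  assumes g: "\<And>b. 0 \<le> g b"
  shows "pair_mean (pair_fun g) = block_mean g 1 * msum (wp 1 []) (blocks 2) + msum (wp 1 []) (blocks 1) * block_mean g 2"
proof -
  have "pair_mean (pair_fun g) = msum (\<lambda>z. (\<lambda>(a, c). (wp 1 [] a * ennreal (g a)) * wp 1 [] c) z
      + (\<lambda>(a, c). wp 1 [] a * (wp 1 [] c * ennreal (g c))) z) (blocks 1 \<times> blocks 2)"
    unfolding pair_mean_def pairs_def using g
    by (intro msum_cong) (auto simp: pair_weight_def pair_fun_def wp_1 distrib_left distrib_right ac_simps)
  also have "\<dots> = block_mean g 1 * msum (wp 1 []) (blocks 2) + msum (wp 1 []) (blocks 1) * block_mean g 2"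
    unfolding msum_add msum_Times block_mean_def ..
  finally show ?thesis .
qed

text \<open>The masses of the two block families are finite, and positive because their product is the total
mass \<open>1\<close> of the pairs.\<close>
lemma pair_mean_finite_iff:
  assumes g: "\<And>b. 0 \<le> g b"
  shows "pair_mean (pair_fun g) < \<infinity> \<longleftrightarrow> block_mean g 1 < \<infinity> \<and> block_mean g 2 < \<infinity>"
proof -
  let ?w1 = "msum (wp 1 []) (blocks 1)" and ?w2 = "msum (wp 1 []) (blocks 2)"
  have "msum pair_weight pairs = msum (\<lambda>(a, c). wp 1 [] a * wp 1 [] c) (blocks 1 \<times> blocks 2)"
    unfolding pairs_def by (intro msum_cong) (auto simp: pair_weight_def wp_1)
  then have "?w1 * ?w2 = 1"
    using law_normalized(2) unfolding pair_mass_def msum_Times by simp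
  then have "?w1 \<noteq> 0" "?w2 \<noteq> 0" by auto
  moreover have "?w1 < \<infinity>" "?w2 < \<infinity>" using blocks_mass_1 by simp_all
  ultimately show ?thesis
    unfolding pair_mean_eq[OF g] by (auto simp: ennreal_mult_less_top ennreal_add_eq_top less_top)
qed

lemma length_mean_finite: "pair_mean (pair_fun (\<lambda>b. real (length b))) < \<infinity>"
proof -
  obtain z C where z0: "1 < z" "C < \<infinity>" "\<forall>j\<in>{1,2}. msum (wp (ennreal z) []) (blocks j) < \<infinity>"
    "\<forall>j\<in>{1,2}. \<forall>v\<in>N j. reach_mass j [v] \<le> C" using block_bounds_ex by blast
  have z: "1 < z" "C < \<infinity>" "\<And>j. j \<in> {1,2} \<Longrightarrow> msum (wp (ennreal z) []) (blocks j) < \<infinity>"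
    "\<And>j v. j \<in> {1,2} \<Longrightarrow> v \<in> N j \<Longrightarrow> reach_mass j [v] \<le> C" using z0 by blast+
  have "block_mean (\<lambda>b. real (length b)) j < \<infinity>" if "j \<in> {1,2}" for j
    using length_moment_finite[OF z(1) z(3)[OF that]] unfolding block_mean_def by (simp add: ennreal_of_nat_eq_real_of_nat)
  then show ?thesis by (subst pair_mean_finite_iff) auto
qed

lemma last_sum_mean_finite:
  assumes L: "\<And>v. 0 \<le> L v" and fin: "pair_mean (pair_fun (end_letter L)) < \<infinity>"
  shows "pair_mean (pair_fun (last_sum L)) < \<infinity>"
proof -
  obtain z C where z0: "1 < z" "C < \<infinity>" "\<forall>j\<in>{1,2}. msum (wp (ennreal z) []) (blocks j) < \<infinity>"
    "\<forall>j\<in>{1,2}. \<forall>v\<in>N j. reach_mass j [v] \<le> C" using block_bounds_ex by blast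
  have z: "1 < z" "C < \<infinity>" "\<And>j. j \<in> {1,2} \<Longrightarrow> msum (wp (ennreal z) []) (blocks j) < \<infinity>"
    "\<And>j v. j \<in> {1,2} \<Longrightarrow> v \<in> N j \<Longrightarrow> reach_mass j [v] \<le> C" using z0 by blast+
  have e0: "0 \<le> end_letter L b" for b using L by (simp add: end_letter_def)
  have l0: "0 \<le> last_sum L b" for b unfolding last_sum_def using L by (auto intro!: sum_list_nonneg)
  have em: "letter_mean (\<lambda>v. ennreal (L v)) j = block_mean (end_letter L) j" for j
    unfolding letter_mean_def block_mean_def end_letter_def ..
  have lm: "letter_mean (\<lambda>v. ennreal (L v)) j < \<infinity>" if "j \<in> {1,2}" for j
    using fin that unfolding pair_mean_finite_iff[of "end_letter L", OF e0] em by auto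
  have ls: "ennreal (last_sum L b) = letter_sum (\<lambda>v. ennreal (L v)) b" for b
    unfolding last_sum_def letter_sum_def
  proof (induction b)
    case (Cons a b)
    have "0 \<le> (\<Sum>x\<leftarrow>b. L (last x))" by (rule sum_list_nonneg) (use L in auto)
    then show ?case using Cons L by (simp add: ennreal_plus)
  qed simp
  have "block_mean (last_sum L) j < \<infinity>" if j: "j \<in> {1,2}" for j
    using letter_sum_mass_finite[OF j z(2) z(4)[OF j] lm length_moment_finite[OF z(1) z(3)[OF j]]]
    unfolding block_mean_def ls .
  then show ?thesis by (subst pair_mean_finite_iff[OF l0]) auto
qed

lemma exit_time_sum:
  assumes "good (traj \<omega>)"
  shows "real (exit_time (2 * m) (traj \<omega>)) = real (exit_time 0 (traj \<omega>)) + (\<Sum>k<m. pair_fun (\<lambda>b. real (length b)) (pair_at k \<omega>))"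
proof (induction m)
  case (Suc m)
  have "exit_time (2 * m) (traj \<omega>) < exit_time (Suc (2 * m)) (traj \<omega>)"
    "exit_time (Suc (2 * m)) (traj \<omega>) < exit_time (Suc (Suc (2 * m))) (traj \<omega>)"
    by (rule exit_time_mono[OF assms])+
  then show ?case using Suc unfolding pair_fun_at block_at_def length_blk by simp
qed simp

lemma word_sum_exit_sum:
  assumes "good (traj \<omega>)"
  shows "word_sum L (X (exit_time (2 * m) (traj \<omega>)) \<omega>) = (\<Sum>k<m. pair_fun (end_letter L) (pair_at k \<omega>))"
proof (induction m)
  case 0
  have "X (exit_time 0 (traj \<omega>)) \<omega> = []" using exit_time_length[OF assms, of 0] by simp
  then show ?case by (simp add: word_sum_def)
next
  case (Suc m)
  show ?case
    using Suc word_sum_exit[OF assms, of L "2 * m"] word_sum_exit[OF assms, of L "Suc (2 * m)"]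
    unfolding pair_fun_at block_at_def by simp
qed

text \<open>The mean length of a pair is positive because an exit time increases by at least one per pair.\<close>
lemma exit_rate:
  obtains D where "0 < D"
    "AE \<omega> in M. (\<lambda>m. real (exit_time (2 * m) (traj \<omega>)) / real m) \<longlonglongrightarrow> D"
proof -
  let ?D = "enn2real (pair_mean (pair_fun (\<lambda>b. real (length b))))"
  have len0: "0 \<le> pair_fun (\<lambda>b. real (length b)) z" for z by (simp add: pair_fun_def)
  have lim: "AE \<omega> in M. (\<lambda>m. real (exit_time (2 * m) (traj \<omega>)) / real m) \<longlonglongrightarrow> ?D \<and> good (traj \<omega>)"
    using pair_average_finite[OF len0 length_mean_finite] trajectory_good
  proof eventually_elim
    case (elim \<omega>)
    have "(\<lambda>m. real (exit_time 0 (traj \<omega>)) / real m + (\<Sum>k<m. pair_fun (\<lambda>b. real (length b)) (pair_at k \<omega>)) / real m) \<longlonglongrightarrow> 0 + ?D"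
      by (rule tendsto_add[OF lim_const_over_n elim(1)])
    then show ?case using elim(2) unfolding exit_time_sum[OF elim(2)] by (simp add: add_divide_distrib)
  qed
  have "1 \<le> ?D"
  proof -
    obtain \<omega> where w: "(\<lambda>m. real (exit_time (2 * m) (traj \<omega>)) / real m) \<longlonglongrightarrow> ?D" "good (traj \<omega>)"
      using eventually_happens'[OF _ lim] ae_filter_bot by blast
    have ge: "m \<le> exit_time (2 * m) (traj \<omega>)" for m
    proof (induction m)
      case (Suc m)
      have "exit_time (2 * m) (traj \<omega>) < exit_time (Suc (2 * m)) (traj \<omega>)"
        "exit_time (Suc (2 * m)) (traj \<omega>) < exit_time (Suc (Suc (2 * m))) (traj \<omega>)"
        by (rule exit_time_mono[OF w(2)])+
      then show ?case using Suc by simp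
    qed simp
    have "eventually (\<lambda>m. 1 \<le> real (exit_time (2 * m) (traj \<omega>)) / real m) sequentially"
      using eventually_gt_at_top[of 0]
    proof eventually_elim
      case (elim m)
      then show ?case using ge[of m] by (simp add: le_divide_eq)
    qed
    then show ?thesis by (rule tendsto_lowerbound[OF w(1)]) simp
  qed
  then show ?thesis using that[of ?D] lim by (auto elim: AE_mp)
qed

lemma exit_pairs_increasing:
  "good (traj \<omega>) \<Longrightarrow> exit_time (2 * m) (traj \<omega>) < exit_time (2 * Suc m) (traj \<omega>)"
  using exit_time_mono[of "traj \<omega>" "2 * m"] exit_time_mono[of "traj \<omega>" "Suc (2 * m)"] by simp

text \<open>The detour within the current pair is a term of a convergent average, hence negligible against the
number of pairs.\<close>
theorem word_sum_rate_finite: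
  assumes L: "\<And>v. 0 \<le> L v" and fin: "pair_mean (pair_fun (end_letter L)) < \<infinity>"
  shows "\<exists>c. AE \<omega> in M. (\<lambda>n. word_sum L (X n \<omega>) / real n) \<longlonglongrightarrow> c"
proof -
  obtain D where D: "0 < D" "AE \<omega> in M. (\<lambda>m. real (exit_time (2 * m) (traj \<omega>)) / real m) \<longlonglongrightarrow> D"
    by (rule exit_rate)
  let ?mu = "enn2real (pair_mean (pair_fun (end_letter L)))"
  have e0: "0 \<le> pair_fun (end_letter L) z" and l0: "0 \<le> pair_fun (last_sum L) z" for z
    using L by (auto simp: end_letter_def last_sum_def pair_fun_def intro!: add_nonneg_nonneg sum_list_nonneg)
  have "AE \<omega> in M. (\<lambda>n. word_sum L (X n \<omega>) / real n) \<longlonglongrightarrow> ?mu / D"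
    using D(2) pair_average_finite[OF e0 fin] pair_average_finite[OF l0 last_sum_mean_finite[OF L fin]] trajectory_good
  proof eventually_elim
    case (elim \<omega>)
    let ?S = "\<lambda>m. \<Sum>k<m. pair_fun (last_sum L) (pair_at k \<omega>)"
    have "(\<lambda>m. ?S (Suc m) / real m - ?S m / real m) \<longlonglongrightarrow> enn2real (pair_mean (pair_fun (last_sum L))) - enn2real (pair_mean (pair_fun (last_sum L)))"
      by (rule tendsto_diff[OF ratio_Suc_tendsto[OF elim(3)] elim(3)])
    then have U: "(\<lambda>m. pair_fun (last_sum L) (pair_at m \<omega>) / real m) \<longlonglongrightarrow> 0"
      by (simp add: diff_divide_distrib[symmetric])
    show ?case
    proof (rule renewal_limit_finite[OF exit_pairs_increasing[OF elim(4)] _ elim(1) D(1) elim(2) U])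
      fix m n assume n: "exit_time (2 * m) (traj \<omega>) \<le> n" "n \<le> exit_time (2 * Suc m) (traj \<omega>)"
      show "(\<Sum>k<m. pair_fun (end_letter L) (pair_at k \<omega>)) \<le> word_sum L (X n \<omega>) \<and>
        word_sum L (X n \<omega>) \<le> (\<Sum>k<m. pair_fun (end_letter L) (pair_at k \<omega>)) + pair_fun (last_sum L) (pair_at m \<omega>)"
        using word_sum_between_exits[where L=L, OF L elim(4) n]
        unfolding word_sum_exit_sum[OF elim(4)] pair_fun_at block_at_def by simp
    qed
  qed
  then show ?thesis by blast
qed

theorem word_sum_rate_infinite:
  assumes L: "\<And>v. 0 \<le> L v" and inf: "pair_mean (pair_fun (end_letter L)) = \<infinity>"
  shows "AE \<omega> in M. filterlim (\<lambda>n. word_sum L (X n \<omega>) / real n) at_top sequentially"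
proof -
  obtain D where D: "0 < D" "AE \<omega> in M. (\<lambda>m. real (exit_time (2 * m) (traj \<omega>)) / real m) \<longlonglongrightarrow> D"
    by (rule exit_rate)
  have e0: "0 \<le> pair_fun (end_letter L) z" for z
    using L by (auto simp: end_letter_def pair_fun_def intro!: add_nonneg_nonneg)
  show ?thesis
    using D(2) pair_average_infinite[OF e0 inf] trajectory_good
  proof eventually_elim
    case (elim \<omega>)
    show ?case
    proof (rule renewal_limit_infinite[OF exit_pairs_increasing[OF elim(3)] _ elim(1) D(1) elim(2)])
      fix m n assume n: "exit_time (2 * m) (traj \<omega>) \<le> n" "n \<le> exit_time (2 * Suc m) (traj \<omega>)"
      show "(\<Sum>k<m. pair_fun (end_letter L) (pair_at k \<omega>)) \<le> word_sum L (X n \<omega>)"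
        using word_sum_between_exits(1)[where L=L, OF L elim(3) n] unfolding word_sum_exit_sum[OF elim(3)] .
    qed
  qed
qed

text \<open>The maximum with \<open>0\<close> changes nothing on the letters of a word and makes the letter function
nonnegative everywhere.\<close>
lemma path_dist_eq:
  assumes W: "nonneg_weight W"
  shows "AE \<omega> in M. \<forall>n. path_dist V rt p \<alpha> (ew W) (map (\<lambda>k. X k \<omega>) [0..<Suc n])
    = ereal (word_sum (\<lambda>v. max 0 (fdist W v)) (X n \<omega>))"
  using X_0 AE_space
proof eventually_elim
  case (elim \<omega>)
  show ?case
  proof
    fix n
    have x: "X n \<omega> \<in> FP" by (rule X_FP[OF elim(2)])
    have "hd (map (\<lambda>k. X k \<omega>) [0..<Suc n]) = []" using elim(1) by (simp add: hd_map hd_upt del: upt_Suc)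
    moreover have "last (map (\<lambda>k. X k \<omega>) [0..<Suc n]) = X n \<omega>" by simp
    moreover have "word_sum (fdist W) (X n \<omega>) = word_sum (\<lambda>v. max 0 (fdist W v)) (X n \<omega>)"
    proof -
      have "fdist W a = max 0 (fdist W a)" if "a \<in> set (X n \<omega>)" for a
        using fdist_nonneg[OF W letter_type_in[of a], of a] FP_letter_V[OF x that] by simp
      then show ?thesis unfolding word_sum_def by (intro arg_cong[where f=sum_list] map_cong refl)
    qed
    ultimately show "path_dist V rt p \<alpha> (ew W) (map (\<lambda>k. X k \<omega>) [0..<Suc n])
      = ereal (word_sum (\<lambda>v. max 0 (fdist W v)) (X n \<omega>))"
      unfolding path_dist_def using weight_dist_word_sum[OF W x] by simp
  qed
qed

text \<open>The growth condition is used with the rate \<open>ln z\<close>, where \<open>z\<close> is a point at which the block lengths still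
have a finite generating function.\<close>
lemma end_letter_mean_finite:
  assumes W: "nonneg_weight W"
    and growth: "\<forall>e :: nat \<Rightarrow> 'a \<times> 'a.
          (\<forall>n\<ge>1. e n \<in> factor_edges V p 1 \<union> factor_edges V p 2 \<and>
                  graph_dist V rt p \<alpha> [] (start rt (e n)) = enat n) \<longrightarrow>
          (\<forall>l::real. l > 0 \<longrightarrow> limsup (\<lambda>n. ereal (\<bar>W (e n)\<bar> / exp (l * real n))) = 0)"
    and bdd: "\<And>n::nat. bdd_above (W ` {e \<in> factor_edges V p 1 \<union> factor_edges V p 2.
                graph_dist V rt p \<alpha> [] (start rt e) = enat n})"
  shows "pair_mean (pair_fun (end_letter (\<lambda>v. max 0 (fdist W v)))) < \<infinity>"
proof -
  obtain z C where z0: "1 < z" "C < \<infinity>" "\<forall>j\<in>{1,2}. msum (wp (ennreal z) []) (blocks j) < \<infinity>"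
    "\<forall>j\<in>{1,2}. \<forall>v\<in>N j. reach_mass j [v] \<le> C" using block_bounds_ex by blast
  have z: "1 < z" "C < \<infinity>" "\<And>j. j \<in> {1,2} \<Longrightarrow> msum (wp (ennreal z) []) (blocks j) < \<infinity>"
    "\<And>j v. j \<in> {1,2} \<Longrightarrow> v \<in> N j \<Longrightarrow> reach_mass j [v] \<le> C" using z0 by blast+
  have l: "0 < ln z" using z(1) by simp
  obtain B where B: "0 \<le> B" "\<And>i v w. i \<in> {1,2} \<Longrightarrow> (v, w) \<in> factor_edges V p i \<Longrightarrow> W (v, w) \<le> B * exp (ln z * real (steps v))"
    using weight_growth_bound[OF W l _ bdd] growth l by blast
  have "exp (ln z * real m) = z ^ m" for m
    using z(1) by (simp add: mult.commute[of "ln z"] exp_of_nat_mult)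
  then have B': "W (v, w) \<le> B * z ^ steps v" if "i \<in> {1,2}" "(v, w) \<in> factor_edges V p i" for i v w
    using B(2)[OF that] by simp
  have Lb: "max 0 (fdist W v) \<le> B / (z - 1) * z ^ steps v" if "i \<in> {1,2}" "v \<in> V i" for i v
    using fdist_growth[OF W z(1) B(1) B' that] fdist_nonneg[OF W that] z(1) by (simp add: field_simps)
  have "letter_mean (\<lambda>v. ennreal (max 0 (fdist W v))) i < \<infinity>" if i: "i \<in> {1,2}" for i
    by (rule letter_mean_finite[OF z(1) z(3)[OF i] i _ Lb[OF i]]) (use B z in auto)
  then have "block_mean (end_letter (\<lambda>v. max 0 (fdist W v))) i < \<infinity>" if i: "i \<in> {1,2}" for i
    using i unfolding letter_mean_def block_mean_def end_letter_def by blast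
  then show ?thesis by (subst pair_mean_finite_iff) (auto simp: end_letter_def)
qed

end

theorem theorem4p12:
  fixes V :: "nat \<Rightarrow> 'a set" and rt :: "nat \<Rightarrow> 'a"
    and p :: "nat \<Rightarrow> 'a \<Rightarrow> 'a \<Rightarrow> real" and \<alpha> :: real
    and M :: "'w measure" and X :: "nat \<Rightarrow> 'w \<Rightarrow> 'a list"
    and W\<^sub>0 :: "'a \<times> 'a \<Rightarrow> real"
  assumes setting: "free_product_setting V rt p \<alpha>"
    and walk: "markov_chain M (free_product V rt) (trans_prob V rt p \<alpha>) [] X"
    and radius: "conv_radius (\<lambda>n. measure M {\<omega>\<in>space M. X n \<omega> = []}) > 1"
    and nonneg: "\<forall>e\<in>factor_edges V p 1 \<union> factor_edges V p 2. 0 \<le> W\<^sub>0 e"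
    and growth: "\<forall>e :: nat \<Rightarrow> 'a \<times> 'a.
          (\<forall>n\<ge>1. e n \<in> factor_edges V p 1 \<union> factor_edges V p 2 \<and>
                  graph_dist V rt p \<alpha> [] (start rt (e n)) = enat n) \<longrightarrow>
          (\<forall>l::real. l > 0 \<longrightarrow> limsup (\<lambda>n. ereal (\<bar>W\<^sub>0 (e n)\<bar> / exp (l * real n))) = 0)"
  shows "\<exists>c :: ereal.
           (AE \<omega> in M.
              (\<lambda>n. path_dist V rt p \<alpha> (extend_weight V rt p W\<^sub>0) (map (\<lambda>k. X k \<omega>) [0..<Suc n])
                     / ereal (real n)) \<longlonglongrightarrow> c) \<and>
           ((\<forall>n::nat. bdd_above (W\<^sub>0 ` {e \<in> factor_edges V p 1 \<union> factor_edges V p 2.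
                graph_dist V rt p \<alpha> [] (start rt e) = enat n})) \<longrightarrow> c < \<infinity>)"
proof -
  interpret random_walk V rt p \<alpha> M X
    by unfold_locales (use setting walk radius in auto)
  have W: "nonneg_weight W\<^sub>0" using nonneg by (simp add: nonneg_weight_def)
  \<comment> \<open>nonnegative on all of the type, and equal to the distance on letters\<close>
  define L where "L v = max 0 (fdist W\<^sub>0 v)" for v
  have L: "0 \<le> L v" for v by (simp add: L_def)
  let ?d = "\<lambda>\<omega> n. path_dist V rt p \<alpha> (extend_weight V rt p W\<^sub>0) (map (\<lambda>k. X k \<omega>) [0..<Suc n]) / ereal (real n)"
  have d: "AE \<omega> in M. \<forall>n>0. ?d \<omega> n = ereal (word_sum L (X n \<omega>) / real n)"
    using path_dist_eq[OF W] unfolding L_def[symmetric] by eventually_elim simp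
  show ?thesis
  proof (cases "pair_mean (pair_fun (end_letter L)) < \<infinity>")
    case True
    obtain c where c: "AE \<omega> in M. (\<lambda>n. word_sum L (X n \<omega>) / real n) \<longlonglongrightarrow> c"
      using word_sum_rate_finite[OF L True] by blast
    have "AE \<omega> in M. ?d \<omega> \<longlonglongrightarrow> ereal c"
      using c d
    proof eventually_elim
      case (elim \<omega>)
      have "(\<lambda>n. ereal (word_sum L (X n \<omega>) / real n)) \<longlonglongrightarrow> ereal c" using elim(1) by simp
      moreover have "eventually (\<lambda>n. ereal (word_sum L (X n \<omega>) / real n) = ?d \<omega> n) sequentially"
        using eventually_gt_at_top[of 0] by eventually_elim (use elim(2) in simp)
      ultimately show ?case by (rule Lim_transform_eventually)
    qed
    then show ?thesis by (intro exI[of _ "ereal c"]) simp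
  next
    case False
    then have inf: "pair_mean (pair_fun (end_letter L)) = \<infinity>" by (simp add: less_top[symmetric])
    have lim: "AE \<omega> in M. ?d \<omega> \<longlonglongrightarrow> \<infinity>"
      using word_sum_rate_infinite[OF L inf] d
    proof eventually_elim
      case (elim \<omega>)
      have "(\<lambda>n. ereal (word_sum L (X n \<omega>) / real n)) \<longlonglongrightarrow> \<infinity>"
        using elim(1) by (simp add: tendsto_PInfty_eq_at_top)
      moreover have "eventually (\<lambda>n. ereal (word_sum L (X n \<omega>) / real n) = ?d \<omega> n) sequentially"
        using eventually_gt_at_top[of 0] by eventually_elim (use elim(2) in simp)
      ultimately show ?case by (rule Lim_transform_eventually)
    qed
    have unb: "\<not> (\<forall>n::nat. bdd_above (W\<^sub>0 ` {e \<in> factor_edges V p 1 \<union> factor_edges V p 2.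
                graph_dist V rt p \<alpha> [] (start rt e) = enat n}))"
    proof
      assume "\<forall>n::nat. bdd_above (W\<^sub>0 ` {e \<in> factor_edges V p 1 \<union> factor_edges V p 2.
                graph_dist V rt p \<alpha> [] (start rt e) = enat n})"
      then have "pair_mean (pair_fun (end_letter L)) < \<infinity>"
        unfolding L_def[abs_def] by (intro end_letter_mean_finite[OF W growth]) (rule spec)
      then show False using inf by simp
    qed
    show ?thesis
    proof (rule exI[of _ "\<infinity>"], rule conjI[OF lim], rule impI)
      assume "\<forall>n::nat. bdd_above (W\<^sub>0 ` {e \<in> factor_edges V p 1 \<union> factor_edges V p 2.
                graph_dist V rt p \<alpha> [] (start rt e) = enat n})"
      with unb show "(\<infinity>::ereal) < \<infinity>" by (rule notE)
    qed
  qed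
qed

end
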